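(* Let $E$ be a Banach space with topological dual $E'$, let $E_w$ denote $E$ endowed with the weak topology $\sigma(E,E')$, and let $B_w$ denote the closed unit ball of $E$ with the topology induced from $E_w$. The following conditions are equivalent (where in (i) the word "separable" may be included or omitted, i.e. both versions of (i) are equivalent to all the other conditions): (i) $B_w$ is (separable) metrizable; (ii) $B_w$ is first countable; (iii) $B_w$ has the strong Pytkeev property; (iv) $B_w$ is an $\aleph$-space and a $k$-space; (v) $B_w$ has countable $cs^\ast$-character and is a $k$-space; (vi) $E_w$ is an $\aleph$-space and $B_w$ is a $k$-space; (vii) $E_w$ has countable $cs^\ast$-character and $B_w$ is a $k$-space; (viii) $E_w$ has countable $cs^\ast$-character and $E$ contains no isomorphic copy of $\ell_1$; (ix) $E'$ is (norm) separable.
   Context: A topological space $X$ has the strong Pytkeev property if for each $x\in X$ there exists a countable family $\mathcal{D}$ of subsets of $X$ such that for each neighborhood $U$ of $x$ and each $A\subset X$ with $x\in\overline{A}\setminus A$ there is $D\in\mathcal{D}$ such that $D\subset U$ and $D\cap A$ is infinite. A family $\mathcal{N}$ of subsets of $X$ is a $k$-network if for any open $U\subset X$ and compact $K\subset U$ there is a finite subfamily $\mathcal{F}\subset\mathcal{N}$ such that $K\subset\bigcup\mathcal{F}\subset U$. $X$ is an $\aleph$-space if it is regular (including $T_1$) and has a $\sigma$-locally finite $k$-network (i.e. a $k$-network that is a countable union of locally finite families). $X$ has countable $cs^\ast$-character if for each $x\in X$ there is a countable family $\mathcal{D}$ of subsets of $X$ such that for each sequence in $X$ converging to $x$ and each neighborhood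 $U$ of $x$ there is $D\in\mathcal{D}$ such that $D\subset U$ and $D$ contains infinitely many elements of that sequence (i.e. the $n$-th term lies in $D$ for infinitely many indices $n$). A Hausdorff space $X$ is a $k$-space if a set $A\subset X$ is closed whenever $A\cap K$ is closed in $K$ for every compact $K\subset X$. *)

theory Defs
  imports "HOL-Analysis.Analysis"
begin

section \<open>Topological notions\<close>

text \<open>Neighbourhoods need not be open.\<close>

definition nbhd_in :: "'a topology \<Rightarrow> 'a \<Rightarrow> 'a set \<Rightarrow> bool" where
  "nbhd_in X x U \<longleftrightarrow> U \<subseteq> topspace X \<and> x \<in> X interior_of U"

definition strong_Pytkeev_space :: "'a topology \<Rightarrow> bool" where
  "strong_Pytkeev_space X \<longleftrightarrow>
     (\<forall>x \<in> topspace X. \<exists>\<D>. countable \<D> \<and> (\<forall>D \<in> \<D>. D \<subseteq> topspace X) \<and>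
        (\<forall>U A. nbhd_in X x U \<and> A \<subseteq> topspace X \<and> x \<in> X closure_of A - A \<longrightarrow>
               (\<exists>D \<in> \<D>. D \<subseteq> U \<and> infinite (D \<inter> A))))"

definition k_network :: "'a topology \<Rightarrow> 'a set set \<Rightarrow> bool" where
  "k_network X \<N> \<longleftrightarrow>
     (\<forall>N \<in> \<N>. N \<subseteq> topspace X) \<and>
     (\<forall>U K. openin X U \<and> compactin X K \<and> K \<subseteq> U \<longrightarrow>
            (\<exists>\<F>. finite \<F> \<and> \<F> \<subseteq> \<N> \<and> K \<subseteq> \<Union>\<F> \<and> \<Union>\<F> \<subseteq> U))"

definition sigma_locally_finite_in :: "'a topology \<Rightarrow> 'a set set \<Rightarrow> bool" where
  "sigma_locally_finite_in X \<N> \<longleftrightarrow>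
     (\<exists>\<L> :: nat \<Rightarrow> 'a set set. (\<forall>n. locally_finite_in X (\<L> n)) \<and> \<N> = (\<Union>n. \<L> n))"

definition aleph_space :: "'a topology \<Rightarrow> bool" where
  "aleph_space X \<longleftrightarrow>
     regular_space X \<and> t1_space X \<and>
     (\<exists>\<N>. k_network X \<N> \<and> sigma_locally_finite_in X \<N>)"

text \<open>Terms of a sequence are counted by index, so a sequence that takes the same
  value infinitely often is covered as well.\<close>

definition countable_cs_star_character :: "'a topology \<Rightarrow> bool" where
  "countable_cs_star_character X \<longleftrightarrow>
     (\<forall>x \<in> topspace X. \<exists>\<D>. countable \<D> \<and> (\<forall>D \<in> \<D>. D \<subseteq> topspace X) \<and>
        (\<forall>s U. range s \<subseteq> topspace X \<and> limitin X s x sequentially \<and> nbhd_in X x U \<longrightarrow>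
               (\<exists>D \<in> \<D>. D \<subseteq> U \<and> infinite {n :: nat. s n \<in> D})))"


section \<open>The weak topology\<close>

text \<open>The coarsest topology on the underlying set of the space for which every
  functional in the (real) topological dual is continuous.\<close>

definition weak_topology :: "'a::real_normed_vector topology" where
  "weak_topology =
     topology_generated_by {blinfun_apply f -` U | (f :: 'a \<Rightarrow>\<^sub>L real) U. open U}"

definition weak_unit_ball :: "'a::real_normed_vector topology" where
  "weak_unit_ball = subtopology weak_topology (cball 0 1)"

lemma topspace_weak_topology [simp]:
  "topspace (weak_topology :: 'a::real_normed_vector topology) = UNIV"
proof -
  have "UNIV \<in> {blinfun_apply f -` U | (f :: 'a \<Rightarrow>\<^sub>L real) U. open U}"
    by (rule CollectI, intro exI[of _ 0] exI[of _ UNIV]) auto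
  then show ?thesis
    unfolding weak_topology_def topology_generated_by_topspace by blast
qed

lemma topspace_weak_unit_ball [simp]:
  "topspace (weak_unit_ball :: 'a::real_normed_vector topology) = cball 0 1"
  by (simp add: weak_unit_ball_def)


section \<open>Isomorphic copies of the sequence space of absolutely summable sequences\<close>

definition ell1 :: "(nat \<Rightarrow> real) set" where
  "ell1 = {x. summable (\<lambda>n. \<bar>x n\<bar>)}"

definition ell1_norm :: "(nat \<Rightarrow> real) \<Rightarrow> real" where
  "ell1_norm x = (\<Sum>n. \<bar>x n\<bar>)"

text \<open>A map that is linear on \<^const>\<open>ell1\<close>, bounded, and bounded below, i.e. an
  isomorphism of normed spaces from \<^const>\<open>ell1\<close> onto its image. The values of
  the map outside \<^const>\<open>ell1\<close> are irrelevant.\<close>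

definition ell1_isomorphic_embedding :: "((nat \<Rightarrow> real) \<Rightarrow> 'a::real_normed_vector) \<Rightarrow> bool" where
  "ell1_isomorphic_embedding T \<longleftrightarrow>
     (\<forall>x \<in> ell1. \<forall>y \<in> ell1. T (\<lambda>n. x n + y n) = T x + T y) \<and>
     (\<forall>c. \<forall>x \<in> ell1. T (\<lambda>n. c * x n) = c *\<^sub>R T x) \<and>
     (\<exists>a b. 0 < a \<and> (\<forall>x \<in> ell1. a * ell1_norm x \<le> norm (T x) \<and> norm (T x) \<le> b * ell1_norm x))"


section \<open>Lists of equivalent conditions\<close>

definition all_equivalent :: "bool list \<Rightarrow> bool" where
  "all_equivalent Ps \<longleftrightarrow> (\<forall>P \<in> set Ps. \<forall>Q \<in> set Ps. P \<longleftrightarrow> Q)"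

end

theory Submission
  imports Defs "HOL-Library.Diagonal_Subsequence"
begin

text \<open>Each condition is compared with separability of the dual.

  Let the dual be separable.  A dense sequence of functionals embeds each ball, with its weak
  topology, into a countable power of the line (\<open>weak_cball_eq_pullback\<close>), so the balls are metrizable
  and second countable.  Weakly compact sets are bounded, hence countable bases of the
  balls of integer radius together form a countable k-network of the whole space.  A copy of the
  space of summable sequences is impossible, because it would give uncountably many functionals at
  mutual distances bounded from below (\<open>no_ell1_embedding_if_separable_dual\<close>).

  Conversely, a countable base at the origin of the unit ball makes the dual separable, by the Hahn-Banach
  theorem (\<open>separable_dual_if_countable_base\<close>).  All other conditions are reduced to
  this one.  The link is that the weak topology has countable fan tightness, a consequence of the
  weak* compactness of the dual ball (\<open>weak_fan_tightness\<close>).  It turns the strong Pytkeev property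
  at the origin into a countable base (\<open>separable_dual_if_strong_Pytkeev_at_0\<close>).  The remaining conditions
  imply countable cs*-character of the ball.  This property yields the strong Pytkeev property as soon as a
  bounded set that accumulates weakly at the origin contains a weakly null sequence.  The latter follows
  (\<open>weakly_null_sequence_in\<close>) from the cs*-property, if every sequence in the ball has
  a weakly Cauchy subsequence: then on a countable bounded set \<open>A\<close> the functionals are separable for
  the uniform distance on \<open>A\<close>.  Indeed, among uncountably many functionals at mutual distances greater
  than \<open>e\<close> there are, by second countability, functionals that converge to another one on
  \<open>A\<close> as well as in their behaviour on the network, and the points where they differ from
  their limit produce a weakly null sequence that escapes every member of the network on
  which the limit is small (\<open>countable_if_separated_on\<close>).

  Weakly Cauchy subsequences are obtained from Rosenthal's dichotomy (\<open>Rosenthal_dichotomy\<close>): a bounded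
  sequence without them has a Boolean independent subsequence.  Such a sequence spans a copy of the
  space of summable sequences (\<open>ell1_embedding_if_boolean_independent\<close>).  It is also impossible
  when the unit ball is a k-space (\<open>not_boolean_independent_if_k_space\<close>): the differences of its terms
  accumulate at the origin, but no compact set contains a convergent sequence of different ones.
  The dichotomy itself rests on Galvin's partition lemma (\<open>Galvin\<close>).\<close>

section \<open>A Ramsey theorem for initial segments\<close>

text \<open>Only continuations \<open>N\<close> that lie beyond \<open>s\<close> are considered, so that the sets
  \<open>(s \<union> N) \<inter> {..<k}\<close> are the initial segments of a set that starts with \<open>s\<close>.\<close>

definition accepts :: "nat set set \<Rightarrow> nat set \<Rightarrow> nat set \<Rightarrow> bool" where
  "accepts F s M \<longleftrightarrow>
     (\<forall>N\<subseteq>M. infinite N \<and> (\<forall>m\<in>s. \<forall>n\<in>N. m < n) \<longrightarrow> (\<exists>k. (s \<union> N) \<inter> {..<k} \<in> F))"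

definition rejects :: "nat set set \<Rightarrow> nat set \<Rightarrow> nat set \<Rightarrow> bool" where
  "rejects F s M \<longleftrightarrow> (\<forall>N\<subseteq>M. infinite N \<longrightarrow> \<not> accepts F s N)"

lemma accepts_subset: "accepts F s M \<Longrightarrow> N \<subseteq> M \<Longrightarrow> accepts F s N"
  unfolding accepts_def by (meson order_trans)

lemma rejects_subset: "rejects F s M \<Longrightarrow> N \<subseteq> M \<Longrightarrow> rejects F s N"
  unfolding rejects_def by (meson order_trans)

lemma accepts_tail:
  assumes "\<And>n. n \<in> M \<Longrightarrow> (\<forall>m\<in>s. m < n) \<Longrightarrow> n \<in> N" and "accepts F s N"
  shows "accepts F s M"
  unfolding accepts_def
proof (intro allI impI, elim conjE)
  fix L assume L: "L \<subseteq> M" "infinite L" "\<forall>m\<in>s. \<forall>n\<in>L. m < n"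
  then have "L \<subseteq> N"
    using assms(1) by blast
  then show "\<exists>k. (s \<union> L) \<inter> {..<k} \<in> F"
    using assms(2) L unfolding accepts_def by blast
qed

lemma finite_decision:
  assumes "finite T" "infinite M"
  shows "\<exists>N\<subseteq>M. infinite N \<and> (\<forall>s\<in>T. accepts F s N \<or> rejects F s N)"
  using assms
proof (induction T)
  case empty
  then show ?case by blast
next
  case (insert s T)
  then obtain N where N: "N \<subseteq> M" "infinite N" "\<forall>s\<in>T. accepts F s N \<or> rejects F s N"
    by blast
  obtain L where L: "L \<subseteq> N" "infinite L" "accepts F s L \<or> rejects F s L"
    using N(2) unfolding rejects_def by blast
  then show ?case
    using N accepts_subset rejects_subset by (metis insert_iff order_trans)
qed

text \<open>By diagonalisation: an element of the diagonal set that lies beyond \<open>s\<close> was chosen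
  after \<open>s\<close> had been decided, and the status of \<open>s\<close> depends on such elements only.\<close>

lemma ex_deciding_set:
  "\<exists>M. infinite M \<and> (\<forall>s\<subseteq>M. finite s \<longrightarrow> accepts F s M \<or> rejects F s M)"
proof -
  let ?D = "\<lambda>k M. \<forall>s\<subseteq>{..k}. accepts F s M \<or> rejects F s M"
  let ?P = "\<lambda>(k::nat) (p :: nat \<times> nat set). infinite (snd p) \<and>
              (\<forall>n\<in>snd p. fst p < n) \<and> ?D (fst p) (snd p)"
  let ?Q = "\<lambda>(k::nat) (p :: nat \<times> nat set) q. snd q \<subseteq> snd p \<and> fst q \<in> snd p"
  have step: "\<exists>N. infinite N \<and> N \<subseteq> M \<and> (\<forall>n\<in>N. k < n) \<and> ?D k N" if M: "infinite M" for k and M :: "nat set"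
  proof -
    have "M = (M \<inter> {..k}) \<union> (M \<inter> {k<..})" by auto
    with M have "infinite (M \<inter> {k<..})"
      by (metis finite_Int finite_UnI finite_atMost)
    then obtain N where "N \<subseteq> M \<inter> {k<..}" "infinite N" "\<forall>s\<in>Pow {..k}. accepts F s N \<or> rejects F s N"
      using finite_decision[of "Pow {..k}" "M \<inter> {k<..}" F] by auto
    then show ?thesis by blast
  qed
  have "\<exists>f. \<forall>n. ?P n (f n) \<and> ?Q n (f n) (f (Suc n))"
  proof (rule dependent_nat_choice)
    obtain N where N: "infinite N" "N \<subseteq> UNIV" "\<forall>n\<in>N. 0 < n" "?D 0 N"
      using step[of UNIV 0] by blast
    then show "\<exists>p. ?P 0 p"
      by (intro exI[of _ "(0, N)"]) simp
  next
    fix p :: "nat \<times> nat set" and n :: nat assume p: "?P n p"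
    then obtain k where k: "k \<in> snd p"
      by (metis finite.emptyI ex_in_conv)
    obtain N where N: "infinite N" "N \<subseteq> snd p" "\<forall>n\<in>N. k < n" "?D k N"
      using step[of "snd p" k] p by blast
    show "\<exists>q. ?P (Suc n) q \<and> ?Q n p q"
      using N k by (intro exI[of _ "(k, N)"]) simp
  qed
  then obtain f where f: "\<forall>n. ?P n (f n) \<and> ?Q n (f n) (f (Suc n))"
    by (rule exE)
  \<comment> \<open>\<open>m n\<close> is the \<open>n\<close>-th point of the diagonal set; all later points are taken from
    \<open>A n\<close>, which has decided every \<open>s \<subseteq> {..m n}\<close>.\<close>
  have P: "?P n (f n)" and Q: "?Q n (f n) (f (Suc n))" for n
    using spec[OF f, of n] by (rule conjunct1, rule conjunct2)
  define m where "m n = fst (f n)" for n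
  define A where "A n = snd (f n)" for n
  have A_Suc: "A (Suc n) \<subseteq> A n" and m_in: "m (Suc n) \<in> A n" for n
    using Q[of n] by (auto simp: m_def A_def)
  have A_inf: "infinite (A n)" and m_less: "x \<in> A n \<Longrightarrow> m n < x" and dec: "?D (m n) (A n)" for n x
    using P[of n] by (auto simp: m_def A_def)
  have A_mono: "A j \<subseteq> A i" if "i \<le> j" for i j
    using that A_Suc lift_Suc_antimono_le by blast
  have m_mono: "strict_mono m"
    using m_less m_in by (simp add: strict_mono_Suc_iff)
  have later: "m j \<in> A i" if "i < j" for i j
    using m_in[of "j - 1"] A_mono[of i "j - 1"] that by (cases j) auto
  define M where "M = range (\<lambda>n. m n)"
  have "infinite M"
    unfolding M_def using m_mono by (simp add: range_inj_infinite strict_mono_imp_inj_on)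
  then obtain M' where M': "M' \<subseteq> M" "infinite M'" "accepts F {} M' \<or> rejects F {} M'"
    using finite_decision[of "{{}}" M F] by blast
  moreover have "accepts F s M' \<or> rejects F s M'" if s: "s \<subseteq> M'" "finite s" "s \<noteq> {}" for s
  proof -
    obtain i where i: "Max s = m i"
      using s M' Max_in unfolding M_def by blast
    have sub: "s \<subseteq> {..m i}"
      using s i by (metis Max_ge atMost_iff subsetI)
    have tail: "x \<in> A i" if x: "x \<in> M" "\<forall>y\<in>s. y < x" for x
    proof -
      obtain j where j: "x = m j" using x(1) unfolding M_def by blast
      have "m i < m j"
        using x(2) j i Max_in[OF s(2,3)] by metis
      then have "i < j"
        using m_mono by (simp add: strict_mono_less)
      then show ?thesis using later j by simp
    qed
    consider "accepts F s (A i)" | "rejects F s (A i)" using dec sub by blast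
    then show ?thesis
    proof cases
      case 1
      then show ?thesis using accepts_tail[OF _ 1, of M'] tail M' by blast
    next
      case 2
      have "rejects F s M'"
        unfolding rejects_def
      proof (intro allI impI notI)
        fix N assume N: "N \<subseteq> M'" "infinite N" "accepts F s N"
        have "{x \<in> N. \<not> (\<forall>y\<in>s. y < x)} \<subseteq> {..m i}"
          using i Max_ge[OF s(2)] by (force simp: not_less)
        then have "finite {x \<in> N. \<not> (\<forall>y\<in>s. y < x)}"
          by (rule finite_subset) simp
        moreover have "N = {x \<in> N. \<forall>y\<in>s. y < x} \<union> {x \<in> N. \<not> (\<forall>y\<in>s. y < x)}" by blast
        ultimately have "infinite {x \<in> N. \<forall>y\<in>s. y < x}"
          using N(2) by (metis (no_types, lifting) finite_Un)
        moreover have "{x \<in> N. \<forall>y\<in>s. y < x} \<subseteq> A i"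
        proof
          fix x assume "x \<in> {x \<in> N. \<forall>y\<in>s. y < x}"
          then show "x \<in> A i" using N(1) M'(1) by (intro tail) auto
        qed
        moreover have "accepts F s {x \<in> N. \<forall>y\<in>s. y < x}"
          by (rule accepts_subset[OF N(3)]) simp
        ultimately show False using 2 unfolding rejects_def by meson
      qed
      then show ?thesis by blast
    qed
  qed
  ultimately show ?thesis by metis
qed

text \<open>If a deciding set \<open>M\<close> accepts the empty set, the second alternative holds.  Otherwise
  \<open>M\<close> rejects the empty set.  When \<open>M\<close> rejects \<open>s\<close>, it rejects all but finitely many extensions
  of \<open>s\<close> by one later element, because the other extension points would form a set that accepts
  \<open>s\<close>.  So an infinite set can be built all of whose finite subsets are rejected, and a member
  of \<open>F\<close> is never rejected.\<close>

lemma Galvin: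
  fixes F :: "nat set set"
  obtains M where "infinite M" "\<And>s. finite s \<Longrightarrow> s \<subseteq> M \<Longrightarrow> s \<notin> F"
  | M where "infinite M" "\<And>N. N \<subseteq> M \<Longrightarrow> infinite N \<Longrightarrow> \<exists>k. N \<inter> {..<k} \<in> F"
proof -
  obtain M where M: "infinite M" and dec: "\<And>s. s \<subseteq> M \<Longrightarrow> finite s \<Longrightarrow> accepts F s M \<or> rejects F s M"
    using ex_deciding_set by blast
  consider "accepts F {} M" | "rejects F {} M" using dec by blast
  then show thesis
  proof cases
    case 1
    then show ?thesis using that(2)[OF M] unfolding accepts_def by auto
  next
    case 2
    have extend: "finite {n \<in> M. (\<forall>m\<in>s. m < n) \<and> \<not> rejects F (insert n s) M}"
      if s: "s \<subseteq> M" "finite s" "rejects F s M" for s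
    proof (rule ccontr)
      let ?N = "{n \<in> M. (\<forall>m\<in>s. m < n) \<and> \<not> rejects F (insert n s) M}"
      assume inf: "infinite ?N"
      have "accepts F s ?N"
        unfolding accepts_def
      proof (intro allI impI, elim conjE)
        fix L assume L: "L \<subseteq> ?N" "infinite L"
        define n where "n = (LEAST x. x \<in> L)"
        have n: "n \<in> L" unfolding n_def using L by (metis LeastI ex_in_conv finite.emptyI)
        have n_le: "n \<le> x" if "x \<in> L" for x unfolding n_def using that by (rule Least_le)
        have "accepts F (insert n s) M"
          using n L dec[of "insert n s"] s by blast
        moreover have "L - {n} \<subseteq> M" "infinite (L - {n})" "\<forall>m\<in>insert n s. \<forall>x\<in>L - {n}. m < x"
          using L n_le by (auto simp: less_le)
        ultimately obtain k where "(insert n s \<union> (L - {n})) \<inter> {..<k} \<in> F"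
          unfolding accepts_def by blast
        moreover have "insert n s \<union> (L - {n}) = s \<union> L" using n by blast
        ultimately show "\<exists>k. (s \<union> L) \<inter> {..<k} \<in> F" by metis
      qed
      moreover have "?N \<subseteq> M" by blast
      ultimately show False
        using s(3) inf unfolding rejects_def by meson
    qed
    let ?P = "\<lambda>(k::nat) t. finite t \<and> t \<subseteq> M \<and> (\<forall>s\<subseteq>t. rejects F s M)"
    let ?Q = "\<lambda>(k::nat) t u. \<exists>n. u = insert n t \<and> (\<forall>m\<in>t. m < n)"
    have "\<exists>f. \<forall>n. ?P n (f n) \<and> ?Q n (f n) (f (Suc n))"
    proof (rule dependent_nat_choice)
      show "\<exists>t. ?P 0 t" using 2 by (intro exI[of _ "{}"]) auto
    next
      fix t k assume t: "?P k t"
      let ?bad = "(\<Union>s\<in>Pow t. {n \<in> M. (\<forall>m\<in>s. m < n) \<and> \<not> rejects F (insert n s) M}) \<union> {n. \<exists>m\<in>t. n \<le> m}"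
      have "{n. \<exists>m\<in>t. n \<le> m} = (\<Union>m\<in>t. {..m})" by auto
      then have "finite {n. \<exists>m\<in>t. n \<le> m}" using t by simp
      moreover have "finite {n \<in> M. (\<forall>m\<in>s. m < n) \<and> \<not> rejects F (insert n s) M}" if "s \<in> Pow t" for s
        using t that by (intro extend) (auto intro: finite_subset)
      ultimately have "finite ?bad"
        using t by (metis (no_types, lifting) finite_Pow_iff finite_UN finite_Un)
      then obtain n where n: "n \<in> M" "n \<notin> ?bad"
        using M by (meson finite_subset subsetI)
      then have gr: "\<forall>m\<in>t. m < n" by (simp add: not_le)
      have "rejects F s M" if s: "s \<subseteq> insert n t" for s
      proof (cases "n \<in> s")
        case True
        have "s - {n} \<in> Pow t" "\<forall>m\<in>s - {n}. m < n" using s gr by auto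
        then have "rejects F (insert n (s - {n})) M" using n by blast
        then show ?thesis using True by (simp add: insert_absorb)
      next
        case False
        then show ?thesis using s t by (meson subset_insert)
      qed
      then show "\<exists>u. ?P (Suc k) u \<and> ?Q k t u"
        using t n gr by (intro exI[of _ "insert n t"]) auto
    qed
    then obtain f where f: "\<forall>n. ?P n (f n) \<and> ?Q n (f n) (f (Suc n))"
      by (rule exE)
    have P: "?P n (f n)" and Q: "?Q n (f n) (f (Suc n))" for n
      using spec[OF f, of n] by (rule conjunct1, rule conjunct2)
    define N where "N = (\<Union>n. f n)"
    have f_mono: "f i \<subseteq> f j" if "i \<le> j" for i j
      using that Q lift_Suc_mono_le[of f i j] by (metis subset_insertI)
    have card_f: "card (f n) \<ge> n" for n
    proof (induction n)
      case (Suc n)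
      obtain x where "f (Suc n) = insert x (f n)" "x \<notin> f n" using Q[of n] by blast
      then show ?case using Suc P[of n] by simp
    qed simp
    have "infinite N"
    proof
      assume "finite N"
      then have "card (f (Suc (card N))) \<le> card N"
        unfolding N_def by (intro card_mono) auto
      then show False using card_f[of "Suc (card N)"] by simp
    qed
    moreover have "s \<notin> F" if s: "finite s" "s \<subseteq> N" for s
    proof
      assume "s \<in> F"
      obtain n where n: "s \<subseteq> f n"
      proof -
        have "\<exists>n. s \<subseteq> f n" using s
        proof (induction s)
          case (insert x s)
          then obtain i j where "s \<subseteq> f i" "x \<in> f j" unfolding N_def by auto
          then have "insert x s \<subseteq> f (max i j)"
            using f_mono[of i "max i j"] f_mono[of j "max i j"] by auto
          then show ?case by blast
        qed simp
        then show thesis using that by blast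
      qed
      then have "rejects F s M" using P by blast
      moreover have "accepts F s M"
        unfolding accepts_def
      proof (intro allI impI, elim conjE)
        fix L assume L: "\<forall>m\<in>s. \<forall>n\<in>L. m < n"
        show "\<exists>k. (s \<union> L) \<inter> {..<k} \<in> F"
        proof (cases "s = {}")
          case True
          then show ?thesis using \<open>s \<in> F\<close> by (intro exI[of _ 0]) simp
        next
          case False
          have "(s \<union> L) \<inter> {..<Suc (Max s)} = s"
            using Max_ge[OF s(1)] bspec[OF L Max_in[OF s(1) False]]
            by (fastforce simp: less_Suc_eq_le)
          then show ?thesis using \<open>s \<in> F\<close> by metis
        qed
      qed
      ultimately show False using M unfolding rejects_def by blast
    qed
    ultimately show ?thesis using that(1)[of N] by blast
  qed
qed

section \<open>Weakly Cauchy subsequences\<close>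

definition weakly_Cauchy :: "(nat \<Rightarrow> 'a::real_normed_vector) \<Rightarrow> bool" where
  "weakly_Cauchy x \<longleftrightarrow> (\<forall>f :: 'a \<Rightarrow>\<^sub>L real. convergent (\<lambda>n. blinfun_apply f (x n)))"

text \<open>The pairs of half-spaces \<open>{f. f (x i) \<le> r}\<close> and \<open>{f. q \<le> f (x i)}\<close> of the dual unit ball
  are independent: any choice of one member from each of finitely many pairs has a common
  element.  For \<open>r < q\<close> this makes \<open>x\<close> behave like the unit vectors of the space of summable
  sequences.\<close>

definition boolean_independent :: "real \<Rightarrow> real \<Rightarrow> (nat \<Rightarrow> 'a::real_normed_vector) \<Rightarrow> bool" where
  "boolean_independent r q x \<longleftrightarrow>
     (\<forall>n P. \<exists>f :: 'a \<Rightarrow>\<^sub>L real. norm f \<le> 1 \<and> (\<forall>i<n. if i \<in> P then blinfun_apply f (x i) \<le> r else q \<le> blinfun_apply f (x i)))"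

definition oscillates :: "real \<Rightarrow> real \<Rightarrow> (nat \<Rightarrow> real) \<Rightarrow> bool" where
  "oscillates r q u \<longleftrightarrow> (\<exists>\<^sub>F n in sequentially. u n \<le> r) \<and> (\<exists>\<^sub>F n in sequentially. q \<le> u n)"

lemma oscillates_subseqD:
  assumes "strict_mono \<rho>" "oscillates r q (\<lambda>n. u (\<rho> n))"
  shows "oscillates r q u"
  using assms(2) eventually_subseq[OF assms(1)] unfolding oscillates_def frequently_def by blast

lemma oscillates_shiftI:
  assumes "oscillates r q u"
  shows "oscillates r q (\<lambda>n. u (k + n))"
proof -
  have "(\<exists>\<^sub>F n in sequentially. Q (u (k + n))) \<longleftrightarrow> (\<exists>\<^sub>F n in sequentially. Q (u n))" for Q
    using eventually_sequentially_seg[of "\<lambda>n. \<not> Q (u n)" k]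
    unfolding frequently_def by (simp add: add.commute)
  from this[of "\<lambda>v. v \<le> r"] this[of "\<lambda>v. q \<le> v"] show ?thesis
    using assms unfolding oscillates_def by simp
qed

lemma frequently_sequentially_iff:
  "(\<exists>\<^sub>F n in sequentially. P n) \<longleftrightarrow> (\<forall>N. \<exists>n\<ge>N. P n)"
  by (auto simp: frequently_def eventually_sequentially)

lemma card_image_initial:
  fixes g :: "nat \<Rightarrow> nat"
  assumes "strict_mono g" "j < n"
  shows "card (g ` {..<n} \<inter> {..<g j}) = j"
proof -
  have "g ` {..<n} \<inter> {..<g j} = g ` {..<j}"
    using assms by (auto simp: strict_mono_less)
  then show ?thesis
    using strict_mono_imp_inj_on[OF assms(1)] by (simp add: card_image inj_on_subset)
qed

text \<open>Galvin's lemma is applied to the finite sets along which no functional in the unit ball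
  alternates between \<open>\<le> r\<close> and \<open>\<ge> q\<close>.  If every finite subset of \<open>M\<close> admits an alternating
  functional, then the middle elements of consecutive triples of \<open>M\<close> are independent: the element
  of a triple picked together with the middle one decides the parity of the position of the
  latter.\<close>

lemma independent_or_no_oscillation:
  fixes x :: "nat \<Rightarrow> 'a::real_normed_vector"
  shows "\<exists>\<sigma>. strict_mono \<sigma> \<and>
     (boolean_independent r q (x \<circ> \<sigma>) \<or>
      (\<forall>f :: 'a \<Rightarrow>\<^sub>L real. norm f \<le> 1 \<longrightarrow> \<not> oscillates r q (\<lambda>n. blinfun_apply f (x (\<sigma> n)))))"
proof -
  define alt where "alt f s \<longleftrightarrow>
      (\<forall>m\<in>s. if even (card (s \<inter> {..<m})) then blinfun_apply f (x m) \<le> r else q \<le> blinfun_apply f (x m))"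
    for f :: "'a \<Rightarrow>\<^sub>L real" and s :: "nat set"
  have alt_image: "alt f (g ` {..<n}) \<longleftrightarrow> (\<forall>j<n. if even j then blinfun_apply f (x (g j)) \<le> r else q \<le> blinfun_apply f (x (g j)))"
    if "strict_mono g" for f n and g :: "nat \<Rightarrow> nat"
    unfolding alt_def by (auto simp: card_image_initial[OF that])
  let ?F = "{s. \<not> (\<exists>f. norm f \<le> 1 \<and> alt f s)}"
  show ?thesis
  proof (rule Galvin[of ?F])
    fix M :: "nat set" assume M: "infinite M" and notF: "\<And>s. finite s \<Longrightarrow> s \<subseteq> M \<Longrightarrow> s \<notin> ?F"
    define m where "m = enumerate M"
    have m: "strict_mono m" "\<And>i. m i \<in> M"
      using M by (simp_all add: m_def strict_mono_enumerate enumerate_in_set)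
    define \<sigma> where "\<sigma> i = m (3 * i + 1)" for i
    have "strict_mono \<sigma>"
      using m(1) by (simp add: \<sigma>_def strict_mono_def)
    moreover have "boolean_independent r q (x \<circ> \<sigma>)"
      unfolding boolean_independent_def
    proof (intro allI)
      fix n :: nat and P :: "nat set"
      \<comment> \<open>From the triple \<open>3 * i, 3 * i + 1, 3 * i + 2\<close> two elements are listed, so that each
        triple starts at an even position.  The middle element is listed first, at an even position,
        if \<open>i \<in> P\<close>, and second otherwise.\<close>
      define h where "h j = 3 * (j div 2) + j mod 2 + (if j div 2 \<in> P then 1 else 0)" for j :: nat
      have "h j < h (Suc j)" for j
        unfolding h_def by (cases "even j") (auto elim!: evenE oddE)
      then have "strict_mono (m \<circ> h)"
        using m(1) by (simp add: strict_mono_Suc_iff strict_mono_less)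
      moreover have "(m \<circ> h) ` {..<2 * n} \<notin> ?F"
        using m(2) by (intro notF) auto
      ultimately obtain f where f: "norm f \<le> 1"
          "\<And>j. j < 2 * n \<Longrightarrow> if even j then blinfun_apply f (x (m (h j))) \<le> r else q \<le> blinfun_apply f (x (m (h j)))"
        using alt_image by (auto simp: o_def)
      have "if i \<in> P then blinfun_apply f ((x \<circ> \<sigma>) i) \<le> r else q \<le> blinfun_apply f ((x \<circ> \<sigma>) i)" if "i < n" for i
        using f(2)[of "2 * i"] f(2)[of "2 * i + 1"] that by (simp add: h_def \<sigma>_def split: if_splits)
      then show "\<exists>f :: 'a \<Rightarrow>\<^sub>L real. norm f \<le> 1 \<and> (\<forall>i<n. if i \<in> P then blinfun_apply f ((x \<circ> \<sigma>) i) \<le> r else q \<le> blinfun_apply f ((x \<circ> \<sigma>) i))"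
        using f(1) by blast
    qed
    ultimately show ?thesis by blast
  next
    fix M :: "nat set" assume M: "infinite M"
      and inF: "\<And>N. N \<subseteq> M \<Longrightarrow> infinite N \<Longrightarrow> \<exists>k. N \<inter> {..<k} \<in> ?F"
    define m where "m = enumerate M"
    have m: "strict_mono m" "\<And>i. m i \<in> M"
      using M by (simp_all add: m_def strict_mono_enumerate enumerate_in_set)
    have "\<not> oscillates r q (\<lambda>n. blinfun_apply f (x (m n)))"
      if f: "norm f \<le> 1" for f :: "'a \<Rightarrow>\<^sub>L real"
    proof
      assume "oscillates r q (\<lambda>n. blinfun_apply f (x (m n)))"
      then have low: "\<exists>n\<ge>N. blinfun_apply f (x (m n)) \<le> r" and high: "\<exists>n\<ge>N. q \<le> blinfun_apply f (x (m n))" for N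
        by (auto simp: oscillates_def frequently_sequentially_iff)
      let ?P = "\<lambda>j v. if even j then blinfun_apply f (x (m v)) \<le> r else q \<le> blinfun_apply f (x (m v))"
      have "\<exists>v. \<forall>j. ?P j (v j) \<and> v j < v (Suc j)"
      proof (rule dependent_nat_choice)
        show "\<exists>v. ?P 0 v" using low[of 0] by auto
      next
        fix v j
        show "\<exists>w. ?P (Suc j) w \<and> v < w"
          using low[of "Suc v"] high[of "Suc v"] by (auto simp: Suc_le_eq)
      qed
      then obtain v where v: "\<And>j. ?P j (v j)" "\<And>j. v j < v (Suc j)" by metis
      define g where "g = m \<circ> v"
      have g: "strict_mono g"
        using v(2) m(1) by (simp add: g_def strict_mono_Suc_iff strict_mono_less)
      have "infinite (range g)"
        using g by (simp add: range_inj_infinite strict_mono_imp_inj_on)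
      moreover have "range g \<subseteq> M" using m(2) by (auto simp: g_def)
      ultimately obtain k where k: "range g \<inter> {..<k} \<in> ?F"
        using inF[of "range g"] by blast
      define j where "j = (LEAST j. k \<le> g j)"
      have "k \<le> g k" using g by (rule strict_mono_imp_increasing)
      then have j: "k \<le> g j" unfolding j_def by (rule LeastI)
      have "g i < k" if "i < j" for i
        using that not_less_Least[of i "\<lambda>j. k \<le> g j"] by (simp add: j_def)
      moreover have "i < j" if "g i < k" for i
      proof -
        have "g i < g j" using that j by simp
        then show ?thesis using g by (simp add: strict_mono_less)
      qed
      ultimately have "range g \<inter> {..<k} = g ` {..<j}" by auto
      moreover have "alt f (g ` {..<j})"
        unfolding alt_image[OF g] using v(1) by (simp add: g_def)
      ultimately show False using k f by auto
    qed
    then show ?thesis using m(1) by blast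
  qed
qed

text \<open>Rational bounds suffice, and they leave only countably many oscillations to be excluded.\<close>

lemma convergent_if_no_oscillation:
  fixes u :: "nat \<Rightarrow> real"
  assumes bdd: "bounded (range u)"
    and osc: "\<And>a b :: rat. a < b \<Longrightarrow> \<not> oscillates (of_rat a) (of_rat b) u"
  shows "convergent u"
proof -
  obtain l \<sigma> where \<sigma>: "strict_mono \<sigma>" and lim: "(u \<circ> \<sigma>) \<longlonglongrightarrow> l"
    using bounded_imp_convergent_subsequence[OF bdd] by blast
  have near: "\<exists>\<^sub>F n in sequentially. \<bar>u n - l\<bar> < d" if d: "d > 0" for d
  proof -
    have "\<forall>\<^sub>F n in sequentially. \<bar>u (\<sigma> n) - l\<bar> < d"
      using tendstoD[OF lim d] by (simp add: dist_real_def)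
    then have "\<exists>\<^sub>F n in sequentially. \<bar>u (\<sigma> n) - l\<bar> < d"
      by (intro eventually_frequently) simp_all
    then show ?thesis
      using eventually_subseq[OF \<sigma>] unfolding frequently_def by blast
  qed
  have "u \<longlonglongrightarrow> l"
  proof (rule tendstoI)
    fix e :: real assume e: "e > 0"
    obtain a b :: rat where ab: "l < of_rat a" "of_rat a < real_of_rat b" "of_rat b < l + e"
      using e by (metis of_rat_dense less_add_same_cancel1)
    obtain c d :: rat where cd: "l - e < of_rat c" "of_rat c < real_of_rat d" "of_rat d < l"
      using e by (metis of_rat_dense diff_less_eq less_add_same_cancel1)
    have 1: "\<exists>\<^sub>F n in sequentially. u n \<le> of_rat a"
      using near[of "of_rat a - l"] ab(1) by (auto elim!: frequently_elim1)
    have 2: "\<exists>\<^sub>F n in sequentially. of_rat d \<le> u n"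
      using near[of "l - of_rat d"] cd(3) by (auto elim!: frequently_elim1)
    have "\<forall>\<^sub>F n in sequentially. u n < of_rat b"
      using osc[of a b] 1 ab(2) by (auto simp: oscillates_def of_rat_less not_frequently not_le)
    moreover have "\<forall>\<^sub>F n in sequentially. of_rat c < u n"
      using osc[of c d] 2 cd(2) by (auto simp: oscillates_def of_rat_less not_frequently not_le)
    ultimately show "\<forall>\<^sub>F n in sequentially. dist (u n) l < e"
      by eventually_elim (use ab cd in \<open>auto simp: dist_real_def\<close>)
  qed
  then show ?thesis by (rule convergentI)
qed

lemma weakly_Cauchy_if_unit_ball:
  fixes x :: "nat \<Rightarrow> 'a::real_normed_vector"
  assumes "\<And>f :: 'a \<Rightarrow>\<^sub>L real. norm f \<le> 1 \<Longrightarrow> convergent (\<lambda>n. blinfun_apply f (x n))"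
  shows "weakly_Cauchy x"
  unfolding weakly_Cauchy_def
proof
  fix f :: "'a \<Rightarrow>\<^sub>L real"
  show "convergent (\<lambda>n. blinfun_apply f (x n))"
  proof (cases "f = 0")
    case False
    have "convergent (\<lambda>n. norm f * blinfun_apply (inverse (norm f) *\<^sub>R f) (x n))"
      using assms[of "inverse (norm f) *\<^sub>R f"] False by (intro convergent_mult convergent_const) auto
    moreover have "norm f * blinfun_apply (inverse (norm f) *\<^sub>R f) (x n) = blinfun_apply f (x n)" for n
      using False by (simp add: scaleR_blinfun.rep_eq)
    ultimately show ?thesis by simp
  qed (simp add: convergent_const)
qed

text \<open>A diagonal argument over all rational pairs \<open>a < b\<close> removes every oscillation, unless one
  of the pairs produces an independent subsequence on the way.\<close>

theorem Rosenthal_dichotomy: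
  fixes x :: "nat \<Rightarrow> 'a::real_normed_vector"
  assumes bdd: "bounded (range x)"
  obtains \<sigma> where "strict_mono \<sigma>" "weakly_Cauchy (x \<circ> \<sigma>)"
  | r q \<sigma> where "r < q" "strict_mono \<sigma>" "boolean_independent r q (x \<circ> \<sigma>)"
proof (cases "\<exists>r q \<sigma>. r < q \<and> strict_mono \<sigma> \<and> boolean_independent r q (x \<circ> \<sigma>)")
  case False
  define P where "P k \<sigma> \<longleftrightarrow> (case from_nat k of (a, b :: rat) \<Rightarrow> a < b \<longrightarrow>
      (\<forall>f :: 'a \<Rightarrow>\<^sub>L real. norm f \<le> 1 \<longrightarrow>
         \<not> oscillates (of_rat a) (of_rat b) (\<lambda>n. blinfun_apply f (x (\<sigma> n)))))"
    for k and \<sigma> :: "nat \<Rightarrow> nat"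
  interpret subseqs P
  proof
    fix k and \<sigma> :: "nat \<Rightarrow> nat" assume \<sigma>: "strict_mono \<sigma>"
    obtain a b :: rat where ab: "from_nat k = (a, b)" by fastforce
    obtain \<rho> where \<rho>: "strict_mono \<rho>"
        "boolean_independent (of_rat a) (of_rat b) ((x \<circ> \<sigma>) \<circ> \<rho>) \<or>
        (\<forall>f :: 'a \<Rightarrow>\<^sub>L real. norm f \<le> 1 \<longrightarrow>
         \<not> oscillates (of_rat a) (of_rat b) (\<lambda>n. blinfun_apply f ((x \<circ> \<sigma>) (\<rho> n))))"
      using independent_or_no_oscillation[of "of_rat a" "of_rat b" "x \<circ> \<sigma>"] by blast
    have "strict_mono (\<sigma> \<circ> \<rho>)" using \<sigma> \<rho>(1) by (rule strict_mono_o)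
    then have "a < b \<Longrightarrow> \<not> boolean_independent (of_rat a) (of_rat b) (x \<circ> (\<sigma> \<circ> \<rho>))"
      using False of_rat_less by blast
    then have "P k (\<sigma> \<circ> \<rho>)"
      using \<rho>(2) unfolding P_def ab by (auto simp: o_assoc)
    then show "\<exists>\<rho>. strict_mono \<rho> \<and> P k (\<sigma> \<circ> \<rho>)" using \<rho>(1) by blast
  qed
  have P_subseq: "P k (\<sigma> \<circ> \<rho>)" if "strict_mono \<rho>" "P k \<sigma>" for k \<sigma> \<rho>
    using that oscillates_subseqD[OF that(1)] unfolding P_def by (auto split: prod.splits)
  define d where "d = diagseq"
  have P_diag: "P k d" for k
  proof -
    obtain a b :: rat where ab: "from_nat k = (a, b)" by fastforce
    have "P k (\<lambda>n. d (Suc k + n))"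
      using diagseq_holds[of k, OF P_subseq] by (simp add: d_def o_def)
    then show ?thesis
      using oscillates_shiftI[of _ _ "\<lambda>n. blinfun_apply _ (x (d n))" "Suc k"]
      unfolding P_def ab prod.case by blast
  qed
  have "weakly_Cauchy (x \<circ> d)"
  proof (rule weakly_Cauchy_if_unit_ball, rule convergent_if_no_oscillation)
    fix f :: "'a \<Rightarrow>\<^sub>L real"
    have "bounded (blinfun_apply f ` range x)"
      using bdd by (intro bounded_linear_image blinfun.bounded_linear_right)
    then show "bounded (range (\<lambda>n. blinfun_apply f ((x \<circ> d) n)))"
      by (rule bounded_subset) auto
    fix a b :: rat assume "norm f \<le> 1" "a < b"
    then show "\<not> oscillates (of_rat a) (of_rat b) (\<lambda>n. blinfun_apply f ((x \<circ> d) n))"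
      using P_diag[of "to_nat (a, b)"] by (simp add: P_def)
  qed
  then show thesis using that(1) subseq_diagseq unfolding d_def by blast
qed (use that in blast)

section \<open>The Hahn-Banach theorem\<close>

definition sublinear :: "('a::real_vector \<Rightarrow> real) \<Rightarrow> bool" where
  "sublinear p \<longleftrightarrow> (\<forall>x y. p (x + y) \<le> p x + p y) \<and> (\<forall>c x. 0 \<le> c \<longrightarrow> p (c *\<^sub>R x) = c * p x)"

lemma sublinear_add: "sublinear p \<Longrightarrow> p (x + y) \<le> p x + p y"
  and sublinear_scale: "sublinear p \<Longrightarrow> 0 \<le> c \<Longrightarrow> p (c *\<^sub>R x) = c * p x"
  by (simp_all add: sublinear_def)

lemma sublinear_0: "sublinear p \<Longrightarrow> p 0 = 0"
  using sublinear_scale[of p 0 0] by simp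

lemma sublinear_uminus: "sublinear p \<Longrightarrow> - p (- x) \<le> p x"
  using sublinear_add[of p x "- x"] sublinear_0[of p] by simp

text \<open>The infimal convolution of \<open>p\<close> with \<open>f\<close> on the cone \<open>K\<close> has these properties.  It serves
  twice: for a subspace with a dominated linear functional, and for a single ray.\<close>

lemma sublinear_below_on_cone:
  fixes p :: "'a::real_vector \<Rightarrow> real"
  assumes p: "sublinear p"
    and K: "0 \<in> K" "\<And>x y. x \<in> K \<Longrightarrow> y \<in> K \<Longrightarrow> x + y \<in> K"
      "\<And>c x. 0 \<le> c \<Longrightarrow> x \<in> K \<Longrightarrow> c *\<^sub>R x \<in> K"
    and f: "\<And>x y. x \<in> K \<Longrightarrow> y \<in> K \<Longrightarrow> f (x + y) = f x + f y"
      "\<And>c x. 0 \<le> c \<Longrightarrow> x \<in> K \<Longrightarrow> f (c *\<^sub>R x) = c * f x"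
      "\<And>x. x \<in> K \<Longrightarrow> - p (- x) \<le> f x"
  shows "\<exists>q. sublinear q \<and> (\<forall>x. q x \<le> p x) \<and> (\<forall>x\<in>K. q x \<le> f x)"
proof -
  define q where "q x = (INF k\<in>K. p (x - k) + f k)" for x
  have lower: "- p (- x) \<le> p (x - k) + f k" if "k \<in> K" for x k
    using sublinear_add[OF p, of "x - k" "- x"] f(3)[OF that] by simp
  then have bdd: "bdd_below ((\<lambda>k. p (x - k) + f k) ` K)" for x
    by (intro bdd_belowI2)
  have q_le: "q x \<le> p (x - k) + f k" if "k \<in> K" for x k
    unfolding q_def using bdd that by (rule cINF_lower)
  have f0: "f 0 = 0" using f(2)[of 0 0] K(1) by simp
  have add: "q (x + y) \<le> q x + q y" for x y
  proof -
    have "q (x + y) \<le> (p (x - k) + f k) + (p (y - l) + f l)" if "k \<in> K" "l \<in> K" for k l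
      using q_le[OF K(2)[OF that], of "x + y"] sublinear_add[OF p, of "x - k" "y - l"] f(1)[OF that]
      by (simp add: algebra_simps)
    then have 1: "q (x + y) - (p (x - k) + f k) \<le> p (y - l) + f l" if "k \<in> K" "l \<in> K" for k l
      using that by (simp add: diff_le_eq add.commute)
    have "q (x + y) - (p (x - k) + f k) \<le> q y" if "k \<in> K" for k
      unfolding q_def[of y] using K(1) 1[OF that] by (intro cINF_greatest) blast+
    then have 2: "q (x + y) - q y \<le> p (x - k) + f k" if "k \<in> K" for k
      using that by (simp add: diff_le_eq add.commute)
    have "q (x + y) - q y \<le> q x"
      unfolding q_def[of x] using K(1) 2 by (intro cINF_greatest) blast+
    then show ?thesis by simp
  qed
  have pos: "q (c *\<^sub>R x) \<le> c * q x" if c: "0 < c" for c x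
  proof -
    have "q (c *\<^sub>R x) / c \<le> p (x - k) + f k" if "k \<in> K" for k
    proof -
      have "q (c *\<^sub>R x) \<le> p (c *\<^sub>R (x - k)) + f (c *\<^sub>R k)"
        using q_le[OF K(3)[of c k], of "c *\<^sub>R x"] c that by (simp add: algebra_simps)
      also have "\<dots> = c * (p (x - k) + f k)"
        using sublinear_scale[OF p, of c "x - k"] f(2)[of c k] c that by (simp add: distrib_left)
      finally show ?thesis using c by (simp add: field_simps)
    qed
    then have "q (c *\<^sub>R x) / c \<le> q x"
      unfolding q_def[of x] using K(1) by (intro cINF_greatest) auto
    then show ?thesis using c by (simp add: field_simps)
  qed
  have "q (c *\<^sub>R x) = c * q x" if "0 \<le> c" for c x
  proof (cases "c = 0")
    case True
    have "q 0 \<le> 0" using q_le[OF K(1), of 0] sublinear_0[OF p] f0 by simp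
    moreover have "0 \<le> q 0" using add[of 0 0] by simp
    ultimately show ?thesis using True by simp
  next
    case False
    then have "0 < c" using that by simp
    moreover have "q x \<le> inverse c * q (c *\<^sub>R x)"
      using pos[of "inverse c" "c *\<^sub>R x"] \<open>0 < c\<close> by simp
    ultimately show ?thesis using pos[of c x] by (auto simp: field_simps)
  qed
  then have "sublinear q" using add by (simp add: sublinear_def)
  moreover have "q x \<le> p x" for x using q_le[OF K(1), of x] f0 by simp
  moreover have "q x \<le> f x" if "x \<in> K" for x using q_le[OF that, of x] sublinear_0[OF p] by simp
  ultimately show ?thesis by blast
qed

lemma sublinear_below_on_ray:
  fixes p :: "'a::real_vector \<Rightarrow> real"
  assumes p: "sublinear p"
  shows "\<exists>q. sublinear q \<and> (\<forall>x. q x \<le> p x) \<and> q (- v) \<le> - p v"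
proof -
  let ?K = "{- (t *\<^sub>R v) | t. 0 \<le> t}"
  have add: "p ((s + t) *\<^sub>R v) = p (s *\<^sub>R v) + p (t *\<^sub>R v)" if "0 \<le> s" "0 \<le> t" for s t
    using that by (simp only: sublinear_scale[OF p] add_nonneg_nonneg distrib_right)
  have "\<exists>q. sublinear q \<and> (\<forall>x. q x \<le> p x) \<and> (\<forall>x\<in>?K. q x \<le> - p (- x))"
  proof (rule sublinear_below_on_cone[OF p])
    show "0 \<in> ?K" by (intro CollectI exI[of _ 0]) simp
    fix x y assume "x \<in> ?K" "y \<in> ?K"
    then obtain s t where st: "x = - (s *\<^sub>R v)" "y = - (t *\<^sub>R v)" "0 \<le> s" "0 \<le> t" by blast
    then show "x + y \<in> ?K" by (intro CollectI exI[of _ "s + t"]) (simp add: scaleR_left_distrib)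
    show "- p (- (x + y)) = - p (- x) + - p (- y)"
      using add[OF st(3,4)] by (simp add: st(1,2) scaleR_left_distrib add.commute)
  next
    fix c :: real and x assume "0 \<le> c" "x \<in> ?K"
    then obtain t where t: "x = - (t *\<^sub>R v)" "0 \<le> t" by blast
    with \<open>0 \<le> c\<close> show "c *\<^sub>R x \<in> ?K" by (intro CollectI exI[of _ "c * t"]) simp
    show "- p (- (c *\<^sub>R x)) = c * - p (- x)"
      using sublinear_scale[OF p \<open>0 \<le> c\<close>, of "- x"] by simp
  qed simp
  then obtain q where q: "sublinear q" "\<forall>x. q x \<le> p x" "\<forall>x\<in>?K. q x \<le> - p (- x)" by blast
  have "- v \<in> ?K" by (intro CollectI exI[of _ 1]) simp
  from bspec[OF q(3) this] have "q (- v) \<le> - p v" by simp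
  then show ?thesis using q by blast
qed

text \<open>A pointwise minimal sublinear functional below \<open>p\<close> exists by Zorn's lemma, and it is odd by
  the preceding lemma, hence linear.\<close>

lemma linear_below_sublinear:
  fixes p :: "'a::real_vector \<Rightarrow> real"
  assumes p: "sublinear p"
  shows "\<exists>g. linear g \<and> (\<forall>x. g x \<le> p x)"
proof -
  let ?A = "{q. sublinear q \<and> (\<forall>x. q x \<le> p x)}"
  let ?P = "\<lambda>q r :: 'a \<Rightarrow> real. r \<le> q"
  have "\<exists>m\<in>?A. \<forall>a\<in>?A. ?P m a \<longrightarrow> a = m"
  proof (rule predicate_Zorn)
    show "partial_order_on ?A (relation_of ?P ?A)"
      by (rule partial_order_on_relation_ofI) auto
  next
    fix C assume "C \<in> Chains (relation_of ?P ?A)"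
    then have C: "\<And>q. q \<in> C \<Longrightarrow> sublinear q \<and> (\<forall>x. q x \<le> p x)"
        and chain: "\<And>q r. q \<in> C \<Longrightarrow> r \<in> C \<Longrightarrow> q \<le> r \<or> r \<le> q"
      unfolding Chains_def relation_of_def by blast+
    show "\<exists>u\<in>?A. \<forall>q\<in>C. ?P q u"
    proof (cases "C = {}")
      case True
      then show ?thesis using p by (intro bexI[of _ p]) auto
    next
      case False
      define u where "u x = (INF q\<in>C. q x)" for x
      have "- p (- x) \<le> q x" if "q \<in> C" for q x
        using sublinear_uminus[of q x] C[OF that] by (meson neg_le_iff_le order_trans)
      then have bdd: "bdd_below ((\<lambda>q. q x) ` C)" for x
        by (intro bdd_belowI2)
      have u_le: "u x \<le> q x" if "q \<in> C" for q x
        unfolding u_def using bdd that by (rule cINF_lower)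
      have add: "u (x + y) \<le> u x + u y" for x y
      proof -
        have "u (x + y) \<le> q x + r y" if "q \<in> C" "r \<in> C" for q r
        proof -
          obtain s where s: "s \<in> C" "s \<le> q" "s \<le> r" using chain[of q r] \<open>q \<in> C\<close> \<open>r \<in> C\<close> by blast
          have "u (x + y) \<le> s x + s y"
            using u_le[OF s(1), of "x + y"] sublinear_add[of s x y] C[OF s(1)] by simp
          also have "\<dots> \<le> q x + r y" using s(2,3) by (auto simp: le_fun_def intro: add_mono)
          finally show ?thesis .
        qed
        then have 1: "u (x + y) - q x \<le> r y" if "q \<in> C" "r \<in> C" for q r
          using that by (simp add: diff_le_eq add.commute)
        have "u (x + y) - q x \<le> u y" if "q \<in> C" for q
          unfolding u_def[of y] using False 1[OF that] by (rule cINF_greatest)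
        then have 2: "u (x + y) - u y \<le> q x" if "q \<in> C" for q
          using that by (simp add: diff_le_eq add.commute)
        have "u (x + y) - u y \<le> u x"
          unfolding u_def[of x] using False 2 by (rule cINF_greatest)
        then show ?thesis by simp
      qed
      have pos: "u (c *\<^sub>R x) \<le> c * u x" if c: "0 < c" for c x
      proof -
        have "u (c *\<^sub>R x) / c \<le> q x" if "q \<in> C" for q
          using u_le[OF that, of "c *\<^sub>R x"] sublinear_scale[of q c x] C[OF that] c
          by (simp add: field_simps)
        then have "u (c *\<^sub>R x) / c \<le> u x"
          unfolding u_def[of x] using False by (intro cINF_greatest) auto
        then show ?thesis using c by (simp add: field_simps)
      qed
      have "u (c *\<^sub>R x) = c * u x" if "0 \<le> c" for c x
      proof (cases "c = 0")
        case True
        have "(\<lambda>q. q 0) ` C = {0 :: real}" using False C sublinear_0 by (auto simp: image_iff)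
        then show ?thesis using True by (simp add: u_def)
      next
        case False
        then have "0 < c" using that by simp
        moreover have "u x \<le> inverse c * u (c *\<^sub>R x)"
          using pos[of "inverse c" "c *\<^sub>R x"] \<open>0 < c\<close> by simp
        ultimately show ?thesis using pos[of c x] by (auto simp: field_simps)
      qed
      then have "sublinear u" using add by (simp add: sublinear_def)
      moreover have "u x \<le> p x" for x
        using False u_le C by (meson ex_in_conv order_trans)
      ultimately show ?thesis using u_le by (intro bexI[of _ u]) (auto simp: le_fun_def)
    qed
  qed
  then obtain g where g: "sublinear g" "\<And>x. g x \<le> p x"
      and minimal: "\<And>q. sublinear q \<Longrightarrow> (\<forall>x. q x \<le> p x) \<Longrightarrow> q \<le> g \<Longrightarrow> q = g" by blast
  have odd: "g (- v) = - g v" for v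
  proof -
    obtain q where q: "sublinear q" "\<forall>x. q x \<le> g x" "q (- v) \<le> - g v"
      using sublinear_below_on_ray[OF g(1)] by blast
    have "q = g"
      using q g(2) by (intro minimal) (auto simp: le_fun_def intro: order_trans)
    then show ?thesis using q(3) sublinear_uminus[OF g(1), of v] by simp
  qed
  have "linear g"
  proof (rule linearI)
    fix x y
    show "g (x + y) = g x + g y"
      using sublinear_add[OF g(1), of x y] sublinear_add[OF g(1), of "x + y" "- y"] odd[of y] by simp
  next
    fix c :: real and x
    show "g (c *\<^sub>R x) = c *\<^sub>R g x"
    proof (cases "0 \<le> c")
      case True
      then show ?thesis using sublinear_scale[OF g(1)] by simp
    next
      case False
      then show ?thesis
        using sublinear_scale[OF g(1), of "- c" x] odd[of "c *\<^sub>R x"] by simp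
    qed
  qed
  then show ?thesis using g(2) by blast
qed

theorem Hahn_Banach_sublinear:
  fixes p :: "'a::real_vector \<Rightarrow> real"
  assumes p: "sublinear p" and S: "subspace S"
    and f: "\<And>x y. x \<in> S \<Longrightarrow> y \<in> S \<Longrightarrow> f (x + y) = f x + f y"
      "\<And>c x. x \<in> S \<Longrightarrow> f (c *\<^sub>R x) = c * f x"
      "\<And>x. x \<in> S \<Longrightarrow> f x \<le> p x"
  shows "\<exists>g. linear g \<and> (\<forall>x. g x \<le> p x) \<and> (\<forall>x\<in>S. g x = f x)"
proof -
  have f_minus: "f (- x) = - f x" if "x \<in> S" for x
    using f(2)[OF that, of "-1"] by simp
  have "\<exists>q. sublinear q \<and> (\<forall>x. q x \<le> p x) \<and> (\<forall>x\<in>S. q x \<le> f x)"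
  proof (rule sublinear_below_on_cone[OF p])
    fix x assume "x \<in> S"
    then show "- p (- x) \<le> f x"
      using f(3)[of "- x"] f_minus[of x] subspace_neg[OF S] by fastforce
  qed (use S f in \<open>auto simp: subspace_def\<close>)
  then obtain q where q: "sublinear q" "\<forall>x. q x \<le> p x" "\<forall>x\<in>S. q x \<le> f x" by blast
  obtain g where g: "linear g" "\<forall>x. g x \<le> q x" using linear_below_sublinear[OF q(1)] by blast
  have "g x = f x" if "x \<in> S" for x
  proof (rule antisym)
    show "g x \<le> f x" using g(2) q(3) that by (meson order_trans)
    have "g (- x) \<le> f (- x)" using g(2) q(3) subspace_neg[OF S that] by (meson order_trans)
    then show "f x \<le> g x" using f_minus[OF that] linear_neg[OF g(1)] by simp
  qed
  then show ?thesis using g q(2) by (meson order_trans)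
qed

lemma linear_below_sublinear_eq:
  fixes p :: "'a::real_vector \<Rightarrow> real"
  assumes p: "sublinear p"
  shows "\<exists>g. linear g \<and> (\<forall>x. g x \<le> p x) \<and> g v = p v"
proof -
  obtain q where q: "sublinear q" "\<forall>x. q x \<le> p x" "q (- v) \<le> - p v"
    using sublinear_below_on_ray[OF p] by blast
  obtain g where g: "linear g" "\<forall>x. g x \<le> q x" using linear_below_sublinear[OF q(1)] by blast
  have "g (- v) \<le> - p v" using g(2) q(3) by (meson order_trans)
  then have "p v \<le> g v" using linear_neg[OF g(1)] by simp
  moreover have le: "\<forall>x. g x \<le> p x" using g(2) q(2) by (meson order_trans)
  ultimately show ?thesis using g(1) by (meson antisym)
qed

lemma sublinear_norm: "0 \<le> c \<Longrightarrow> sublinear (\<lambda>x. c * norm x)"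
  unfolding sublinear_def
  by (auto simp: distrib_left[symmetric] norm_triangle_ineq intro!: mult_left_mono)

lemma blinfun_of_linear_le_norm:
  fixes g :: "'a::real_normed_vector \<Rightarrow> real"
  assumes g: "linear g" and le: "\<And>x. g x \<le> c * norm x" and "0 \<le> c"
  obtains h :: "'a \<Rightarrow>\<^sub>L real" where "blinfun_apply h = g" "norm h \<le> c"
proof -
  have abs: "norm (g x) \<le> norm x * c" for x
    using le[of x] le[of "- x"] linear_neg[OF g, of x] by (simp add: abs_le_iff mult.commute)
  have "bounded_linear g"
    using g abs by (auto intro!: bounded_linear_intro[where K = c] simp: linear_add linear_scale)
  then have "blinfun_apply (Blinfun g) = g" by (rule bounded_linear_Blinfun_apply)
  moreover have "norm (Blinfun g) \<le> c"
    using abs \<open>0 \<le> c\<close> calculation by (intro norm_blinfun_bound) (auto simp: mult.commute)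
  ultimately show thesis by (rule that)
qed

corollary Hahn_Banach_norm:
  fixes S :: "'a::real_normed_vector set"
  assumes S: "subspace S" and "0 \<le> c"
    and f: "\<And>x y. x \<in> S \<Longrightarrow> y \<in> S \<Longrightarrow> f (x + y) = f x + f y"
      "\<And>c x. x \<in> S \<Longrightarrow> f (c *\<^sub>R x) = c * f x"
      "\<And>x. x \<in> S \<Longrightarrow> \<bar>f x\<bar> \<le> c * norm x"
  obtains h :: "'a \<Rightarrow>\<^sub>L real" where "norm h \<le> c" "\<And>x. x \<in> S \<Longrightarrow> h x = f x"
proof -
  have "f x \<le> c * norm x" if "x \<in> S" for x using f(3)[OF that] by simp
  then obtain g where g: "linear g" "\<And>x. g x \<le> c * norm x" "\<forall>x\<in>S. g x = f x"
    using Hahn_Banach_sublinear[OF sublinear_norm[OF \<open>0 \<le> c\<close>] S, of f] f(1,2) by blast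
  obtain h :: "'a \<Rightarrow>\<^sub>L real" where "blinfun_apply h = g" "norm h \<le> c"
    using blinfun_of_linear_le_norm[OF g(1,2) \<open>0 \<le> c\<close>] by blast
  then show thesis using that g(3) by simp
qed

corollary norming_functional:
  fixes v :: "'a::real_normed_vector"
  obtains h :: "'a \<Rightarrow>\<^sub>L real" where "norm h \<le> 1" "h v = norm v"
proof -
  obtain g where g: "linear g" "\<And>x. g x \<le> 1 * norm x" "g v = norm v"
    using linear_below_sublinear_eq[OF sublinear_norm[of 1], of v] by auto
  obtain h :: "'a \<Rightarrow>\<^sub>L real" where "blinfun_apply h = g" "norm h \<le> 1"
    using blinfun_of_linear_le_norm[OF g(1,2)] by auto
  then show thesis using that g(3) by simp
qed

text \<open>The distance from a subspace is sublinear, and a linear functional below it vanishes on the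
  subspace.\<close>

corollary separating_functional:
  fixes S :: "'a::real_normed_vector set"
  assumes S: "subspace S" and v: "v \<notin> closure S"
  obtains h :: "'a \<Rightarrow>\<^sub>L real" where "\<And>x. x \<in> S \<Longrightarrow> h x = 0" "h v \<noteq> 0"
proof -
  have ne: "S \<noteq> {}" and 0: "0 \<in> S" using subspace_0[OF S] by auto
  let ?p = "\<lambda>x. infdist x S"
  have near: "\<exists>s\<in>S. norm (x - s) < ?p x + e" if "0 < e" for x e
  proof (rule ccontr)
    assume "\<not> ?thesis"
    then have "?p x + e \<le> ?p x"
      unfolding infdist_notempty[OF ne, of x] using ne
      by (intro cINF_greatest) (auto simp: not_less dist_norm)
    then show False using that by simp
  qed
  have p_le: "?p x \<le> norm (x - s)" if "s \<in> S" for x s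
    using infdist_le[OF that, of x] by (simp add: dist_norm)
  have add: "?p (x + y) \<le> ?p x + ?p y" for x y
  proof (rule field_le_epsilon)
    fix e :: real assume "0 < e"
    then obtain s t where st: "s \<in> S" "t \<in> S" "norm (x - s) < ?p x + e / 2" "norm (y - t) < ?p y + e / 2"
      using near[of "e / 2" x] near[of "e / 2" y] by auto
    have "?p (x + y) \<le> norm ((x - s) + (y - t))"
      using p_le[OF subspace_add[OF S st(1,2)], of "x + y"] by (simp add: algebra_simps)
    also have "\<dots> \<le> ?p x + ?p y + e" using norm_triangle_ineq[of "x - s" "y - t"] st by simp
    finally show "?p (x + y) \<le> ?p x + ?p y + e" .
  qed
  have pos: "?p (c *\<^sub>R x) \<le> c * ?p x" if c: "0 < c" for c x
  proof (rule field_le_epsilon)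
    fix e :: real assume "0 < e"
    then obtain s where s: "s \<in> S" "norm (x - s) < ?p x + e / c" using near[of "e / c" x] c by auto
    have "?p (c *\<^sub>R x) \<le> norm (c *\<^sub>R (x - s))"
      using p_le[OF subspace_scale[OF S s(1)], of "c *\<^sub>R x" c] by (simp add: algebra_simps)
    also have "\<dots> \<le> c * (?p x + e / c)" using s c by simp
    finally show "?p (c *\<^sub>R x) \<le> c * ?p x + e" using c by (simp add: distrib_left)
  qed
  have "?p (c *\<^sub>R x) = c * ?p x" if "0 \<le> c" for c x
  proof (cases "c = 0")
    case True
    then show ?thesis using 0 by simp
  next
    case False
    then have "0 < c" using that by simp
    moreover have "?p x \<le> inverse c * ?p (c *\<^sub>R x)"
      using pos[of "inverse c" "c *\<^sub>R x"] \<open>0 < c\<close> by simp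
    ultimately show ?thesis using pos[of c x] by (auto simp: field_simps)
  qed
  then have "sublinear ?p" using add by (simp add: sublinear_def)
  then obtain g where g: "linear g" "\<forall>x. g x \<le> ?p x" "g v = ?p v"
    using linear_below_sublinear_eq by blast
  have "g x \<le> 1 * norm x" for x using g(2) p_le[OF 0, of x] by (metis diff_zero mult_1 order_trans)
  then obtain h :: "'a \<Rightarrow>\<^sub>L real" where h: "blinfun_apply h = g"
    using blinfun_of_linear_le_norm[OF g(1), of 1] by auto
  have "g x = 0" if "x \<in> S" for x
    using g(2)[rule_format, of x] g(2)[rule_format, of "- x"] that subspace_neg[OF S that]
      linear_neg[OF g(1), of x] by simp
  moreover have "g v \<noteq> 0" using v g(3) ne by (simp add: in_closure_iff_infdist_zero)
  ultimately show thesis using that[of h] h by simp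
qed

text \<open>In the induction step some \<open>x\<close> in the common kernel of \<open>F\<close> has \<open>g x \<noteq> 0\<close>; subtracting
  the multiple of \<open>g\<close> that agrees with \<open>f\<close> at \<open>x\<close> gives a functional that vanishes on this kernel.\<close>

lemma in_span_if_kernel_subset:
  fixes F :: "('a::real_normed_vector \<Rightarrow>\<^sub>L real) set"
  assumes "finite F" "\<And>x. (\<forall>g\<in>F. g x = 0) \<Longrightarrow> blinfun_apply f x = 0"
  shows "f \<in> span F"
  using assms
proof (induction F arbitrary: f)
  case empty
  then have "f = 0" by (intro blinfun_eqI) simp
  then show ?case by (simp add: span_zero)
next
  case (insert g F)
  show ?case
  proof (cases "\<exists>x. (\<forall>h\<in>F. h x = 0) \<and> g x \<noteq> 0")
    case False
    then have "f \<in> span F" using insert.prems by (intro insert.IH) auto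
    then show ?thesis using span_mono[of F "insert g F"] by blast
  next
    case True
    then obtain x where x: "\<forall>h\<in>F. h x = 0" "g x \<noteq> 0" by blast
    define c where "c = f x / g x"
    have "f - c *\<^sub>R g \<in> span F"
    proof (rule insert.IH)
      fix y assume y: "\<forall>h\<in>F. blinfun_apply h y = 0"
      define z where "z = y - (g y / g x) *\<^sub>R x"
      have "\<forall>h\<in>insert g F. blinfun_apply h z = 0"
        using x y by (auto simp: z_def blinfun.diff_right blinfun.scaleR_right)
      then have "blinfun_apply f z = 0" by (rule insert.prems)
      then show "blinfun_apply (f - c *\<^sub>R g) y = 0"
        by (simp add: z_def c_def blinfun.diff_right blinfun.scaleR_right blinfun.diff_left blinfun.scaleR_left)
    qed
    then have "f - c *\<^sub>R g \<in> span (insert g F)" using span_mono[of F "insert g F"] by blast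
    moreover have "c *\<^sub>R g \<in> span (insert g F)" by (simp add: span_base span_scale)
    ultimately show ?thesis using span_add by fastforce
  qed
qed

section \<open>The weak topology through functionals\<close>

definition weak_nbhd :: "('a::real_normed_vector \<Rightarrow>\<^sub>L real) set \<Rightarrow> real \<Rightarrow> 'a \<Rightarrow> 'a set" where
  "weak_nbhd F e x = {y. \<forall>f\<in>F. \<bar>blinfun_apply f (y - x)\<bar> < e}"

lemma openin_weak_topology_vimage:
  fixes f :: "'a::real_normed_vector \<Rightarrow>\<^sub>L real"
  assumes "open U"
  shows "openin weak_topology (blinfun_apply f -` U)"
  unfolding weak_topology_def openin_topology_generated_by_iff
  by (rule generate_topology_on.Basis) (use assms in blast)

lemma openin_weak_nbhd:
  fixes F :: "('a::real_normed_vector \<Rightarrow>\<^sub>L real) set"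
  assumes "finite F"
  shows "openin weak_topology (weak_nbhd F e x)"
proof -
  have "weak_nbhd F e x = (\<Inter>f\<in>F. blinfun_apply f -` ball (f x) e) \<inter> topspace weak_topology"
    by (auto simp: weak_nbhd_def dist_real_def blinfun.diff_right abs_minus_commute)
  moreover have "openin weak_topology ((\<Inter>f\<in>F. blinfun_apply f -` ball (f x) e) \<inter> topspace weak_topology)"
    using assms by (intro openin_INT openin_weak_topology_vimage) auto
  ultimately show ?thesis by simp
qed

lemma weak_nbhd_self: "0 < e \<Longrightarrow> x \<in> weak_nbhd F e x"
  by (simp add: weak_nbhd_def)

lemma weak_nbhd_mono: "F \<subseteq> G \<Longrightarrow> d \<le> e \<Longrightarrow> weak_nbhd G d x \<subseteq> weak_nbhd F e x"
  by (fastforce simp: weak_nbhd_def)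

lemma openin_weak_topology_iff:
  fixes U :: "'a::real_normed_vector set"
  shows "openin weak_topology U \<longleftrightarrow> (\<forall>x\<in>U. \<exists>F e. finite F \<and> 0 < e \<and> weak_nbhd F e x \<subseteq> U)"
proof
  assume "openin weak_topology U"
  then have "generate_topology_on {blinfun_apply f -` U | (f :: 'a \<Rightarrow>\<^sub>L real) U. open U} U"
    by (simp add: weak_topology_def openin_topology_generated_by_iff)
  then show "\<forall>x\<in>U. \<exists>F e. finite F \<and> 0 < e \<and> weak_nbhd F e x \<subseteq> U"
  proof induction
    case (Int U V)
    show ?case
    proof
      fix x assume x: "x \<in> U \<inter> V"
      obtain F d where "finite F" "0 < d" "weak_nbhd F d x \<subseteq> U"
        using bspec[OF Int.IH(1), of x] x by auto
      moreover obtain G e where "finite G" "0 < e" "weak_nbhd G e x \<subseteq> V"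
        using bspec[OF Int.IH(2), of x] x by auto
      ultimately show "\<exists>F e. finite F \<and> 0 < e \<and> weak_nbhd F e x \<subseteq> U \<inter> V"
        using weak_nbhd_mono[of F "F \<union> G" "min d e" d x] weak_nbhd_mono[of G "F \<union> G" "min d e" e x]
        by (intro exI[of _ "F \<union> G"] exI[of _ "min d e"]) auto
    qed
  next
    case (UN K)
    then show ?case by (meson UnionE Union_upper order_trans)
  next
    case (Basis V)
    then obtain f :: "'a \<Rightarrow>\<^sub>L real" and W where V: "V = blinfun_apply f -` W" "open W" by blast
    show ?case
    proof
      fix x assume "x \<in> V"
      then obtain e where e: "0 < e" "ball (f x) e \<subseteq> W" using V open_contains_ball by blast
      have "weak_nbhd {f} e x \<subseteq> V"
      proof
        fix y assume "y \<in> weak_nbhd {f} e x"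
        then have "f y \<in> ball (f x) e"
          by (simp add: weak_nbhd_def dist_real_def blinfun.diff_right abs_minus_commute)
        then show "y \<in> V" using e V by blast
      qed
      then show "\<exists>F e. finite F \<and> 0 < e \<and> weak_nbhd F e x \<subseteq> V"
        using e by (intro exI[of _ "{f}"] exI[of _ e]) simp
    qed
  qed simp
next
  assume *: "\<forall>x\<in>U. \<exists>F e. finite F \<and> 0 < e \<and> weak_nbhd F e x \<subseteq> U"
  then show "openin weak_topology U"
    by (subst openin_subopen) (meson openin_weak_nbhd weak_nbhd_self)
qed

lemma weak_closure_iff:
  fixes A :: "'a::real_normed_vector set"
  shows "x \<in> weak_topology closure_of A \<longleftrightarrow>
    (\<forall>F e. finite F \<longrightarrow> 0 < e \<longrightarrow> weak_nbhd F e x \<inter> A \<noteq> {})"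
proof
  assume "x \<in> weak_topology closure_of A"
  then show "\<forall>F e. finite F \<longrightarrow> 0 < e \<longrightarrow> weak_nbhd F e x \<inter> A \<noteq> {}"
    unfolding in_closure_of by (meson openin_weak_nbhd weak_nbhd_self disjoint_iff)
next
  assume *: "\<forall>F e. finite F \<longrightarrow> 0 < e \<longrightarrow> weak_nbhd F e x \<inter> A \<noteq> {}"
  show "x \<in> weak_topology closure_of A"
    unfolding in_closure_of
  proof (intro conjI allI impI)
    fix T assume "x \<in> T \<and> openin weak_topology T"
    then obtain F e where "finite F" "0 < e" "weak_nbhd F e x \<subseteq> T"
      using openin_weak_topology_iff by blast
    then show "\<exists>y. y \<in> A \<and> y \<in> T" using * by blast
  qed simp
qed

lemma limitin_weak_topology_iff:
  fixes s :: "nat \<Rightarrow> 'a::real_normed_vector"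
  shows "limitin weak_topology s x sequentially \<longleftrightarrow>
     (\<forall>f :: 'a \<Rightarrow>\<^sub>L real. (\<lambda>n. blinfun_apply f (s n)) \<longlonglongrightarrow> blinfun_apply f x)"
proof
  assume lim: "limitin weak_topology s x sequentially"
  show "\<forall>f :: 'a \<Rightarrow>\<^sub>L real. (\<lambda>n. blinfun_apply f (s n)) \<longlonglongrightarrow> blinfun_apply f x"
  proof (intro allI tendstoI)
    fix f :: "'a \<Rightarrow>\<^sub>L real" and e :: real assume "0 < e"
    then have "\<forall>\<^sub>F n in sequentially. s n \<in> weak_nbhd {f} e x"
      using lim unfolding limitin_def by (simp add: openin_weak_nbhd weak_nbhd_self)
    then show "\<forall>\<^sub>F n in sequentially. dist (blinfun_apply f (s n)) (blinfun_apply f x) < e"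
      by (simp add: weak_nbhd_def dist_real_def blinfun.diff_right)
  qed
next
  assume lim: "\<forall>f :: 'a \<Rightarrow>\<^sub>L real. (\<lambda>n. blinfun_apply f (s n)) \<longlonglongrightarrow> blinfun_apply f x"
  show "limitin weak_topology s x sequentially"
    unfolding limitin_def
  proof (intro conjI allI impI)
    fix U assume "openin weak_topology U \<and> x \<in> U"
    then obtain F e where F: "finite F" "0 < e" "weak_nbhd F e x \<subseteq> U"
      using openin_weak_topology_iff by blast
    have "\<forall>\<^sub>F n in sequentially. \<bar>blinfun_apply f (s n - x)\<bar> < e" for f
      using tendstoD[OF lim[rule_format, of f] F(2)] by (simp add: dist_real_def blinfun.diff_right)
    then have "\<forall>\<^sub>F n in sequentially. \<forall>f\<in>F. \<bar>blinfun_apply f (s n - x)\<bar> < e"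
      using F(1) by (intro eventually_ball_finite) auto
    then show "\<forall>\<^sub>F n in sequentially. s n \<in> U"
      by (rule eventually_mono) (use F(3) in \<open>auto simp: weak_nbhd_def\<close>)
  qed simp
qed

lemma closedin_weak_vimage:
  fixes f :: "'a::real_normed_vector \<Rightarrow>\<^sub>L real"
  assumes "closed C"
  shows "closedin weak_topology (blinfun_apply f -` C)"
  using openin_weak_topology_vimage[OF open_Compl[OF assms], of f]
  by (simp add: closedin_def vimage_Compl[symmetric] Compl_eq_Diff_UNIV[symmetric])

lemma weak_closure_subspace:
  fixes S :: "'a::real_normed_vector set"
  assumes S: "subspace S" and z: "z \<in> weak_topology closure_of S"
  shows "z \<in> closure S"
proof (rule ccontr)
  assume "z \<notin> closure S"
  then obtain h :: "'a \<Rightarrow>\<^sub>L real" where h: "\<And>x. x \<in> S \<Longrightarrow> h x = 0" "h z \<noteq> 0"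
    using separating_functional[OF S] by blast
  then have "weak_nbhd {h} \<bar>h z\<bar> z \<inter> S \<noteq> {}"
    using z unfolding weak_closure_iff by simp
  then show False using h by (auto simp: weak_nbhd_def blinfun.diff_right)
qed

lemma closedin_weak_cball: "closedin weak_topology (cball 0 c :: 'a::real_normed_vector set)"
proof -
  have "weak_topology closure_of cball 0 c \<subseteq> (cball 0 c :: 'a set)"
  proof
    fix z :: 'a assume z: "z \<in> weak_topology closure_of cball 0 c"
    obtain h :: "'a \<Rightarrow>\<^sub>L real" where h: "norm h \<le> 1" "h z = norm z" using norming_functional by blast
    show "z \<in> cball 0 c"
    proof (rule ccontr)
      assume "z \<notin> cball 0 c"
      then have "weak_nbhd {h} (norm z - c) z \<inter> cball 0 c \<noteq> {}"
        using z unfolding weak_closure_iff by simp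
      then obtain y where "\<bar>h y - norm z\<bar> < norm z - c" "norm y \<le> c"
        using h(2) by (auto simp: weak_nbhd_def blinfun.diff_right)
      moreover have "h y \<le> norm y"
        using norm_blinfun[of h y] mult_right_mono[OF h(1) norm_ge_zero[of y]] by simp
      ultimately show False by linarith
    qed
  qed
  then show ?thesis by (simp add: closure_of_subset_eq[symmetric])
qed

lemma weak_unit_ball_nbhd_0_iff:
  fixes U :: "'a::real_normed_vector set"
  shows "nbhd_in weak_unit_ball 0 U \<longleftrightarrow>
    U \<subseteq> cball 0 1 \<and> (\<exists>F e. finite F \<and> 0 < e \<and> weak_nbhd F e 0 \<inter> cball 0 1 \<subseteq> U)"
proof safe
  assume "nbhd_in weak_unit_ball 0 U"
  then obtain T where T: "openin weak_unit_ball T" "0 \<in> T" "T \<subseteq> U"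
    by (auto simp: nbhd_in_def interior_of_def)
  then obtain V where V: "openin weak_topology V" "T = V \<inter> cball 0 1"
    by (auto simp: weak_unit_ball_def openin_subtopology)
  then obtain F e where "finite F" "0 < e" "weak_nbhd F e 0 \<subseteq> V"
    using T(2) openin_weak_topology_iff by blast
  then show "\<exists>F e. finite F \<and> 0 < e \<and> weak_nbhd F e 0 \<inter> cball 0 1 \<subseteq> U"
    using V(2) T(3) by blast
next
  fix F and e :: real
  assume *: "U \<subseteq> cball 0 1" "finite F" "0 < e" "weak_nbhd F e 0 \<inter> cball 0 1 \<subseteq> U"
  have "openin weak_unit_ball (weak_nbhd F e 0 \<inter> cball 0 1)"
    using openin_weak_nbhd[OF *(2)] by (auto simp: weak_unit_ball_def openin_subtopology)
  moreover have "0 \<in> weak_nbhd F e 0 \<inter> cball 0 1"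
    using *(3) weak_nbhd_self by fastforce
  ultimately show "nbhd_in weak_unit_ball 0 U"
    using * unfolding nbhd_in_def interior_of_def by auto
qed (auto simp: nbhd_in_def)

lemma weak_unit_ball_closure:
  assumes "A \<subseteq> cball 0 1"
  shows "weak_unit_ball closure_of A = weak_topology closure_of A"
proof -
  have "weak_topology closure_of A \<subseteq> cball 0 1"
    using assms closedin_weak_cball by (rule closure_of_minimal)
  then show ?thesis
    using assms by (auto simp: weak_unit_ball_def closure_of_subtopology Int_absorb1)
qed

section \<open>Weak* compactness of the dual ball\<close>

text \<open>The elements are plain functions, so that the topology of pointwise convergence on the type
  of functions is the weak* topology.\<close>

definition dual_ball :: "('a::real_normed_vector \<Rightarrow> real) set" where
  "dual_ball = {\<phi>. linear \<phi> \<and> (\<forall>x. \<bar>\<phi> x\<bar> \<le> norm x)}"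

lemma dual_ball_eq: "dual_ball = blinfun_apply ` (cball 0 1 :: ('a::real_normed_vector \<Rightarrow>\<^sub>L real) set)"
proof safe
  fix \<phi> :: "'a \<Rightarrow> real" assume "\<phi> \<in> dual_ball"
  then have "linear \<phi>" "\<And>x. \<phi> x \<le> 1 * norm x" by (auto simp: dual_ball_def abs_le_iff)
  then obtain h :: "'a \<Rightarrow>\<^sub>L real" where "blinfun_apply h = \<phi>" "norm h \<le> 1"
    using blinfun_of_linear_le_norm by (metis zero_le_one)
  then show "\<phi> \<in> blinfun_apply ` cball 0 1" by auto
next
  fix f :: "'a \<Rightarrow>\<^sub>L real" assume "f \<in> cball 0 1"
  then have "\<bar>f x\<bar> \<le> norm x" for x
    using norm_blinfun[of f x] mult_right_mono[of "norm f" 1 "norm x"] by simp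
  then show "blinfun_apply f \<in> dual_ball"
    by (simp add: dual_ball_def blinfun.bounded_linear_right bounded_linear.linear)
qed

lemma compact_UNIV_PiE:
  fixes S :: "'i \<Rightarrow> 'b::topological_space set"
  assumes "\<And>i. compact (S i)"
  shows "compact {\<phi>. \<forall>i. \<phi> i \<in> S i}"
proof -
  have "compactin (product_topology (\<lambda>_. euclidean) UNIV) (PiE UNIV S)"
    using assms by (simp add: compactin_PiE)
  moreover have "PiE UNIV S = {\<phi>. \<forall>i. \<phi> i \<in> S i}" by auto
  ultimately show ?thesis by (simp add: euclidean_product_topology)
qed

theorem Banach_Alaoglu: "compact (dual_ball :: ('a::real_normed_vector \<Rightarrow> real) set)"
proof -
  have cont: "continuous_on UNIV (\<lambda>\<phi> :: 'a \<Rightarrow> real. \<phi> x)" for x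
    by (rule continuous_on_product_coordinates)
  have "closed {\<phi> :: 'a \<Rightarrow> real. \<phi> (x + y) = \<phi> x + \<phi> y}" for x y
    by (intro closed_Collect_eq continuous_on_add cont)
  moreover have "closed {\<phi> :: 'a \<Rightarrow> real. \<phi> (c *\<^sub>R x) = c * \<phi> x}" for c x
    by (intro closed_Collect_eq continuous_on_mult continuous_on_const cont)
  ultimately have closed: "closed ((\<Inter>x. \<Inter>y. {\<phi> :: 'a \<Rightarrow> real. \<phi> (x + y) = \<phi> x + \<phi> y}) \<inter>
      (\<Inter>c. \<Inter>x. {\<phi> :: 'a \<Rightarrow> real. \<phi> (c *\<^sub>R x) = c * \<phi> x}))"
    by (intro closed_Int closed_INT ballI)
  have "compact {\<phi> :: 'a \<Rightarrow> real. \<forall>x. \<phi> x \<in> cball 0 (norm x)}"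
    by (rule compact_UNIV_PiE) simp
  from compact_Int_closed[OF this closed] show ?thesis
    by (rule back_subst[where P = compact]) (auto simp: dual_ball_def linear_iff)
qed

text \<open>By compactness a sign pattern that is realised on all finite pieces is realised globally.\<close>

lemma boolean_independent_pattern:
  fixes x :: "nat \<Rightarrow> 'a::real_normed_vector"
  assumes "boolean_independent r q x"
  obtains f :: "'a \<Rightarrow>\<^sub>L real"
  where "norm f \<le> 1" "\<And>i. i \<in> P \<Longrightarrow> f (x i) \<le> r" "\<And>i. i \<notin> P \<Longrightarrow> q \<le> f (x i)"
proof -
  define C where "C i = {\<phi> :: 'a \<Rightarrow> real. if i \<in> P then \<phi> (x i) \<le> r else q \<le> \<phi> (x i)}" for i
  have closed: "closed (C i)" for i
    unfolding C_def by (cases "i \<in> P") (auto intro!: closed_Collect_le)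
  have "dual_ball \<inter> \<Inter> (range C) \<noteq> {}"
  proof (rule compact_imp_fip[OF Banach_Alaoglu])
    show "closed T" if "T \<in> range C" for T using that closed by blast
    fix \<C> assume "finite \<C>" "\<C> \<subseteq> range C"
    then obtain I where I: "finite I" "\<C> = C ` I" by (meson finite_subset_image)
    then obtain n where n: "\<forall>i\<in>I. i < n" using finite_nat_set_iff_bounded by blast
    obtain f :: "'a \<Rightarrow>\<^sub>L real" where "norm f \<le> 1" "\<forall>i<n. if i \<in> P then f (x i) \<le> r else q \<le> f (x i)"
      using assms unfolding boolean_independent_def by blast
    then have "blinfun_apply f \<in> dual_ball \<inter> \<Inter> \<C>"
      using n I(2) by (auto simp: dual_ball_eq C_def)
    then show "dual_ball \<inter> \<Inter> \<C> \<noteq> {}" by blast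
  qed
  then obtain \<phi> where \<phi>: "\<phi> \<in> dual_ball" "\<And>i. \<phi> \<in> C i" by blast
  obtain f :: "'a \<Rightarrow>\<^sub>L real" where f: "norm f \<le> 1" "\<phi> = blinfun_apply f"
    using \<phi>(1) by (auto simp: dual_ball_eq)
  show thesis
    by (rule that[of f]) (use f \<phi>(2) in \<open>auto simp: C_def split: if_splits\<close>)
qed

text \<open>The weak topology has countable fan tightness at the origin.  For fixed \<open>n\<close>, each point
  \<open>x\<close> of \<open>A n\<close> gives an open set of sequences in the dual ball: those whose first \<open>n\<close> terms are
  small at \<open>x\<close>.  These sets cover the compact space of all sequences in the dual ball, and a finite
  subcover is given by a finite subset of \<open>A n\<close>.\<close>

lemma weak_fan_tightness:
  fixes A :: "nat \<Rightarrow> 'a::real_normed_vector set"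
  assumes A: "\<And>n. 0 \<in> weak_topology closure_of (A n)"
  obtains F where "\<And>n. finite (F n)" "\<And>n. F n \<subseteq> A n" "0 \<in> weak_topology closure_of (\<Union>n. F n)"
proof -
  let ?K = "{\<Phi> :: nat \<Rightarrow> 'a \<Rightarrow> real. \<forall>i. \<Phi> i \<in> dual_ball}"
  define W where "W n x = (\<Inter>i<n. {\<Phi> :: nat \<Rightarrow> 'a \<Rightarrow> real. \<bar>\<Phi> i x\<bar> < inverse (real (Suc n))})" for n x
  have K: "compact ?K" by (intro compact_UNIV_PiE Banach_Alaoglu)
  have "\<exists>F. finite F \<and> F \<subseteq> A n \<and> ?K \<subseteq> (\<Union>x\<in>F. W n x)" for n
  proof -
    have coord: "continuous_on UNIV (\<lambda>\<Phi> :: nat \<Rightarrow> 'a \<Rightarrow> real. \<Phi> i x)" for i x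
    proof -
      have "continuous_on UNIV ((\<lambda>\<phi> :: 'a \<Rightarrow> real. \<phi> x) \<circ> (\<lambda>\<Phi> :: nat \<Rightarrow> 'a \<Rightarrow> real. \<Phi> i))"
        by (rule continuous_on_compose; rule continuous_on_subset[OF continuous_on_product_coordinates]) auto
      then show ?thesis by (simp add: o_def)
    qed
    have "open (W n x)" for x
      unfolding W_def
      by (intro open_INT ballI finite_lessThan open_Collect_less continuous_on_rabs coord continuous_on_const)
    moreover have "?K \<subseteq> (\<Union>x\<in>A n. W n x)"
    proof
      fix \<Phi> assume "\<Phi> \<in> ?K"
      then have "\<forall>i. \<exists>f :: 'a \<Rightarrow>\<^sub>L real. \<Phi> i = blinfun_apply f" by (auto simp: dual_ball_eq image_iff)
      then obtain f :: "nat \<Rightarrow> 'a \<Rightarrow>\<^sub>L real" where f: "\<And>i. \<Phi> i = blinfun_apply (f i)" by metis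
      have "weak_nbhd (f ` {..<n}) (inverse (real (Suc n))) 0 \<inter> A n \<noteq> {}"
        using A[of n] unfolding weak_closure_iff by simp
      then show "\<Phi> \<in> (\<Union>x\<in>A n. W n x)" by (auto simp: weak_nbhd_def W_def f)
    qed
    ultimately obtain F where "F \<subseteq> A n" "finite F" "?K \<subseteq> (\<Union>x\<in>F. W n x)"
      using compactE_image[OF K, of "A n" "W n"] by blast
    then show ?thesis by blast
  qed
  then obtain F where F: "\<And>n. finite (F n)" "\<And>n. F n \<subseteq> A n" "\<And>n. ?K \<subseteq> (\<Union>x\<in>F n. W n x)" by metis
  have "0 \<in> weak_topology closure_of (\<Union>n. F n)"
    unfolding weak_closure_iff
  proof (intro allI impI)
    fix G :: "('a \<Rightarrow>\<^sub>L real) set" and e :: real assume G: "finite G" and "0 < e"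
    \<comment> \<open>Division by a common bound \<open>c\<close> of the norms moves the members of \<open>G\<close> into the dual ball.\<close>
    define c where "c = 1 + (\<Sum>f\<in>G. norm f)"
    have "1 \<le> c" using G by (simp add: c_def sum_nonneg)
    have norm_le: "norm f \<le> c" if "f \<in> G" for f
      using member_le_sum[of f G norm] G that by (simp add: c_def)
    obtain g m where g: "G = g ` {..<m :: nat}"
      using G by (metis finite_imp_nat_seg_image_inj_on lessThan_def)
    define \<Phi> where "\<Phi> i x = (if i < m then blinfun_apply (g i) x / c else 0)" for i x
    have "\<Phi> \<in> ?K"
    proof (intro CollectI allI)
      fix i
      show "\<Phi> i \<in> dual_ball"
      proof (cases "i < m")
        case True
        have "blinfun_apply (inverse c *\<^sub>R g i) \<in> dual_ball"
          unfolding dual_ball_eq using norm_le[of "g i"] True g \<open>1 \<le> c\<close>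
          by (intro imageI) (auto simp: field_simps)
        moreover have "blinfun_apply (inverse c *\<^sub>R g i) = \<Phi> i"
          using True by (auto simp: \<Phi>_def blinfun.scaleR_left field_simps)
        ultimately show ?thesis by simp
      next
        case False
        then have "\<Phi> i = (\<lambda>x. 0)" by (auto simp: \<Phi>_def)
        then show ?thesis by (simp add: dual_ball_def linear_iff)
      qed
    qed
    obtain k where k: "c / e < real k" using reals_Archimedean2 by blast
    define n where "n = max m k"
    obtain x where x: "x \<in> F n" "\<Phi> \<in> W n x" using F(3) \<open>\<Phi> \<in> ?K\<close> by blast
    have "\<bar>blinfun_apply f x\<bar> < e" if f: "f \<in> G" for f
    proof -
      obtain i where i: "f = g i" "i < m" using f unfolding g by blast
      then have "\<bar>blinfun_apply f x / c\<bar> < inverse (real (Suc n))"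
        using x(2) by (force simp: W_def \<Phi>_def n_def dest: bspec[where x = i])
      then have "\<bar>blinfun_apply f x\<bar> < c * inverse (real (Suc n))"
        using \<open>1 \<le> c\<close> by (simp add: abs_divide field_simps)
      also have "\<dots> \<le> e"
      proof -
        have "c / e \<le> real (Suc n)" using k by (simp add: n_def)
        then show ?thesis using \<open>0 < e\<close> by (simp add: field_simps)
      qed
      finally show ?thesis .
    qed
    then have "x \<in> weak_nbhd G e 0" by (simp add: weak_nbhd_def)
    then show "weak_nbhd G e 0 \<inter> (\<Union>n. F n) \<noteq> {}" using x(1) by blast
  qed
  then show thesis using that F by blast
qed

section \<open>Countable neighbourhood bases and separability of the dual\<close>

text \<open>Rational combinations are formed along lists, since lists over a countable set are countable.\<close>

lemma separable_closure_span:
  fixes G :: "'a::real_normed_vector set"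
  assumes "countable G"
  obtains D where "countable D" "closure (span G) \<subseteq> closure D"
proof -
  define comb where "comb l = (\<Sum>(q :: rat, g :: 'a)\<leftarrow>l. real_of_rat q *\<^sub>R g)" for l
  define D where "D = comb ` lists (UNIV \<times> G)"
  have "countable D"
    unfolding D_def using assms by (intro countable_image countable_lists countable_SIGMA) auto
  have D_add: "x + y \<in> D" if xy: "x \<in> D" "y \<in> D" for x y
  proof -
    obtain k l where kl: "k \<in> lists (UNIV \<times> G)" "l \<in> lists (UNIV \<times> G)" "x = comb k" "y = comb l"
      using xy unfolding D_def by blast
    then have "x + y = comb (k @ l)" by (simp add: comb_def)
    then show ?thesis unfolding D_def using kl by (intro image_eqI[of _ _ "k @ l"]) auto
  qed
  have D_scale: "real_of_rat q *\<^sub>R x \<in> D" if x: "x \<in> D" for q x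
  proof -
    obtain l where l: "l \<in> lists (UNIV \<times> G)" "x = comb l" using x unfolding D_def by blast
    have "real_of_rat q *\<^sub>R comb l = comb (map (\<lambda>(p, g). (q * p, g)) l)"
      by (induction l) (auto simp: comb_def scaleR_right_distrib of_rat_mult)
    moreover have "map (\<lambda>(p, g). (q * p, g)) l \<in> lists (UNIV \<times> G)" using l(1) by (auto simp: lists_eq_set)
    ultimately show ?thesis unfolding D_def using l(2) by (metis image_eqI)
  qed
  have "subspace (closure D)"
  proof (rule subspaceI)
    have "comb [] \<in> D" unfolding D_def by (intro imageI) simp
    then show "0 \<in> closure D" using closure_subset[of D] by (auto simp: comb_def)
  next
    fix x y assume "x \<in> closure D" "y \<in> closure D"
    then obtain s t where st: "\<forall>n. s n \<in> D" "s \<longlonglongrightarrow> x" "\<forall>n. t n \<in> D" "t \<longlonglongrightarrow> y"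
      unfolding closure_sequential by blast
    then show "x + y \<in> closure D"
      unfolding closure_sequential using D_add tendsto_add[OF st(2,4)]
      by (intro exI[of _ "\<lambda>n. s n + t n"]) simp
  next
    fix c :: real and x assume "x \<in> closure D"
    then obtain s where s: "\<forall>n. s n \<in> D" "s \<longlonglongrightarrow> x" unfolding closure_sequential by blast
    have "\<exists>q. c < of_rat q \<and> of_rat q < c + inverse (real (Suc n))" for n
      by (rule of_rat_dense) simp
    then obtain q where q: "\<And>n. c < of_rat (q n)" "\<And>n. of_rat (q n) < c + inverse (real (Suc n))" by metis
    have "(\<lambda>n. real_of_rat (q n)) \<longlonglongrightarrow> c"
    proof (rule tendsto_sandwich[where f = "\<lambda>_. c" and h = "\<lambda>n. c + inverse (real (Suc n))"])
      show "(\<lambda>n. c + inverse (real (Suc n))) \<longlonglongrightarrow> c"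
        using tendsto_add[OF tendsto_const LIMSEQ_inverse_real_of_nat, of c] by simp
    qed (use q in \<open>auto intro!: always_eventually less_imp_le\<close>)
    from tendsto_scaleR[OF this s(2)] show "c *\<^sub>R x \<in> closure D"
      unfolding closure_sequential using D_scale s(1)
      by (intro exI[of _ "\<lambda>n. real_of_rat (q n) *\<^sub>R s n"]) simp
  qed
  moreover have "G \<subseteq> D"
  proof
    fix g assume "g \<in> G"
    then show "g \<in> D"
      unfolding D_def by (intro image_eqI[of _ _ "[(1, g)]"]) (auto simp: comb_def)
  qed
  then have "G \<subseteq> closure D" using closure_subset by blast
  ultimately have "span G \<subseteq> closure D" using span_minimal by blast
  then have "closure (span G) \<subseteq> closure D" using closure_minimal closed_closure by blast
  then show thesis using that \<open>countable D\<close> by blast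
qed

text \<open>On the common kernel of the functionals of a basic neighbourhood inside
  \<open>{x. \<bar>f x\<bar> < e}\<close> the norm of \<open>f\<close> is at most \<open>e\<close>; an extension of this
  restriction differs from \<open>f\<close> by an element of their span.\<close>

lemma separable_dual_if_countable_base:
  fixes \<U> :: "'a::real_normed_vector set set"
  assumes "countable \<U>" and nbhd: "\<And>U. U \<in> \<U> \<Longrightarrow> nbhd_in weak_unit_ball 0 U"
    and base: "\<And>U. nbhd_in weak_unit_ball 0 U \<Longrightarrow> \<exists>V\<in>\<U>. V \<subseteq> U"
  shows "separable_space (euclidean :: ('a \<Rightarrow>\<^sub>L real) topology)"
proof -
  have "\<forall>U\<in>\<U>. \<exists>F e. finite F \<and> 0 < e \<and> weak_nbhd F e 0 \<inter> cball 0 1 \<subseteq> U"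
    using nbhd unfolding weak_unit_ball_nbhd_0_iff by blast
  then obtain F e where F: "\<And>U. U \<in> \<U> \<Longrightarrow> finite (F U)" "\<And>U. U \<in> \<U> \<Longrightarrow> 0 < (e U :: real)"
      "\<And>U. U \<in> \<U> \<Longrightarrow> weak_nbhd (F U) (e U) 0 \<inter> cball 0 1 \<subseteq> U"
    by metis
  define G where "G = (\<Union>U\<in>\<U>. F U)"
  have "countable G"
    unfolding G_def by (rule countable_UN[OF assms(1) countable_finite[OF F(1)]])
  have "f \<in> closure (span G)" for f
    unfolding closure_approachable
  proof (intro allI impI)
    fix d :: real assume "0 < d"
    then have "nbhd_in weak_unit_ball 0 (weak_nbhd {f} (d / 2) 0 \<inter> cball 0 1)"
      unfolding weak_unit_ball_nbhd_0_iff
      by (intro conjI exI[of _ "{f}"] exI[of _ "d / 2"]) auto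
    then obtain U where U: "U \<in> \<U>" "U \<subseteq> weak_nbhd {f} (d / 2) 0 \<inter> cball 0 1" using base by blast
    let ?N = "{x. \<forall>g\<in>F U. blinfun_apply g x = 0}"
    have N: "subspace ?N"
      by (auto simp: subspace_def blinfun.add_right blinfun.scaleR_right)
    have small: "\<bar>blinfun_apply f x\<bar> \<le> d / 2 * norm x" if x: "x \<in> ?N" for x
    proof (cases "x = 0")
      case False
      let ?y = "inverse (norm x) *\<^sub>R x"
      have "?y \<in> ?N" using subspace_scale[OF N x] by blast
      then have "?y \<in> weak_nbhd (F U) (e U) 0 \<inter> cball 0 1"
        using F(2)[OF U(1)] False by (auto simp: weak_nbhd_def)
      then have "\<bar>blinfun_apply f ?y\<bar> < d / 2"
        using F(3)[OF U(1)] U(2) by (auto simp: weak_nbhd_def)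
      then show ?thesis using False by (simp add: blinfun.scaleR_right abs_mult field_simps)
    qed simp
    have "0 \<le> d / 2" using \<open>0 < d\<close> by simp
    obtain h :: "'a \<Rightarrow>\<^sub>L real" where h: "norm h \<le> d / 2" "\<And>x. x \<in> ?N \<Longrightarrow> h x = f x"
      by (rule Hahn_Banach_norm[OF N \<open>0 \<le> d / 2\<close>, of "blinfun_apply f"])
        (use small in \<open>auto simp: blinfun.add_right blinfun.scaleR_right\<close>)
    have "f - h \<in> span (F U)"
      using h(2) by (intro in_span_if_kernel_subset F(1)[OF U(1)]) (simp add: blinfun.diff_left)
    then have "f - h \<in> span G" using span_mono[of "F U" G] U(1) by (auto simp: G_def)
    moreover have "dist (f - h) f < d" using h(1) \<open>0 < d\<close> by (simp add: dist_norm)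
    ultimately show "\<exists>g\<in>span G. dist g f < d" by blast
  qed
  moreover obtain D where "countable D" "closure (span G) \<subseteq> closure D"
    using separable_closure_span[OF \<open>countable G\<close>] by blast
  ultimately have "closure D = UNIV" by blast
  then show ?thesis using \<open>countable D\<close> by (auto simp: separable_space_def)
qed

text \<open>The strong Pytkeev property and countable cs*-character are used only at the origin of the
  ball; there a countable base already makes the dual separable.\<close>

definition strong_Pytkeev_at_0 :: "'a::real_normed_vector set set \<Rightarrow> bool" where
  "strong_Pytkeev_at_0 \<D> \<longleftrightarrow> countable \<D> \<and>
     (\<forall>U A. nbhd_in weak_unit_ball 0 U \<and> A \<subseteq> cball 0 1 \<and> 0 \<in> weak_topology closure_of A - A \<longrightarrow>
       (\<exists>D \<in> \<D>. D \<subseteq> U \<and> infinite (D \<inter> A)))"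

text \<open>Fan tightness turns a strong Pytkeev network into a neighbourhood base: let \<open>d 0, d 1, \<dots>\<close> be
  the members contained in \<open>U\<close>.  If no finite union of them were a neighbourhood, their complements
  would accumulate at the origin, and finite subsets of these complements would form a set that
  still accumulates there but meets each \<open>d m\<close> in a finite set only.\<close>

lemma separable_dual_if_strong_Pytkeev_at_0:
  fixes \<D> :: "'a::real_normed_vector set set"
  assumes \<D>: "strong_Pytkeev_at_0 \<D>"
  shows "separable_space (euclidean :: ('a \<Rightarrow>\<^sub>L real) topology)"
proof (rule separable_dual_if_countable_base)
  let ?\<U> = "{U \<in> (\<lambda>\<F>. insert 0 (\<Union>\<F>)) ` {\<F>. \<F> \<subseteq> insert {} \<D> \<and> finite \<F>}. nbhd_in weak_unit_ball 0 U}"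
  have "countable (insert {} \<D>)" using \<D> by (simp add: strong_Pytkeev_at_0_def)
  then have "countable {\<F>. \<F> \<subseteq> insert {} \<D> \<and> finite \<F>}"
    using countable_Collect_finite_subset[of "insert {} \<D>"] by (simp add: conj_commute)
  then show "countable ?\<U>"
    by (intro countable_Collect countable_image)
  show "nbhd_in weak_unit_ball 0 U" if "U \<in> ?\<U>" for U using that by simp
  fix U :: "'a set" assume U: "nbhd_in weak_unit_ball 0 U"
  have U01: "U \<subseteq> cball 0 1" "0 \<in> U"
    using U interior_of_subset[of weak_unit_ball U] by (auto simp: nbhd_in_def)
  define \<E> where "\<E> = insert {} {D \<in> \<D>. D \<subseteq> U}"
  have \<E>: "countable \<E>" "\<E> \<noteq> {}" using \<D> by (auto simp: \<E>_def strong_Pytkeev_at_0_def)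
  define d where "d = from_nat_into \<E>"
  have d: "range d = \<E>" using range_from_nat_into[OF \<E>(2,1)] by (simp add: d_def)
  define E where "E n = insert 0 (\<Union>i<n. d i)" for n
  have d_sub: "d i \<subseteq> U" for i using d by (auto simp: \<E>_def)
  then have E_sub: "E n \<subseteq> U" for n using U01 by (auto simp: E_def)
  have "\<exists>n. nbhd_in weak_unit_ball 0 (E n)"
  proof (rule ccontr)
    assume none: "\<not> ?thesis"
    have "0 \<in> weak_topology closure_of (cball 0 1 - E n)" for n
      unfolding weak_closure_iff
    proof (intro allI impI)
      fix F :: "('a \<Rightarrow>\<^sub>L real) set" and e :: real assume "finite F" "0 < e"
      then have "\<not> weak_nbhd F e 0 \<inter> cball 0 1 \<subseteq> E n"
        using none E_sub[of n] U01(1) unfolding weak_unit_ball_nbhd_0_iff by blast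
      then show "weak_nbhd F e 0 \<inter> (cball 0 1 - E n) \<noteq> {}" by blast
    qed
    then obtain F where F: "\<And>n. finite (F n)" "\<And>n. F n \<subseteq> cball 0 1 - E n"
        "0 \<in> weak_topology closure_of (\<Union>n. F n)"
      by (rule weak_fan_tightness[of "\<lambda>n. cball 0 1 - E n"]) blast
    have "(\<Union>n. F n) \<subseteq> cball 0 1" "0 \<notin> (\<Union>n. F n)" using F(2) by (auto simp: E_def)
    then obtain D where D: "D \<in> \<D>" "D \<subseteq> U" "infinite (D \<inter> (\<Union>n. F n))"
      using \<D> U F(3) unfolding strong_Pytkeev_at_0_def by blast
    then have "D \<in> range d" unfolding d \<E>_def by blast
    then obtain m where m: "D = d m" by blast
    have "n \<le> m" if "x \<in> D" "x \<in> F n" for x n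
    proof (rule ccontr)
      assume "\<not> n \<le> m"
      then show False using F(2)[of n] that by (auto simp: E_def m)
    qed
    then have "D \<inter> (\<Union>n. F n) \<subseteq> (\<Union>n\<le>m. F n)" by blast
    then show False using D(3) F(1) by (meson finite_UN_I finite_atMost finite_subset)
  qed
  then obtain n where n: "nbhd_in weak_unit_ball 0 (E n)" by blast
  have "E n = insert 0 (\<Union>(d ` {..<n}))" by (simp add: E_def)
  moreover have "d ` {..<n} \<subseteq> insert {} \<D>" using d by (auto simp: \<E>_def)
  ultimately have "E n \<in> ?\<U>" using n by blast
  then show "\<exists>V\<in>?\<U>. V \<subseteq> U" using E_sub by blast
qed

section \<open>Countable cs*-character and weakly Cauchy subsequences\<close>

definition cs_star_at_0 :: "'a::real_normed_vector set set \<Rightarrow> bool" where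
  "cs_star_at_0 \<D> \<longleftrightarrow> countable \<D> \<and>
     (\<forall>s U. range s \<subseteq> cball 0 1 \<and> limitin weak_topology s 0 sequentially \<and> nbhd_in weak_unit_ball 0 U \<longrightarrow>
       (\<exists>D \<in> \<D>. D \<subseteq> U \<and> infinite {n :: nat. s n \<in> D}))"

lemma weak_limit_eq_frequent_value:
  fixes s :: "nat \<Rightarrow> 'a::real_normed_vector"
  assumes lim: "limitin weak_topology s z sequentially" and inf: "infinite {n. s n = a}"
  shows "a = z"
proof (rule ccontr)
  assume "a \<noteq> z"
  obtain h :: "'a \<Rightarrow>\<^sub>L real" where "blinfun_apply h (a - z) = norm (a - z)"
    using norming_functional by blast
  then have "0 < blinfun_apply h (a - z)" using \<open>a \<noteq> z\<close> by simp
  then have "blinfun_apply h z < blinfun_apply h a" by (simp add: blinfun.diff_right)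
  then have "\<forall>\<^sub>F n in sequentially. blinfun_apply h (s n) < blinfun_apply h a"
    using lim unfolding limitin_weak_topology_iff by (intro order_tendstoD(2)) auto
  then obtain N where N: "\<And>n. N \<le> n \<Longrightarrow> blinfun_apply h (s n) < blinfun_apply h a"
    unfolding eventually_sequentially by blast
  obtain n where "N \<le> n" "s n = a"
    using inf unfolding infinite_nat_iff_unbounded_le by blast
  then show False using N[of n] by simp
qed

lemma uncountable_ex_islimpt:
  fixes S :: "'a::second_countable_topology set"
  assumes "uncountable S"
  obtains x where "x \<in> S" "x islimpt S"
proof -
  have "\<exists>x\<in>S. x islimpt S"
  proof (rule ccontr)
    assume "\<not> ?thesis"
    then have "\<not> x islimpt S" if "x \<in> S" for x using that by blast
    then have iso: "\<exists>T. open T \<and> x \<in> T \<and> T \<inter> S \<subseteq> {x}" if "x \<in> S" for x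
      using that unfolding islimpt_def by (metis IntE insertI1 subsetI singletonI)
    obtain B :: "'a set set" where B: "countable B" "topological_basis B" using ex_countable_basis by blast
    have "\<exists>b\<in>B. b \<inter> S = {x}" if x: "x \<in> S" for x
    proof -
      obtain T where T: "open T" "x \<in> T" "T \<inter> S \<subseteq> {x}" using iso[OF x] by blast
      then obtain b where "b \<in> B" "x \<in> b" "b \<subseteq> T" using topological_basisE[OF B(2)] by metis
      then show ?thesis using T x by blast
    qed
    then have sing: "\<exists>b\<in>B. b \<inter> S = {x}" if "x \<in> S" for x using that by blast
    have "S \<subseteq> (\<lambda>b. the_elem (b \<inter> S)) ` B"
    proof
      fix x assume "x \<in> S"
      then obtain b where "b \<in> B" "b \<inter> S = {x}" using sing by blast
      then show "x \<in> (\<lambda>b. the_elem (b \<inter> S)) ` B" by (intro image_eqI[of _ _ b]) auto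
    qed
    from countable_subset[OF this countable_image[OF B(1)]] show False using assms by blast
  qed
  then show thesis using that by blast
qed

text \<open>For the relation of having distance greater than \<open>e\<close>, such a set is an \<open>e\<close>-net.\<close>

lemma ex_maximal_pairwise:
  obtains S where "pairwise R S" "\<And>x. x \<notin> S \<Longrightarrow> \<exists>y\<in>S. \<not> R x y \<or> \<not> R y x"
proof -
  have "\<exists>S\<in>{S. pairwise R S}. \<forall>T\<in>{S. pairwise R S}. S \<subseteq> T \<longrightarrow> T = S"
  proof (rule subset_Zorn')
    fix \<C> assume chain: "subset.chain {S. pairwise R S} \<C>"
    have "R x y" if xy: "x \<in> \<Union>\<C>" "y \<in> \<Union>\<C>" "x \<noteq> y" for x y
    proof -
      obtain S T where ST: "S \<in> \<C>" "T \<in> \<C>" "x \<in> S" "y \<in> T" using xy(1,2) by blast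
      then have "S \<subseteq> T \<or> T \<subseteq> S" "pairwise R S" "pairwise R T"
        using chain unfolding subset_chain_def by blast+
      then show ?thesis using ST xy(3) unfolding pairwise_def by blast
    qed
    then show "\<Union>\<C> \<in> {S. pairwise R S}" by (simp add: pairwise_def)
  qed
  then obtain S where S: "pairwise R S" "\<And>T. pairwise R T \<Longrightarrow> S \<subseteq> T \<Longrightarrow> T = S" by blast
  have "\<exists>y\<in>S. \<not> R x y \<or> \<not> R y x" if "x \<notin> S" for x
  proof (rule ccontr)
    assume "\<not> ?thesis"
    then have "pairwise R (insert x S)" using S(1) by (simp add: pairwise_insert)
    then show False using S(2) that by blast
  qed
  then show thesis using that S(1) by blast
qed

text \<open>Record a functional \<open>f\<close> by its values on \<open>A\<close> and by the
  members of the network on which \<open>\<bar>f\<bar> < e / 8\<close>.  An uncountable separated set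
  has a member \<open>f\<close> whose record is a limit of records of other members \<open>g n\<close>, which are
  distant from \<open>f\<close> at points \<open>x n\<close> of \<open>A\<close>.  If \<open>x\<close> is weakly Cauchy, differences of its terms
  form a weakly null sequence on which the \<open>g n\<close> are still large.  But a member of
  the network on which \<open>f\<close> is small contains infinitely many of its terms, and the \<open>g n\<close>
  are eventually small on that member, too.\<close>

lemma countable_if_separated_on:
  fixes \<D> :: "'a::real_normed_vector set set" and A :: "'a set" and S :: "('a \<Rightarrow>\<^sub>L real) set"
  assumes \<D>: "cs_star_at_0 \<D>"
    and Cauchy: "\<And>x :: nat \<Rightarrow> 'a. range x \<subseteq> cball 0 1 \<Longrightarrow> \<exists>\<sigma>. strict_mono \<sigma> \<and> weakly_Cauchy (x \<circ> \<sigma>)"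
    and A: "countable A" "A \<subseteq> cball 0 1" and e: "0 < e"
    and sep: "pairwise (\<lambda>f g. \<exists>a\<in>A. e < \<bar>blinfun_apply f a - blinfun_apply g a\<bar>) S"
  shows "countable S"
proof (cases "A = {}")
  case True
  then have "S \<subseteq> {f}" if "f \<in> S" for f using sep that by (auto simp: pairwise_def)
  then have "finite S" by (meson finite.emptyI finite_insert finite_subset subsetI)
  then show ?thesis by (rule countable_finite)
next
  case False
  show ?thesis
  proof (rule ccontr)
    assume unc: "uncountable S"
    define a where "a = from_nat_into A"
    have a: "range a = A" using range_from_nat_into[OF False A(1)] by (simp add: a_def)
    define d where "d = from_nat_into (insert {} \<D>)"
    have "countable (insert {} \<D>)" using \<D> by (simp add: cs_star_at_0_def)
    then have d: "range d = insert {} \<D>"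
      unfolding d_def by (intro range_from_nat_into) auto
    define U where "U f = weak_nbhd {f} (e / 8) 0 \<inter> cball 0 1" for f :: "'a \<Rightarrow>\<^sub>L real"
    \<comment> \<open>The record of \<open>f\<close>; it lives in a second countable space.\<close>
    define \<Psi> where "\<Psi> f = (\<lambda>i. blinfun_apply f (a i), \<lambda>i. if d i \<subseteq> U f then 1 else 0 :: real)"
      for f :: "'a \<Rightarrow>\<^sub>L real"
    have "inj_on \<Psi> S"
    proof (rule inj_onI, rule ccontr)
      fix f g assume fg: "f \<in> S" "g \<in> S" "\<Psi> f = \<Psi> g" "f \<noteq> g"
      then obtain x where "x \<in> A" "e < \<bar>blinfun_apply f x - blinfun_apply g x\<bar>" using sep unfolding pairwise_def by blast
      moreover obtain i where "x = a i" using a \<open>x \<in> A\<close> by blast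
      moreover have "blinfun_apply f (a i) = blinfun_apply g (a i)" using fg(3) by (auto simp: \<Psi>_def dest: fun_cong)
      ultimately show False using e by simp
    qed
    then have "uncountable (\<Psi> ` S)" using unc by (metis countable_image_inj_on)
    then obtain f where f: "f \<in> S" "\<Psi> f islimpt \<Psi> ` S"
      using uncountable_ex_islimpt by (metis imageE)
    then obtain p where p: "\<forall>n. p n \<in> \<Psi> ` S - {\<Psi> f}" "p \<longlonglongrightarrow> \<Psi> f"
      unfolding islimpt_sequential by blast
    then have "\<forall>n. \<exists>g\<in>S. p n = \<Psi> g \<and> g \<noteq> f" by blast
    then obtain g0 where g0: "\<And>n. g0 n \<in> S" "\<And>n. p n = \<Psi> (g0 n)" "\<And>n. g0 n \<noteq> f" by metis
    have "\<exists>x\<in>A. e < \<bar>blinfun_apply (g0 n) x - blinfun_apply f x\<bar>" for n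
      using sep g0 f(1) unfolding pairwise_def by blast
    then obtain x0 where x0: "\<And>n. x0 n \<in> A" "\<And>n. e < \<bar>blinfun_apply (g0 n) (x0 n) - blinfun_apply f (x0 n)\<bar>"
      by metis
    obtain \<sigma> where \<sigma>: "strict_mono \<sigma>" "weakly_Cauchy (x0 \<circ> \<sigma>)"
      using Cauchy[of x0] x0(1) A(2) by blast
    define g x where "g n = g0 (\<sigma> n)" and "x n = x0 (\<sigma> n)" for n
    have x: "x n \<in> A" "e < \<bar>blinfun_apply (g n) (x n) - blinfun_apply f (x n)\<bar>" for n
      using x0 by (simp_all add: x_def g_def)
    have conv: "convergent (\<lambda>n. blinfun_apply h (x n))" for h :: "'a \<Rightarrow>\<^sub>L real"
      using \<sigma>(2) by (simp add: weakly_Cauchy_def x_def)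
    have coord: "(\<lambda>n. F n i) \<longlonglongrightarrow> L i" if "F \<longlonglongrightarrow> L" for F :: "nat \<Rightarrow> nat \<Rightarrow> real" and L i
    proof -
      have "isCont (\<lambda>h :: nat \<Rightarrow> real. h i) L"
        using continuous_on_product_coordinates[of i, where ?'b = real]
        unfolding continuous_on_eq_continuous_at[OF open_UNIV] by simp
      then show ?thesis using that by (rule isCont_tendsto_compose)
    qed
    have "(\<lambda>n. \<Psi> (g n)) \<longlonglongrightarrow> \<Psi> f"
      using LIMSEQ_subseq_LIMSEQ[OF p(2) \<sigma>(1)] by (simp add: o_def g0(2) g_def)
    then have fst: "(\<lambda>n. fst (\<Psi> (g n)) i) \<longlonglongrightarrow> fst (\<Psi> f) i"
      and snd: "(\<lambda>n. snd (\<Psi> (g n)) i) \<longlonglongrightarrow> snd (\<Psi> f) i" for i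
      using coord[OF tendsto_fst, of _ _ i] coord[OF tendsto_snd, of _ _ i] by blast+
    have lim_A: "(\<lambda>n. blinfun_apply (g n) y) \<longlonglongrightarrow> blinfun_apply f y" if "y \<in> A" for y
    proof -
      obtain i where "y = a i" using \<open>y \<in> A\<close> a by blast
      then show ?thesis using fst[of i] by (simp add: \<Psi>_def)
    qed
    have inherit: "\<forall>\<^sub>F n in sequentially. d i \<subseteq> U (g n)" if "d i \<subseteq> U f" for i
    proof -
      have "\<forall>\<^sub>F n in sequentially. snd (\<Psi> (g n)) i > 1 / 2"
        using snd[of i] that by (intro order_tendstoD(1)) (auto simp: \<Psi>_def)
      then show ?thesis by eventually_elim (auto simp: \<Psi>_def split: if_splits)
    qed
    have "\<exists>m\<ge>k. \<bar>blinfun_apply (g m) (x k) - blinfun_apply f (x k)\<bar> < e / 4" for k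
    proof -
      have "\<forall>\<^sub>F m in sequentially. \<bar>blinfun_apply (g m) (x k) - blinfun_apply f (x k)\<bar> < e / 4"
        using tendstoD[OF lim_A[OF x(1)[of k]], of "e / 4"] e by (simp add: dist_real_def)
      then obtain N where "\<forall>m\<ge>N. \<bar>blinfun_apply (g m) (x k) - blinfun_apply f (x k)\<bar> < e / 4"
        unfolding eventually_sequentially by blast
      then show ?thesis by (intro exI[of _ "max N k"]) simp
    qed
    then obtain \<rho> where \<rho>: "\<And>k. k \<le> \<rho> k"
        "\<And>k. \<bar>blinfun_apply (g (\<rho> k)) (x k) - blinfun_apply f (x k)\<bar> < e / 4" by metis
    have \<rho>_top: "filterlim \<rho> at_top sequentially"
      by (rule filterlim_at_top_mono[OF filterlim_ident]) (simp add: \<rho>(1))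
    \<comment> \<open>At \<open>x k\<close> the functional \<open>g (\<rho> k)\<close> is close to \<open>f\<close>, at \<open>x (\<rho> k)\<close> it is not.\<close>
    define y where "y k = (1 / 2) *\<^sub>R (x (\<rho> k) - x k)" for k
    have y_ball: "range y \<subseteq> cball 0 1"
    proof clarify
      fix k
      have "norm (x (\<rho> k) - x k) \<le> 1 + 1"
        using x(1)[of "\<rho> k"] x(1)[of k] A(2) by (intro norm_triangle_le_diff add_mono) auto
      then show "y k \<in> cball 0 1" by (simp add: y_def)
    qed
    have y_lim: "(\<lambda>k. blinfun_apply h (y k)) \<longlonglongrightarrow> 0" for h :: "'a \<Rightarrow>\<^sub>L real"
    proof -
      obtain l where l: "(\<lambda>n. blinfun_apply h (x n)) \<longlonglongrightarrow> l" using conv[of h] by (auto simp: convergent_def)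
      then have "(\<lambda>n. blinfun_apply h (x (\<rho> n))) \<longlonglongrightarrow> l" using filterlim_compose \<rho>_top by blast
      from tendsto_mult[OF tendsto_const tendsto_diff[OF this l], of "1 / 2"] show ?thesis
        by (simp add: y_def blinfun.scaleR_right blinfun.diff_right)
    qed
    then have "limitin weak_topology y 0 sequentially" by (simp add: limitin_weak_topology_iff)
    moreover have "nbhd_in weak_unit_ball 0 (U f)"
      unfolding weak_unit_ball_nbhd_0_iff U_def using e
      by (intro conjI exI[of _ "{f}"] exI[of _ "e / 8"]) auto
    ultimately obtain D where D: "D \<in> \<D>" "D \<subseteq> U f" "infinite {k. y k \<in> D}"
      using \<D> y_ball unfolding cs_star_at_0_def by blast
    then obtain i where i: "D = d i" using d by (metis insertI2 rangeE)
    have "\<forall>\<^sub>F k in sequentially. d i \<subseteq> U (g (\<rho> k))"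
      using eventually_compose_filterlim[OF inherit \<rho>_top] D(2) i by blast
    moreover have "\<forall>\<^sub>F k in sequentially. \<bar>blinfun_apply f (y k)\<bar> < e / 8"
      using tendstoD[OF y_lim[of f], of "e / 8"] e by simp
    ultimately have "\<forall>\<^sub>F k in sequentially. d i \<subseteq> U (g (\<rho> k)) \<and> \<bar>blinfun_apply f (y k)\<bar> < e / 8"
      by eventually_elim simp
    then obtain N where N: "\<And>k. N \<le> k \<Longrightarrow> d i \<subseteq> U (g (\<rho> k)) \<and> \<bar>blinfun_apply f (y k)\<bar> < e / 8"
      unfolding eventually_sequentially by blast
    obtain k where k: "N \<le> k" "y k \<in> D"
      using D(3) unfolding infinite_nat_iff_unbounded_le by blast
    then have "\<bar>blinfun_apply (g (\<rho> k)) (y k)\<bar> < e / 8"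
      using N[OF k(1)] i by (auto simp: U_def weak_nbhd_def)
    moreover have "\<bar>blinfun_apply f (y k)\<bar> < e / 8" using N[OF k(1)] by simp
    moreover have "blinfun_apply (g (\<rho> k)) (y k) - blinfun_apply f (y k) =
        (1 / 2) * ((blinfun_apply (g (\<rho> k)) (x (\<rho> k)) - blinfun_apply f (x (\<rho> k))) -
          (blinfun_apply (g (\<rho> k)) (x k) - blinfun_apply f (x k)))"
      by (simp add: y_def blinfun.scaleR_right blinfun.diff_right algebra_simps)
    ultimately have "\<bar>blinfun_apply (g (\<rho> k)) (x (\<rho> k)) - blinfun_apply f (x (\<rho> k))\<bar> \<le> e"
      using \<rho>(2)[of k] unfolding abs_less_iff abs_le_iff by argo
    then show False using x(2)[of "\<rho> k"] by simp
  qed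
qed

lemma ex_countable_uniformly_dense_on:
  fixes \<D> :: "'a::real_normed_vector set set" and A :: "'a set"
  assumes \<D>: "cs_star_at_0 \<D>"
    and Cauchy: "\<And>x :: nat \<Rightarrow> 'a. range x \<subseteq> cball 0 1 \<Longrightarrow> \<exists>\<sigma>. strict_mono \<sigma> \<and> weakly_Cauchy (x \<circ> \<sigma>)"
    and A: "countable A" "A \<subseteq> cball 0 1"
  obtains G :: "('a \<Rightarrow>\<^sub>L real) set"
  where "countable G" "\<And>f e. 0 < e \<Longrightarrow> \<exists>g\<in>G. \<forall>a\<in>A. \<bar>blinfun_apply f a - blinfun_apply g a\<bar> \<le> e"
proof -
  have "\<exists>S. countable S \<and> (\<forall>f :: 'a \<Rightarrow>\<^sub>L real. \<exists>g\<in>S. \<forall>a\<in>A. \<bar>blinfun_apply f a - blinfun_apply g a\<bar> \<le> e)"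
    if e: "0 < e" for e :: real
  proof -
    let ?R = "\<lambda>(f :: 'a \<Rightarrow>\<^sub>L real) (g :: 'a \<Rightarrow>\<^sub>L real). \<exists>a\<in>A. e < \<bar>blinfun_apply f a - blinfun_apply g a\<bar>"
    obtain S where S: "pairwise ?R S" "\<And>f. f \<notin> S \<Longrightarrow> \<exists>g\<in>S. \<not> ?R f g \<or> \<not> ?R g f"
      by (rule ex_maximal_pairwise[of ?R]) blast
    have "countable S" using countable_if_separated_on[OF \<D> Cauchy A e S(1)] .
    moreover have "\<exists>g\<in>S. \<forall>a\<in>A. \<bar>blinfun_apply f a - blinfun_apply g a\<bar> \<le> e" for f
    proof (cases "f \<in> S")
      case True
      then show ?thesis using e by (intro bexI[of _ f]) auto
    next
      case False
      then obtain g where "g \<in> S" "\<not> ?R f g \<or> \<not> ?R g f" using S(2) by blast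
      then show ?thesis by (intro bexI[of _ g]) (auto simp: not_less abs_minus_commute)
    qed
    ultimately show ?thesis by blast
  qed
  then have "\<forall>n. \<exists>S. countable S \<and> (\<forall>f. \<exists>g\<in>S. \<forall>a\<in>A. \<bar>blinfun_apply f a - blinfun_apply g a\<bar> \<le> inverse (real (Suc n)))"
    by simp
  then obtain S where S: "\<And>n. countable (S n)"
      "\<And>n f. \<exists>g\<in>S n. \<forall>a\<in>A. \<bar>blinfun_apply f a - blinfun_apply g a\<bar> \<le> inverse (real (Suc n))"
    by metis
  show thesis
  proof (rule that[of "\<Union>n. S n"])
    show "countable (\<Union>n. S n)" using S(1) by blast
    fix f :: "'a \<Rightarrow>\<^sub>L real" and e :: real assume "0 < e"
    then obtain n where n: "inverse (real (Suc n)) < e" using reals_Archimedean by blast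
    obtain g where "g \<in> S n" "\<forall>a\<in>A. \<bar>blinfun_apply f a - blinfun_apply g a\<bar> \<le> inverse (real (Suc n))"
      using S(2) by blast
    then show "\<exists>g\<in>(\<Union>n. S n). \<forall>a\<in>A. \<bar>blinfun_apply f a - blinfun_apply g a\<bar> \<le> e"
      using n by (intro bexI[of _ g]) (auto intro: order_trans less_imp_le)
  qed
qed

text \<open>Fan tightness reduces to countable \<open>A\<close>; there, countably many functionals control all
  others uniformly on \<open>A\<close>.\<close>

lemma weakly_null_sequence_in:
  fixes \<D> :: "'a::real_normed_vector set set" and A :: "'a set"
  assumes \<D>: "cs_star_at_0 \<D>"
    and Cauchy: "\<And>x :: nat \<Rightarrow> 'a. range x \<subseteq> cball 0 1 \<Longrightarrow> \<exists>\<sigma>. strict_mono \<sigma> \<and> weakly_Cauchy (x \<circ> \<sigma>)"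
    and A: "A \<subseteq> cball 0 1" "0 \<in> weak_topology closure_of A"
  obtains s where "range s \<subseteq> A" "limitin weak_topology s 0 sequentially"
proof -
  obtain F where F: "\<And>n :: nat. finite (F n)" "\<And>n. F n \<subseteq> A" "0 \<in> weak_topology closure_of (\<Union>n. F n)"
    using weak_fan_tightness[of "\<lambda>_. A"] A(2) by blast
  define C where "C = (\<Union>n. F n)"
  have C: "countable C" "C \<subseteq> A" "0 \<in> weak_topology closure_of C"
    using F by (auto simp: C_def countable_finite)
  obtain G :: "('a \<Rightarrow>\<^sub>L real) set" where G: "countable G" "\<And>f e. 0 < e \<Longrightarrow> \<exists>g\<in>G. \<forall>a\<in>C. \<bar>blinfun_apply f a - blinfun_apply g a\<bar> \<le> e"
    using ex_countable_uniformly_dense_on[OF \<D> Cauchy C(1)] C(2) A(1) by (metis order_trans)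
  have "G \<noteq> {}" using G(2)[of 1] by auto
  define g where "g = from_nat_into G"
  have g: "range g = G" using range_from_nat_into[OF \<open>G \<noteq> {}\<close> G(1)] by (simp add: g_def)
  have "\<exists>x. x \<in> weak_nbhd (g ` {..<n}) (inverse (real (Suc n))) 0 \<inter> C" for n
    using C(3)[unfolded weak_closure_iff, rule_format, of "g ` {..<n}" "inverse (real (Suc n))"] by fastforce
  then obtain s where s: "\<And>n. s n \<in> C" "\<And>n. s n \<in> weak_nbhd (g ` {..<n}) (inverse (real (Suc n))) 0"
    by (metis IntE)
  have "(\<lambda>n. blinfun_apply f (s n)) \<longlonglongrightarrow> 0" for f :: "'a \<Rightarrow>\<^sub>L real"
  proof (rule tendstoI)
    fix e :: real assume "0 < e"
    then obtain h where h: "h \<in> G" "\<forall>a\<in>C. \<bar>blinfun_apply f a - blinfun_apply h a\<bar> \<le> e / 2" using G(2)[of "e / 2" f] by auto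
    then obtain j where j: "h = g j" using g by blast
    have "\<forall>\<^sub>F n in sequentially. inverse (real (Suc n)) < e / 2"
      using order_tendstoD(2)[OF LIMSEQ_inverse_real_of_nat, of "e / 2"] \<open>0 < e\<close> by simp
    with eventually_gt_at_top[of j] show "\<forall>\<^sub>F n in sequentially. dist (blinfun_apply f (s n)) 0 < e"
    proof eventually_elim
      case (elim n)
      have "\<bar>h (s n)\<bar> < inverse (real (Suc n))" using s(2)[of n] elim(1) j by (auto simp: weak_nbhd_def)
      then show ?case using h(2)[rule_format, OF s(1)[of n]] elim(2) unfolding dist_real_def by linarith
    qed
  qed
  then have "limitin weak_topology s 0 sequentially" by (simp add: limitin_weak_topology_iff)
  then show thesis using that s(1) C(2) by blast
qed

text \<open>A weakly null sequence in \<open>A\<close> turns the cs*-property into the strong Pytkeev property: a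
  set that contains infinitely many terms contains infinitely many values, as a value that is
  repeated infinitely often would be the limit \<open>0\<close>, which is not in \<open>A\<close>.\<close>

theorem separable_dual_if_cs_star_at_0:
  fixes \<D> :: "'a::real_normed_vector set set"
  assumes \<D>: "cs_star_at_0 \<D>"
    and Cauchy: "\<And>x :: nat \<Rightarrow> 'a. range x \<subseteq> cball 0 1 \<Longrightarrow> \<exists>\<sigma>. strict_mono \<sigma> \<and> weakly_Cauchy (x \<circ> \<sigma>)"
  shows "separable_space (euclidean :: ('a \<Rightarrow>\<^sub>L real) topology)"
proof (rule separable_dual_if_strong_Pytkeev_at_0)
  show "strong_Pytkeev_at_0 \<D>"
    unfolding strong_Pytkeev_at_0_def
  proof (intro conjI allI impI; (elim conjE)?)
    show "countable \<D>" using \<D> by (simp add: cs_star_at_0_def)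
    fix U A :: "'a set" assume U: "nbhd_in weak_unit_ball 0 U" and A: "A \<subseteq> cball 0 1"
      and 0: "0 \<in> weak_topology closure_of A - (A :: 'a set)"
    obtain s where s: "range s \<subseteq> A" "limitin weak_topology s 0 sequentially"
      using weakly_null_sequence_in[OF \<D> Cauchy A] 0 by blast
    then obtain D where D: "D \<in> \<D>" "D \<subseteq> U" "infinite {n. s n \<in> D}"
      using \<D> U A unfolding cs_star_at_0_def by (meson order_trans)
    have "infinite (D \<inter> A)"
    proof
      assume "finite (D \<inter> A)"
      moreover have "s ` {n. s n \<in> D} \<subseteq> D \<inter> A" using s(1) by auto
      ultimately have "finite (s ` {n. s n \<in> D})" by (metis finite_subset)
      then obtain k where k: "s k \<in> D" "infinite {n \<in> {n. s n \<in> D}. s n = s k}"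
        using pigeonhole_infinite[OF D(3)] by blast
      have "infinite {n. s n = s k}" using k(2) by (rule contrapos_nn) (auto intro: finite_subset)
      then have "s k = 0" using weak_limit_eq_frequent_value[OF s(2)] by blast
      moreover have "s k \<in> A" using s(1) by blast
      ultimately show False using 0 by auto
    qed
    then show "\<exists>D\<in>\<D>. D \<subseteq> U \<and> infinite (D \<inter> A)" using D by blast
  qed
qed

section \<open>Independent sequences and copies of the space of summable sequences\<close>

text \<open>Two functionals that realise the sign pattern of \<open>c\<close> and the opposite pattern differ by at
  least \<open>q - r\<close> on each term, with the sign of \<open>c i\<close>, while their difference has norm at most
  two.\<close>

lemma boolean_independent_ell1_bound:
  fixes x :: "nat \<Rightarrow> 'a::real_normed_vector"
  assumes x: "boolean_independent r q x" and "r < q"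
  shows "(q - r) / 2 * (\<Sum>i<n. \<bar>c i\<bar>) \<le> norm (\<Sum>i<n. c i *\<^sub>R x i)"
proof -
  obtain f :: "'a \<Rightarrow>\<^sub>L real" where f: "norm f \<le> 1" "\<forall>i<n. if i \<in> {i. c i < 0} then f (x i) \<le> r else q \<le> f (x i)"
    using x unfolding boolean_independent_def by metis
  obtain g :: "'a \<Rightarrow>\<^sub>L real" where g: "norm g \<le> 1" "\<forall>i<n. if i \<in> {i. 0 \<le> c i} then g (x i) \<le> r else q \<le> g (x i)"
    using x unfolding boolean_independent_def by metis
  let ?v = "\<Sum>i<n. c i *\<^sub>R x i"
  have "(q - r) * \<bar>c i\<bar> \<le> c i * blinfun_apply (f - g) (x i)" if "i < n" for i
  proof (cases "c i < 0")
    case True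
    then have "q - r \<le> - blinfun_apply (f - g) (x i)" using f(2) g(2) that by (force simp: blinfun.diff_left)
    from mult_left_mono[OF this, of "- c i"] show ?thesis using True by (simp add: mult.commute)
  next
    case False
    then have "q - r \<le> blinfun_apply (f - g) (x i)" using f(2) g(2) that by (force simp: blinfun.diff_left)
    from mult_left_mono[OF this, of "c i"] show ?thesis using False by (simp add: mult.commute)
  qed
  then have "(\<Sum>i<n. (q - r) * \<bar>c i\<bar>) \<le> (\<Sum>i<n. c i * blinfun_apply (f - g) (x i))"
    by (intro sum_mono) simp
  also have "\<dots> = blinfun_apply (f - g) ?v" by (simp add: blinfun.sum_right blinfun.scaleR_right)
  also have "\<dots> \<le> norm (f - g) * norm ?v" using norm_blinfun[of "f - g" ?v] by simp
  also have "\<dots> \<le> 2 * norm ?v"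
    using norm_triangle_ineq4[of f g] f(1) g(1) by (intro mult_right_mono) auto
  finally show ?thesis by (simp add: sum_distrib_left[symmetric])
qed

lemma ell1_embedding_if_boolean_independent:
  fixes x :: "nat \<Rightarrow> 'a::banach"
  assumes x: "boolean_independent r q x" and "r < q" and bdd: "\<And>n. norm (x n) \<le> 1"
  shows "ell1_isomorphic_embedding (\<lambda>c. \<Sum>n. c n *\<^sub>R x n)"
proof -
  have le: "norm (c n *\<^sub>R x n) \<le> \<bar>c n\<bar>" for c n
    using mult_left_mono[OF bdd[of n], of "\<bar>c n\<bar>"] by simp
  have summable_norm: "summable (\<lambda>n. norm (c n *\<^sub>R x n))" if "c \<in> ell1" for c
  proof (rule summable_comparison_test'[where g = "\<lambda>n. \<bar>c n\<bar>"])
    show "summable (\<lambda>n. \<bar>c n\<bar>)" using that by (simp add: ell1_def)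
    show "norm (norm (c n *\<^sub>R x n)) \<le> \<bar>c n\<bar>" if "0 \<le> n" for n
      using le[of c n] by (simp del: norm_scaleR)
  qed
  have summable: "summable (\<lambda>n. c n *\<^sub>R x n)" if "c \<in> ell1" for c
    using summable_norm[OF that] by (rule summable_norm_cancel)
  show ?thesis
    unfolding ell1_isomorphic_embedding_def
  proof (intro conjI ballI allI exI)
    show "0 < (q - r) / 2" using \<open>r < q\<close> by simp
    fix c assume c: "c \<in> ell1"
    show "(\<Sum>n. (c n + d n) *\<^sub>R x n) = (\<Sum>n. c n *\<^sub>R x n) + (\<Sum>n. d n *\<^sub>R x n)" if "d \<in> ell1" for d
      using suminf_add[OF summable[OF c] summable[OF that]] by (simp add: scaleR_left_distrib)
    show "(\<Sum>n. (a * c n) *\<^sub>R x n) = a *\<^sub>R (\<Sum>n. c n *\<^sub>R x n)" for a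
      using suminf_scaleR_right[OF summable[OF c], of a] by simp
    show "norm (\<Sum>n. c n *\<^sub>R x n) \<le> 1 * ell1_norm c"
      using Series.summable_norm[OF summable_norm[OF c]] suminf_le[OF le[of c] summable_norm[OF c]] c
      by (simp add: ell1_def ell1_norm_def)
    have "(\<lambda>n. (q - r) / 2 * (\<Sum>i<n. \<bar>c i\<bar>)) \<longlonglongrightarrow> (q - r) / 2 * ell1_norm c"
      using c unfolding ell1_norm_def by (intro tendsto_mult tendsto_const summable_LIMSEQ) (simp add: ell1_def)
    moreover have "(\<lambda>n. norm (\<Sum>i<n. c i *\<^sub>R x i)) \<longlonglongrightarrow> norm (\<Sum>n. c n *\<^sub>R x n)"
      by (intro tendsto_norm summable_LIMSEQ summable c)
    ultimately show "(q - r) / 2 * ell1_norm c \<le> norm (\<Sum>n. c n *\<^sub>R x n)"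
      by (rule LIMSEQ_le) (use boolean_independent_ell1_bound[OF x \<open>r < q\<close>] in blast)
  qed
qed

section \<open>Independent sequences and k-spaces\<close>

lemma diff_in_closure_subspace:
  fixes S :: "'a::real_normed_vector set"
  assumes "subspace S" "x \<in> closure S" "y \<in> closure S"
  shows "x - y \<in> closure S"
proof -
  obtain s t where st: "\<forall>n. s n \<in> S" "s \<longlonglongrightarrow> x" "\<forall>n. t n \<in> S" "t \<longlonglongrightarrow> y"
    using assms(2,3) unfolding closure_sequential by blast
  then show ?thesis
    unfolding closure_sequential using tendsto_diff[OF st(2,4)] subspace_diff[OF assms(1)]
    by (intro exI[of _ "\<lambda>n. s n - t n"]) simp
qed

text \<open>Countably many functionals \<open>g i\<close> separate the points of the closed span of \<open>C\<close>.  A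
  sequence in \<open>C\<close> on which each \<open>g i\<close> converges to \<open>g i z\<close> has no weak cluster point but \<open>z\<close>,
  so it converges in the compact set \<open>K\<close>.\<close>

lemma weakly_convergent_sequence_in_compact:
  fixes K :: "'a::real_normed_vector set"
  assumes K: "compactin weak_topology K" and C: "countable C" "C \<subseteq> K"
    and z: "z \<in> weak_topology closure_of C"
  obtains s where "range s \<subseteq> C" "limitin weak_topology s z sequentially"
proof -
  have in_span: "w \<in> closure (span C)" if "w \<in> weak_topology closure_of C" for w
    using that closure_of_mono[OF span_superset[of C], of weak_topology]
    by (intro weak_closure_subspace) auto
  obtain D where D: "countable D" "closure (span C) \<subseteq> closure D"
    using separable_closure_span[OF C(1)] by blast
  have "D \<noteq> {}" using in_span[OF z] D(2) by auto
  define d where "d = from_nat_into D"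
  have d: "range d = D" using range_from_nat_into[OF \<open>D \<noteq> {}\<close> D(1)] by (simp add: d_def)
  have "\<exists>g :: 'a \<Rightarrow>\<^sub>L real. norm g \<le> 1 \<and> blinfun_apply g (d i) = norm (d i)" for i
    by (rule norming_functional[of "d i"]) blast
  then obtain g :: "nat \<Rightarrow> 'a \<Rightarrow>\<^sub>L real"
    where g: "\<And>i. norm (g i) \<le> 1" "\<And>i. blinfun_apply (g i) (d i) = norm (d i)" by metis
  have separates: "v = 0" if v: "v \<in> closure (span C)" "\<And>i. blinfun_apply (g i) v = 0" for v
  proof (rule ccontr)
    assume "v \<noteq> 0"
    then obtain y where "y \<in> D" "dist y v < norm v / 2"
      using v(1) D(2) by (metis closure_approachable half_gt_zero subsetD zero_less_norm_iff)
    then obtain i where i: "norm (d i - v) < norm v / 2" using d by (auto simp: dist_norm)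
    have "norm (d i) = blinfun_apply (g i) (d i - v)" by (simp add: g(2) v(2) blinfun.diff_right)
    also have "\<dots> \<le> norm (d i - v)"
      using norm_blinfun[of "g i" "d i - v"] mult_right_mono[OF g(1)[of i] norm_ge_zero[of "d i - v"]] by simp
    finally have "norm (d i) < norm v / 2" using i by simp
    then show False using norm_triangle_sub[of v "d i"] i by (simp add: norm_minus_commute)
  qed
  have "\<exists>x. x \<in> weak_nbhd (g ` {..<n}) (inverse (real (Suc n))) z \<inter> C" for n
    using z[unfolded weak_closure_iff, rule_format, of "g ` {..<n}" "inverse (real (Suc n))"] by fastforce
  then obtain s where s: "\<And>n. s n \<in> C" "\<And>n. s n \<in> weak_nbhd (g ` {..<n}) (inverse (real (Suc n))) z"
    by (metis IntE)
  have "(\<lambda>n. blinfun_apply f (s n)) \<longlonglongrightarrow> blinfun_apply f z" for f :: "'a \<Rightarrow>\<^sub>L real"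
  proof (rule ccontr)
    assume "\<not> ?thesis"
    then obtain e where e: "0 < e" "\<And>N. \<exists>n\<ge>N. e \<le> \<bar>blinfun_apply f (s n) - blinfun_apply f z\<bar>"
      unfolding lim_sequentially by (auto simp: dist_real_def not_less)
    define T where "T N = {s n | n. N \<le> n \<and> e \<le> \<bar>blinfun_apply f (s n) - blinfun_apply f z\<bar>}" for N
    have T_sub: "T N \<subseteq> C" for N using s(1) by (auto simp: T_def)
    let ?\<U> = "range (\<lambda>N. weak_topology closure_of T N)"
    have "K \<inter> \<Inter>\<F> \<noteq> {}" if \<F>: "finite \<F>" "\<F> \<subseteq> ?\<U>" for \<F>
    proof -
      obtain I where I: "finite I" "\<F> = (\<lambda>N. weak_topology closure_of T N) ` I"
        using finite_subset_image[OF \<F>] by blast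
      then obtain M where M: "\<forall>i\<in>I. i < M" using finite_nat_set_iff_bounded by blast
      obtain n where n: "M \<le> n" "e \<le> \<bar>blinfun_apply f (s n) - blinfun_apply f z\<bar>" using e(2) by blast
      have "s n \<in> weak_topology closure_of T i" if "i \<in> I" for i
      proof -
        have "s n \<in> T i" using n bspec[OF M that] unfolding T_def by (intro CollectI exI[of _ n]) simp
        then show ?thesis using closure_of_subset[of "T i" weak_topology] by auto
      qed
      then have "s n \<in> K \<inter> \<Inter>\<F>" using s(1)[of n] C(2) I(2) by auto
      then show ?thesis by blast
    qed
    then have "K \<inter> \<Inter>?\<U> \<noteq> {}"
      using K unfolding compactin_fip by (metis (no_types, lifting) closedin_closure_of imageE)
    then obtain w where w: "\<And>N. w \<in> weak_topology closure_of T N" by blast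
    have w_in: "w \<in> blinfun_apply h -` X" if "closed X" "T N \<subseteq> blinfun_apply h -` X" for h :: "'a \<Rightarrow>\<^sub>L real" and N X
      using w[of N] closure_of_minimal[OF that(2) closedin_weak_vimage[OF that(1)]] by blast
    have "blinfun_apply (g i) (w - z) = 0" for i
    proof -
      have "\<bar>blinfun_apply (g i) w - blinfun_apply (g i) z\<bar> \<le> c" if c: "0 < c" for c
      proof -
        obtain N where N: "inverse (real (Suc N)) < c" using reals_Archimedean[OF c] by blast
        have "T (max N (Suc i)) \<subseteq> blinfun_apply (g i) -` {t. \<bar>t - blinfun_apply (g i) z\<bar> \<le> c}"
        proof
          fix y assume "y \<in> T (max N (Suc i))"
          then obtain n where n: "y = s n" "N \<le> n" "i < n" by (auto simp: T_def)
          have "inverse (real (Suc n)) \<le> inverse (real (Suc N))" using n(2) by (simp add: field_simps)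
          moreover have "\<bar>blinfun_apply (g i) (s n) - blinfun_apply (g i) z\<bar> < inverse (real (Suc n))"
            using s(2)[of n] n(3) by (auto simp: weak_nbhd_def blinfun.diff_right)
          ultimately have "\<bar>blinfun_apply (g i) (s n) - blinfun_apply (g i) z\<bar> \<le> c"
            using N by linarith
          then show "y \<in> blinfun_apply (g i) -` {t. \<bar>t - blinfun_apply (g i) z\<bar> \<le> c}"
            using n(1) by simp
        qed
        moreover have "closed {t. \<bar>t - blinfun_apply (g i) z\<bar> \<le> c}"
          by (intro closed_Collect_le continuous_intros)
        ultimately show ?thesis using w_in by blast
      qed
      then have "\<bar>blinfun_apply (g i) w - blinfun_apply (g i) z\<bar> \<le> 0"
        using field_le_epsilon[of "\<bar>blinfun_apply (g i) w - blinfun_apply (g i) z\<bar>" 0] by simp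
      then show ?thesis by (simp add: blinfun.diff_right)
    qed
    moreover have "w \<in> weak_topology closure_of C"
      using w[of 0] closure_of_mono[OF T_sub[of 0], of weak_topology] by blast
    ultimately have "w - z = 0"
      using in_span[OF z] in_span by (intro separates diff_in_closure_subspace) auto
    moreover have "closed {t. e \<le> \<bar>t - blinfun_apply f z\<bar>}"
      by (intro closed_Collect_le continuous_intros)
    then have "w \<in> blinfun_apply f -` {t. e \<le> \<bar>t - blinfun_apply f z\<bar>}"
      by (rule w_in[of _ 0]) (auto simp: T_def)
    ultimately show False using e(1) by simp
  qed
  then have "limitin weak_topology s z sequentially" by (simp add: limitin_weak_topology_iff)
  then show thesis using that s(1) by blast
qed

lemma ex_subseq_convergent_on_finite:
  fixes x :: "nat \<Rightarrow> 'a::real_normed_vector" and F :: "('a \<Rightarrow>\<^sub>L real) set"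
  assumes "finite F" "bounded (range x)"
  shows "\<exists>\<sigma>. strict_mono \<sigma> \<and> (\<forall>f\<in>F. convergent (\<lambda>n. blinfun_apply f (x (\<sigma> n))))"
  using assms(1)
proof induction
  case empty
  then show ?case using strict_mono_id by auto
next
  case (insert f F)
  then obtain \<sigma> where \<sigma>: "strict_mono \<sigma>" "\<forall>f\<in>F. convergent (\<lambda>n. blinfun_apply f (x (\<sigma> n)))" by blast
  have "bounded (blinfun_apply f ` range x)"
    using assms(2) by (intro bounded_linear_image blinfun.bounded_linear_right)
  then have "bounded (range (\<lambda>n. blinfun_apply f (x (\<sigma> n))))"
    by (rule bounded_subset) auto
  then obtain \<rho> l where \<rho>: "strict_mono \<rho>" "((\<lambda>n. blinfun_apply f (x (\<sigma> n))) \<circ> \<rho>) \<longlonglongrightarrow> l"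
    using bounded_imp_convergent_subsequence by blast
  have "convergent (\<lambda>n. blinfun_apply h (x (\<sigma> (\<rho> n))))" if "h \<in> insert f F" for h
  proof (cases "h = f")
    case True
    then show ?thesis using \<rho>(2) by (auto simp: convergent_def o_def)
  next
    case False
    then have "convergent ((\<lambda>n. blinfun_apply h (x (\<sigma> n))) \<circ> \<rho>)"
      using that \<sigma>(2) \<rho>(1) by (intro convergent_subseq_convergent) auto
    then show ?thesis by (simp add: o_def)
  qed
  then show ?case
    using strict_mono_o[OF \<sigma>(1) \<rho>(1)] by (intro exI[of _ "\<sigma> \<circ> \<rho>"]) (simp add: o_def)
qed

text \<open>On finitely many functionals a subsequence of \<open>x\<close> converges, so that consecutive terms of it
  become close.\<close>

lemma zero_in_weak_closure_differences:
  fixes x :: "nat \<Rightarrow> 'a::real_normed_vector"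
  assumes "bounded (range x)"
  shows "0 \<in> weak_topology closure_of {(1 / 2) *\<^sub>R (x i - x j) | i j. i < j}"
  unfolding weak_closure_iff
proof (intro allI impI)
  fix F :: "('a \<Rightarrow>\<^sub>L real) set" and e :: real assume F: "finite F" and e: "0 < e"
  obtain \<sigma> where \<sigma>: "strict_mono \<sigma>" "\<forall>f\<in>F. convergent (\<lambda>n. blinfun_apply f (x (\<sigma> n)))"
    using ex_subseq_convergent_on_finite[OF F assms] by blast
  have "\<forall>\<^sub>F n in sequentially. \<bar>blinfun_apply f (x (\<sigma> n)) - blinfun_apply f (x (\<sigma> (Suc n)))\<bar> < e"
    if f: "f \<in> F" for f
  proof -
    obtain l where l: "(\<lambda>n. blinfun_apply f (x (\<sigma> n))) \<longlonglongrightarrow> l" using \<sigma>(2) f unfolding convergent_def by blast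
    from tendsto_diff[OF l LIMSEQ_Suc[OF l]] show ?thesis using e by (auto dest: tendstoD simp: dist_real_def)
  qed
  then have "\<forall>\<^sub>F n in sequentially. \<forall>f\<in>F. \<bar>blinfun_apply f (x (\<sigma> n)) - blinfun_apply f (x (\<sigma> (Suc n)))\<bar> < e"
    using F by (intro eventually_ball_finite) auto
  then obtain n where n: "\<forall>f\<in>F. \<bar>blinfun_apply f (x (\<sigma> n)) - blinfun_apply f (x (\<sigma> (Suc n)))\<bar> < e"
    unfolding eventually_sequentially by blast
  have "(1 / 2) *\<^sub>R (x (\<sigma> n) - x (\<sigma> (Suc n))) \<in> weak_nbhd F e 0"
    using n e by (force simp: weak_nbhd_def blinfun.scaleR_right blinfun.diff_right)
  moreover have "\<sigma> n < \<sigma> (Suc n)" using \<sigma>(1) by (simp add: strict_mono_Suc_iff)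
  ultimately show "weak_nbhd F e 0 \<inter> {(1 / 2) *\<^sub>R (x i - x j) | i j. i < j} \<noteq> {}" by blast
qed

lemma no_alternation_along_convergent:
  fixes u :: "nat \<Rightarrow> real" and \<rho> :: "nat \<Rightarrow> nat"
  assumes "convergent u" "strict_mono \<rho>" "b < c"
    "\<And>k. even k \<Longrightarrow> c \<le> u (\<rho> k)" "\<And>k. odd k \<Longrightarrow> u (\<rho> k) \<le> b"
  shows False
proof -
  obtain l where "u \<longlonglongrightarrow> l" using assms(1) by (auto simp: convergent_def)
  then have l: "(\<lambda>k. u (\<rho> k)) \<longlonglongrightarrow> l" using LIMSEQ_subseq_LIMSEQ[OF _ assms(2)] by (simp add: o_def)
  have "strict_mono (\<lambda>k :: nat. 2 * k)" "strict_mono (\<lambda>k :: nat. 2 * k + 1)" by (simp_all add: strict_mono_def)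
  then have "(\<lambda>k. u (\<rho> (2 * k))) \<longlonglongrightarrow> l" "(\<lambda>k. u (\<rho> (2 * k + 1))) \<longlonglongrightarrow> l"
    using LIMSEQ_subseq_LIMSEQ[OF l] by (auto simp: o_def)
  then have "c \<le> l" "l \<le> b"
    using assms(4,5) by (auto intro: LIMSEQ_le_const LIMSEQ_le_const2)
  then show False using assms(3) by simp
qed

text \<open>Along a subsequence either \<open>i\<close> is constant and \<open>j\<close> increases, or all the indices
  \<open>i n\<close> and \<open>j n\<close> are different.  In both cases some sign pattern on the terms of \<open>x\<close> makes a
  functional alternate between two separated values.\<close>

lemma differences_not_weakly_convergent:
  fixes x :: "nat \<Rightarrow> 'a::real_normed_vector"
  assumes x: "boolean_independent r q x" and "r < q"
    and ij: "\<And>n. i n < j n" and j: "\<And>N. finite {n. j n \<le> N}"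
    and lim: "limitin weak_topology (\<lambda>n. (1 / 2) *\<^sub>R (x (i n) - x (j n))) z sequentially"
  shows False
proof -
  have conv: "convergent (\<lambda>n. (1 / 2) * (blinfun_apply f (x (i n)) - blinfun_apply f (x (j n))))"
    for f :: "'a \<Rightarrow>\<^sub>L real"
    using lim unfolding limitin_weak_topology_iff convergent_def
    by (auto simp: blinfun.scaleR_right blinfun.diff_right)
  show False
  proof (cases "\<exists>p. infinite {n. i n = p}")
    case True
    then obtain p where p: "infinite {n. i n = p}" by blast
    have step: "\<exists>m. i m = p \<and> n < m \<and> N < j m" for n N
    proof -
      have "infinite ({m. i m = p} - ({m. j m \<le> N} \<union> {..n}))"
        using p j by (intro Diff_infinite_finite) auto
      from infinite_imp_nonempty[OF this] show ?thesis by (auto simp: not_le)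
    qed
    have "\<exists>\<rho>. \<forall>k. i (\<rho> k) = p \<and> (\<rho> k < \<rho> (Suc k) \<and> j (\<rho> k) < j (\<rho> (Suc k)))"
      by (rule dependent_nat_choice[where P = "\<lambda>_ n. i n = p" and Q = "\<lambda>_ n m. n < m \<and> j n < j m"])
        (use step in blast)+
    then obtain \<rho> where \<rho>: "\<And>k. i (\<rho> k) = p" "\<And>k. \<rho> k < \<rho> (Suc k)" "\<And>k. j (\<rho> k) < j (\<rho> (Suc k))"
      by metis
    have mono: "strict_mono \<rho>" "strict_mono (\<lambda>k. j (\<rho> k))" using \<rho>(2,3) by (simp_all add: strict_mono_Suc_iff)
    let ?P = "(\<lambda>k. j (\<rho> k)) ` {k. even k}"
    obtain f :: "'a \<Rightarrow>\<^sub>L real" where f: "\<And>n. n \<in> ?P \<Longrightarrow> blinfun_apply f (x n) \<le> r"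
        "\<And>n. n \<notin> ?P \<Longrightarrow> q \<le> blinfun_apply f (x n)"
      by (rule boolean_independent_pattern[OF x, of ?P]) blast
    have P_iff: "j (\<rho> k) \<in> ?P \<longleftrightarrow> even k" for k
      using strict_mono_eq[OF mono(2)] by auto
    show False
    proof (rule no_alternation_along_convergent[OF conv[of f] mono(1)])
      show "(1 / 2) * (blinfun_apply f (x p) - q) < (1 / 2) * (blinfun_apply f (x p) - r)"
        using \<open>r < q\<close> by simp
    qed (use f P_iff \<rho>(1) in auto)
  next
    case False
    have step: "\<exists>m>n. N < i m" for n N
    proof -
      have "finite ((\<Union>p\<le>N. {m. i m = p}) \<union> {..n})" using False by auto
      then obtain m where "m \<notin> (\<Union>p\<le>N. {m. i m = p}) \<union> {..n}" using ex_new_if_finite by blast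
      then show ?thesis by (auto simp: not_le)
    qed
    have "\<exists>\<rho>. \<forall>k. True \<and> (\<rho> k < \<rho> (Suc k) \<and> j (\<rho> k) < i (\<rho> (Suc k)))"
      by (rule dependent_nat_choice[where P = "\<lambda>_ _. True" and Q = "\<lambda>_ n m. n < m \<and> j n < i m"])
        (use step in blast)+
    then obtain \<rho> where \<rho>: "\<And>k. \<rho> k < \<rho> (Suc k)" "\<And>k. j (\<rho> k) < i (\<rho> (Suc k))" by metis
    have mono: "strict_mono \<rho>" using \<rho>(1) by (simp add: strict_mono_Suc_iff)
    \<comment> \<open>The indices \<open>i (\<rho> 0) < j (\<rho> 0) < i (\<rho> 1) < j (\<rho> 1) < \<dots>\<close> in one sequence.  For even \<open>k\<close> the
      functional below is low at \<open>j (\<rho> k) = t (2 * k + 1)\<close>, for odd \<open>k\<close> at \<open>i (\<rho> k) = t (2 * k)\<close>;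
      these are the positions congruent to 1 and 2 modulo 4.\<close>
    define t where "t m = (if even m then i (\<rho> (m div 2)) else j (\<rho> (m div 2)))" for m
    have "t m < t (Suc m)" for m
      unfolding t_def using ij \<rho>(2) by (cases "even m") auto
    then have t: "strict_mono t" by (simp add: strict_mono_Suc_iff)
    let ?P = "t ` {m. m mod 4 \<in> {1, 2}}"
    obtain f :: "'a \<Rightarrow>\<^sub>L real" where f: "\<And>n. n \<in> ?P \<Longrightarrow> blinfun_apply f (x n) \<le> r"
        "\<And>n. n \<notin> ?P \<Longrightarrow> q \<le> blinfun_apply f (x n)"
      by (rule boolean_independent_pattern[OF x, of ?P]) blast
    have P_iff: "t m \<in> ?P \<longleftrightarrow> m mod 4 \<in> {1, 2}" for m
      using strict_mono_eq[OF t] by auto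
    have i_eq: "i (\<rho> k) = t (2 * k)" and j_eq: "j (\<rho> k) = t (2 * k + 1)" for k by (simp_all add: t_def)
    show False
    proof (rule no_alternation_along_convergent[OF conv[of f] mono])
      show "(1 / 2) * (r - q) < (1 / 2) * (q - r)" using \<open>r < q\<close> by simp
    next
      fix k :: nat assume "even k"
      then have P: "i (\<rho> k) \<notin> ?P" "j (\<rho> k) \<in> ?P"
        unfolding i_eq j_eq P_iff unfolding insert_iff empty_iff by presburger+
      then show "(1 / 2) * (q - r) \<le> (1 / 2) * (blinfun_apply f (x (i (\<rho> k))) - blinfun_apply f (x (j (\<rho> k))))"
        using f(2)[OF P(1)] f(1)[OF P(2)] by simp
    next
      fix k :: nat assume "odd k"
      then have P: "i (\<rho> k) \<in> ?P" "j (\<rho> k) \<notin> ?P"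
        unfolding i_eq j_eq P_iff unfolding insert_iff empty_iff by presburger+
      then show "(1 / 2) * (blinfun_apply f (x (i (\<rho> k))) - blinfun_apply f (x (j (\<rho> k)))) \<le> (1 / 2) * (r - q)"
        using f(1)[OF P(1)] f(2)[OF P(2)] by simp
    qed
  qed
qed

text \<open>The halved differences of an independent sequence accumulate weakly at the origin without
  containing it, so they are not closed.  In a k-space some compact set would witness this, and it would
  contain a weakly convergent sequence of such differences whose limit is not one of them; such a
  sequence involves infinitely many indices.\<close>

lemma not_boolean_independent_if_k_space:
  fixes x :: "nat \<Rightarrow> 'a::real_normed_vector"
  assumes k: "k_space (weak_unit_ball :: 'a topology)"
    and ball: "range x \<subseteq> cball 0 1" and "r < q"
  shows "\<not> boolean_independent r q x"
proof
  assume x: "boolean_independent r q x"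
  define A where "A = {(1 / 2) *\<^sub>R (x i - x j) | i j. i < j}"
  have A_ball: "A \<subseteq> cball 0 1"
  proof
    fix y assume "y \<in> A"
    then obtain i j where y: "y = (1 / 2) *\<^sub>R (x i - x j)" by (auto simp: A_def)
    have "x k \<in> cball 0 1" for k using ball by blast
    then have "norm (x i) \<le> 1" "norm (x j) \<le> 1" by simp_all
    then have "norm (x i - x j) \<le> 2" using norm_triangle_ineq4[of "x i" "x j"] by simp
    then show "y \<in> cball 0 1" by (simp add: y)
  qed
  have A_countable: "countable A"
  proof -
    have "A \<subseteq> (\<lambda>(i, j). (1 / 2) *\<^sub>R (x i - x j)) ` UNIV" by (auto simp: A_def)
    then show ?thesis by (rule countable_subset) simp
  qed
  have "0 \<notin> A"
  proof
    assume "0 \<in> A"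
    then obtain i j where ij: "i < j" "x i = x j" by (auto simp: A_def)
    obtain f :: "'a \<Rightarrow>\<^sub>L real" where f: "\<And>n. n \<in> {i} \<Longrightarrow> blinfun_apply f (x n) \<le> r"
        "\<And>n. n \<notin> {i} \<Longrightarrow> q \<le> blinfun_apply f (x n)"
      by (rule boolean_independent_pattern[OF x, of "{i}"]) blast
    have "blinfun_apply f (x i) \<le> r" "q \<le> blinfun_apply f (x j)"
      using f ij(1) by auto
    then show False using ij(2) \<open>r < q\<close> by simp
  qed
  moreover have "bounded (range x)" using ball bounded_cball bounded_subset by blast
  then have "0 \<in> weak_topology closure_of A"
    unfolding A_def by (rule zero_in_weak_closure_differences)
  then have "0 \<in> weak_unit_ball closure_of A" by (simp add: weak_unit_ball_closure[OF A_ball])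
  ultimately have "\<not> closedin weak_unit_ball A" by (metis closure_of_closedin)
  then obtain K where K: "compactin weak_unit_ball K" "\<not> closedin (subtopology weak_unit_ball K) (K \<inter> A)"
    using k A_ball unfolding k_space_def by auto
  have K_sub: "K \<subseteq> cball 0 1" using compactin_subset_topspace[OF K(1)] by simp
  have "\<not> subtopology weak_unit_ball K closure_of (K \<inter> A) \<subseteq> K \<inter> A"
    using K(2) K_sub unfolding closure_of_subset_eq[symmetric] by auto
  then obtain z where z: "z \<in> K" "z \<notin> A" "z \<in> weak_unit_ball closure_of (K \<inter> A)"
    by (auto simp: closure_of_subtopology)
  then have "z \<in> weak_topology closure_of (K \<inter> A)"
    using weak_unit_ball_closure[of "K \<inter> A"] A_ball by auto
  moreover have "compactin weak_topology K"
    using K(1) by (simp add: weak_unit_ball_def compactin_subtopology)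
  ultimately obtain s where s: "range s \<subseteq> K \<inter> A" "limitin weak_topology s z sequentially"
    using weakly_convergent_sequence_in_compact[of K "K \<inter> A" z] A_countable
    by (metis Int_lower1 Int_lower2 countable_subset)
  have "\<exists>i j. i < j \<and> s n = (1 / 2) *\<^sub>R (x i - x j)" for n
  proof -
    have "s n \<in> A" using s(1) by blast
    then show ?thesis by (auto simp: A_def)
  qed
  then obtain i j where ij: "\<And>n. i n < j n" "\<And>n. s n = (1 / 2) *\<^sub>R (x (i n) - x (j n))" by metis
  have "finite {n. j n \<le> N}" for N
  proof (rule ccontr)
    assume inf: "infinite {n. j n \<le> N}"
    have "s ` {n. j n \<le> N} \<subseteq> (\<lambda>(i, j). (1 / 2) *\<^sub>R (x i - x j)) ` ({..N} \<times> {..N})"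
    proof (rule image_subsetI)
      fix n assume "n \<in> {n. j n \<le> N}"
      then have "(i n, j n) \<in> {..N} \<times> {..N}" using ij(1)[of n] by simp
      then show "s n \<in> (\<lambda>(i, j). (1 / 2) *\<^sub>R (x i - x j)) ` ({..N} \<times> {..N})"
        by (intro image_eqI[of _ _ "(i n, j n)"]) (simp_all add: ij(2))
    qed
    then have "finite (s ` {n. j n \<le> N})" by (rule finite_subset) simp
    then obtain m where "infinite {n \<in> {n. j n \<le> N}. s n = s m}"
      using pigeonhole_infinite[OF inf] by blast
    then have "infinite {n. s n = s m}" by (rule contrapos_nn) (auto intro: finite_subset)
    then have "s m = z" using weak_limit_eq_frequent_value[OF s(2)] by blast
    then show False using s(1) z(2) by blast
  qed
  moreover have "limitin weak_topology (\<lambda>n. (1 / 2) *\<^sub>R (x (i n) - x (j n))) z sequentially"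
    using s(2) unfolding ij(2)[symmetric] .
  ultimately show False
    using differences_not_weakly_convergent[OF x \<open>r < q\<close>, of i j z] ij(1) by blast
qed

lemma weakly_Cauchy_subsequences:
  fixes x :: "nat \<Rightarrow> 'a::real_normed_vector"
  assumes "\<And>r q (y :: nat \<Rightarrow> 'a). r < q \<Longrightarrow> range y \<subseteq> cball 0 1 \<Longrightarrow> \<not> boolean_independent r q y"
    and x: "range x \<subseteq> cball 0 1"
  shows "\<exists>\<sigma>. strict_mono \<sigma> \<and> weakly_Cauchy (x \<circ> \<sigma>)"
proof -
  have "bounded (range x)" using x bounded_cball bounded_subset by blast
  then show ?thesis
  proof (rule Rosenthal_dichotomy)
    fix r q \<sigma> assume "r < q" "boolean_independent r q (x \<circ> \<sigma>)"
    moreover have "range (x \<circ> \<sigma>) \<subseteq> cball 0 1" using x by auto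
    ultimately show ?thesis using assms(1) by blast
  qed blast
qed

section \<open>Separable duals exclude the space of summable sequences\<close>

text \<open>The functionals \<open>c \<mapsto> (\<Sum>n. \<epsilon> n * c n)\<close> with signs \<open>\<epsilon>\<close> on a copy of the space of
  summable sequences extend to the whole space by the Hahn-Banach theorem.  There are uncountably many
  of them, and the unit vectors keep them uniformly apart.\<close>

lemma no_ell1_embedding_if_separable_dual:
  fixes T :: "(nat \<Rightarrow> real) \<Rightarrow> 'a::real_normed_vector"
  assumes sep: "separable_space (euclidean :: ('a \<Rightarrow>\<^sub>L real) topology)"
  shows "\<not> ell1_isomorphic_embedding T"
proof
  assume "ell1_isomorphic_embedding T"
  then obtain a b where T_add: "\<And>x y. x \<in> ell1 \<Longrightarrow> y \<in> ell1 \<Longrightarrow> T (\<lambda>n. x n + y n) = T x + T y"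
    and T_scale: "\<And>c x. x \<in> ell1 \<Longrightarrow> T (\<lambda>n. c * x n) = c *\<^sub>R T x"
    and a: "0 < a" "\<And>x. x \<in> ell1 \<Longrightarrow> a * ell1_norm x \<le> norm (T x)"
    and b: "\<And>x. x \<in> ell1 \<Longrightarrow> norm (T x) \<le> b * ell1_norm x"
    unfolding ell1_isomorphic_embedding_def by metis
  have ell1_add: "(\<lambda>n. x n + y n) \<in> ell1" if "x \<in> ell1" "y \<in> ell1" for x y :: "nat \<Rightarrow> real"
    using summable_add[of "\<lambda>n. \<bar>x n\<bar>" "\<lambda>n. \<bar>y n\<bar>"] that
    by (auto simp: ell1_def intro!: summable_comparison_test'[of "\<lambda>n. \<bar>x n\<bar> + \<bar>y n\<bar>"])
  have ell1_scale: "(\<lambda>n. c * x n) \<in> ell1" if "x \<in> ell1" for x and c :: real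
    using that summable_mult[of "\<lambda>n. \<bar>x n\<bar>" "\<bar>c\<bar>"] by (simp add: ell1_def abs_mult)
  have inj: "inj_on T ell1"
  proof (rule inj_onI)
    fix x y assume xy: "x \<in> ell1" "y \<in> ell1" "T x = T y"
    let ?d = "\<lambda>n. x n + (- 1) * y n"
    have d: "?d \<in> ell1" using ell1_add[OF xy(1) ell1_scale[OF xy(2)]] .
    have "T ?d = 0" using T_add[OF xy(1) ell1_scale[OF xy(2)], of "-1"] T_scale[OF xy(2), of "-1"] xy(3) by simp
    then have "ell1_norm ?d \<le> 0" using a(2)[OF d] a(1) by (simp add: mult_le_0_iff)
    moreover have "0 \<le> \<bar>?d n\<bar> \<and> \<bar>?d n\<bar> \<le> ell1_norm ?d" for n
      unfolding ell1_norm_def using d sum_le_suminf[of "\<lambda>n. \<bar>?d n\<bar>" "{n}"] by (simp add: ell1_def)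
    ultimately have "?d n = 0" for n by (metis abs_le_zero_iff order_trans)
    then show "x = y" by (auto simp: fun_eq_iff)
  qed
  define S where "S = T ` ell1"
  define inv where "inv = inv_into ell1 T"
  have inv: "inv (T x) = x" if "x \<in> ell1" for x using inj that by (simp add: inv_def)
  have zero: "(\<lambda>n. 0) \<in> ell1" by (simp add: ell1_def)
  have S: "subspace S"
  proof (rule subspaceI)
    have "T (\<lambda>n. 0) = 0" using T_scale[OF zero, of 0] by simp
    then show "0 \<in> S" unfolding S_def using zero by (metis imageI)
    show "y + z \<in> S" if "y \<in> S" "z \<in> S" for y z
      using that T_add[symmetric] by (auto simp: S_def intro!: ell1_add)
    show "c *\<^sub>R y \<in> S" if "y \<in> S" for c y
      using that T_scale[symmetric] by (auto simp: S_def intro!: ell1_scale)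
  qed
  define sgn where "sgn P n = (if n \<in> P then 1 else - 1 :: real)" for P :: "nat set" and n
  have abs_sgn: "\<bar>sgn P n * t\<bar> = \<bar>t\<bar>" for P n t by (simp add: sgn_def)
  have summable_sgn: "summable (\<lambda>n. sgn P n * x n)" if "x \<in> ell1" for P x
    using that by (intro summable_norm_cancel[of "\<lambda>n. sgn P n * x n"]) (simp add: abs_sgn ell1_def)
  have "\<exists>h :: 'a \<Rightarrow>\<^sub>L real. \<forall>x\<in>ell1. blinfun_apply h (T x) = (\<Sum>n. sgn P n * x n)" for P
  proof -
    have "0 \<le> 1 / a" using a(1) by simp
    obtain h :: "'a \<Rightarrow>\<^sub>L real" where "\<And>y. y \<in> S \<Longrightarrow> blinfun_apply h y = (\<Sum>n. sgn P n * inv y n)"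
    proof (rule Hahn_Banach_norm[OF S \<open>0 \<le> 1 / a\<close>, of "\<lambda>y. \<Sum>n. sgn P n * inv y n"])
      fix y z assume "y \<in> S" "z \<in> S"
      then obtain u v where uv: "u \<in> ell1" "v \<in> ell1" "y = T u" "z = T v" unfolding S_def by blast
      have "inv (y + z) = (\<lambda>n. u n + v n)" using inv[OF ell1_add[OF uv(1,2)]] T_add[OF uv(1,2)] uv(3,4) by simp
      then show "(\<Sum>n. sgn P n * inv (y + z) n) = (\<Sum>n. sgn P n * inv y n) + (\<Sum>n. sgn P n * inv z n)"
        using suminf_add[OF summable_sgn[OF uv(1)] summable_sgn[OF uv(2)]] inv uv by (simp add: distrib_left)
    next
      fix c y assume "y \<in> S"
      then obtain u where u: "u \<in> ell1" "y = T u" unfolding S_def by blast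
      have "inv (c *\<^sub>R y) = (\<lambda>n. c * u n)" using inv[OF ell1_scale[OF u(1)]] T_scale[OF u(1)] u(2) by metis
      then show "(\<Sum>n. sgn P n * inv (c *\<^sub>R y) n) = c * (\<Sum>n. sgn P n * inv y n)"
        using suminf_mult[OF summable_sgn[OF u(1)], of c P] inv u by (simp add: mult.left_commute)
    next
      fix y assume "y \<in> S"
      then obtain u where u: "u \<in> ell1" "y = T u" unfolding S_def by blast
      have "\<bar>\<Sum>n. sgn P n * u n\<bar> \<le> (\<Sum>n. \<bar>sgn P n * u n\<bar>)"
        using u(1) by (intro summable_rabs) (simp add: abs_sgn ell1_def)
      also have "\<dots> = ell1_norm u" by (simp add: abs_sgn ell1_norm_def)
      also have "\<dots> \<le> 1 / a * norm y" using a(2)[OF u(1)] a(1) u(2) by (simp add: field_simps)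
      finally show "\<bar>\<Sum>n. sgn P n * inv y n\<bar> \<le> 1 / a * norm y" using inv u by simp
    qed blast
    then show ?thesis by (intro exI[of _ h]) (auto simp: S_def inv)
  qed
  then obtain h :: "nat set \<Rightarrow> 'a \<Rightarrow>\<^sub>L real"
    where h: "\<And>P x. x \<in> ell1 \<Longrightarrow> blinfun_apply (h P) (T x) = (\<Sum>n. sgn P n * x n)" by metis
  define unit where "unit k = (\<lambda>n. if n = k then 1 else 0 :: real)" for k :: nat
  have unit: "unit k \<in> ell1" "ell1_norm (unit k) = 1" for k
  proof -
    have "(\<lambda>n. \<bar>unit k n\<bar>) sums 1"
      using sums_single[of k "\<lambda>_. 1 :: real"] by (simp add: unit_def if_distrib[of abs] cong: if_cong)
    then show "unit k \<in> ell1" "ell1_norm (unit k) = 1"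
      by (auto simp: ell1_def ell1_norm_def sums_iff)
  qed
  have h_unit: "blinfun_apply (h P) (T (unit k)) = sgn P k" for P k
  proof -
    have "(\<lambda>n. sgn P n * unit k n) sums sgn P k"
      using sums_single[of k "sgn P"] by (simp add: unit_def if_distrib cong: if_cong)
    then show ?thesis using h[OF unit(1)] by (simp add: sums_iff)
  qed
  have "0 < b" using a(2)[OF unit(1)[of 0]] b[OF unit(1)[of 0]] a(1) unit(2) by simp
  have apart: "2 / b \<le> dist (h P) (h Q)" if PQ: "P \<noteq> Q" for P Q
  proof -
    obtain k where k: "k \<in> P \<longleftrightarrow> k \<notin> Q" using PQ by blast
    have "2 = norm (blinfun_apply (h P - h Q) (T (unit k)))"
      using k by (auto simp: blinfun.diff_left h_unit sgn_def)
    also have "\<dots> \<le> norm (h P - h Q) * b"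
      using norm_blinfun[of "h P - h Q" "T (unit k)"]
        mult_left_mono[OF b[OF unit(1)[of k]] norm_ge_zero[of "h P - h Q"]] unit(2) by simp
    finally show ?thesis using \<open>0 < b\<close> by (simp add: dist_norm field_simps)
  qed
  obtain D :: "('a \<Rightarrow>\<^sub>L real) set" where D: "countable D" "closure D = UNIV"
    using sep by (auto simp: separable_space_def)
  have "\<exists>d\<in>D. dist d (h P) < 1 / b" for P
    using D(2) \<open>0 < b\<close> closure_approachable[of "h P" D] by simp
  then obtain d where d: "\<And>P. d P \<in> D" "\<And>P. dist (d P) (h P) < 1 / b" by metis
  have "inj d"
  proof (rule injI, rule ccontr)
    fix P Q assume "d P = d Q" "P \<noteq> Q"
    then have "dist (h P) (h Q) < 1 / b + 1 / b"
      using d(2)[of P] d(2)[of Q] dist_triangle3[of "h P" "h Q" "d P"] by simp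
    then show False using apart[OF \<open>P \<noteq> Q\<close>] by simp
  qed
  then have "countable (UNIV :: nat set set)"
    using D(1) d(1) by (metis countable_image_inj_on countable_subset image_subsetI)
  then have "range (from_nat_into (UNIV :: nat set set)) = UNIV" by (intro range_from_nat_into) auto
  then show False using Cantors_theorem[of "UNIV :: nat set"] by auto
qed

section \<open>Balls and compact sets in the weak topology\<close>

lemma continuous_map_weak_topology:
  fixes f :: "'a::real_normed_vector \<Rightarrow>\<^sub>L real"
  shows "continuous_map weak_topology euclideanreal (blinfun_apply f)"
  using openin_weak_topology_vimage[of _ f] by (simp add: continuous_map_def vimage_def)

lemma regular_space_weak_topology: "regular_space (weak_topology :: 'a::real_normed_vector topology)"
  unfolding regular_space_def
proof (intro allI impI; elim conjE)
  fix C and x :: 'a assume C: "closedin weak_topology C" and x: "x \<in> topspace weak_topology - C"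
  have "openin weak_topology (UNIV - C)" using C by (simp add: closedin_def)
  then obtain F e where F: "finite F" "0 < e" "weak_nbhd F e x \<subseteq> UNIV - C"
    using x unfolding openin_weak_topology_iff by blast
  define V where "V = (\<Union>f\<in>F. blinfun_apply f -` {t. e / 2 < \<bar>t - f x\<bar>})"
  have "open {t. e / 2 < \<bar>t - c\<bar>}" for c :: real
    by (intro open_Collect_less continuous_intros)
  then have "openin weak_topology (blinfun_apply f -` {t. e / 2 < \<bar>t - f x\<bar>})" for f :: "'a \<Rightarrow>\<^sub>L real"
    by (rule openin_weak_topology_vimage)
  then have "openin weak_topology V"
    unfolding V_def by blast
  moreover have "C \<subseteq> V"
  proof
    fix y assume "y \<in> C"
    then obtain f where "f \<in> F" "\<not> \<bar>blinfun_apply f (y - x)\<bar> < e" using F(3) by (auto simp: weak_nbhd_def)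
    then show "y \<in> V" using F(2) by (auto simp: V_def blinfun.diff_right intro!: bexI[of _ f])
  qed
  moreover have "disjnt (weak_nbhd F (e / 2) x) V"
    by (force simp: disjnt_iff V_def weak_nbhd_def blinfun.diff_right)
  moreover have "openin weak_topology (weak_nbhd F (e / 2) x)" "x \<in> weak_nbhd F (e / 2) x"
    using F by (auto intro: openin_weak_nbhd weak_nbhd_self)
  ultimately show "\<exists>U V. openin weak_topology U \<and> openin weak_topology V \<and> x \<in> U \<and> C \<subseteq> V \<and> disjnt U V"
    by blast
qed

lemma t1_space_weak_topology: "t1_space (weak_topology :: 'a::real_normed_vector topology)"
  unfolding t1_space_def
proof (intro ballI impI)
  fix x y :: 'a assume "x \<noteq> y"
  obtain h :: "'a \<Rightarrow>\<^sub>L real" where h: "blinfun_apply h (y - x) = norm (y - x)" using norming_functional by blast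
  show "\<exists>U. openin weak_topology U \<and> x \<in> U \<and> y \<notin> U"
    using \<open>x \<noteq> y\<close> h by (intro exI[of _ "weak_nbhd {h} (norm (y - x)) x"])
      (auto intro!: openin_weak_nbhd weak_nbhd_self, simp add: weak_nbhd_def)
qed

text \<open>A norm-dense sequence of functionals embeds every ball into the countable power of the line,
  since on a bounded set each functional is uniformly approximated.\<close>

lemma weak_cball_eq_pullback:
  fixes g :: "nat \<Rightarrow> 'a::real_normed_vector \<Rightarrow>\<^sub>L real" and c :: real
  assumes dense: "closure (range g) = UNIV"
  defines "\<phi> \<equiv> \<lambda>x i. blinfun_apply (g i) x"
  shows "subtopology weak_topology (cball 0 c) = pullback_topology (cball 0 c) \<phi> euclidean"
    and "inj \<phi>"
proof -
  have approx: "\<exists>i. norm (g i - f) < e" if "0 < e" for f e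
    using dense that closure_approachable[of f "range g"] by (auto simp: dist_norm)
  show "inj \<phi>"
  proof (rule injI, rule ccontr)
    fix x y :: 'a assume eq: "\<phi> x = \<phi> y" and "x \<noteq> y"
    obtain h :: "'a \<Rightarrow>\<^sub>L real" where h: "blinfun_apply h (x - y) = norm (x - y)" using norming_functional by blast
    obtain i where "norm (g i - h) < 1" using approx[of 1 h] by auto
    then have "norm (g i - h) * norm (x - y) < norm (x - y)" using \<open>x \<noteq> y\<close> by simp
    moreover have "blinfun_apply (g i) (x - y) = 0"
      using fun_cong[OF eq, of i] by (simp add: \<phi>_def blinfun.diff_right)
    then have "\<bar>blinfun_apply (g i - h) (x - y)\<bar> = norm (x - y)"
      using h by (simp add: blinfun.diff_left)
    ultimately show False using norm_blinfun[of "g i - h" "x - y"] by simp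
  qed
  show "subtopology weak_topology (cball 0 c) = pullback_topology (cball 0 c) \<phi> euclidean"
    unfolding topology_eq
  proof (intro allI iffI)
    fix U assume "openin (pullback_topology (cball 0 c) \<phi> euclidean) U"
    then obtain V where V: "open V" "U = \<phi> -` V \<inter> cball 0 c" by (auto simp: openin_pullback_topology)
    have "continuous_map weak_topology (product_topology (\<lambda>_. euclideanreal) UNIV) \<phi>"
      unfolding continuous_map_componentwise_UNIV \<phi>_def by (simp add: continuous_map_weak_topology)
    then have "continuous_map weak_topology euclidean \<phi>" by (simp add: euclidean_product_topology)
    then have "openin weak_topology (\<phi> -` V)"
      using V(1) by (simp add: continuous_map_def vimage_def)
    then show "openin (subtopology weak_topology (cball 0 c)) U"
      using V(2) by (auto simp: openin_subtopology)
  next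
    fix U :: "'a set" assume "openin (subtopology weak_topology (cball 0 c)) U"
    then obtain W where W: "openin weak_topology W" "U = W \<inter> cball 0 c" by (auto simp: openin_subtopology)
    have "\<exists>V. open V \<and> \<phi> x \<in> V \<and> \<phi> -` V \<inter> cball 0 c \<subseteq> U" if x: "x \<in> U" for x
    proof -
      have "0 \<le> c" using x W(2) by (auto intro: order_trans[OF norm_ge_zero])
      obtain F e where F: "finite F" "0 < e" "weak_nbhd F e x \<subseteq> W"
        using W x unfolding openin_weak_topology_iff by blast
      define \<delta> where "\<delta> = e / (4 * (c + 1))"
      have "0 < \<delta>" using F(2) \<open>0 \<le> c\<close> by (simp add: \<delta>_def)
      then obtain k where k: "\<And>f. norm (g (k f) - f) < \<delta>" using approx by metis
      define V where "V = (\<Inter>f\<in>F. {v :: nat \<Rightarrow> real. \<bar>v (k f) - \<phi> x (k f)\<bar> < e / 2})"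
      have "open V"
        unfolding V_def using F(1)
        by (intro open_INT ballI open_Collect_less continuous_on_rabs continuous_on_diff
            continuous_on_const continuous_on_product_coordinates)
      moreover have "\<phi> x \<in> V" using F(2) by (simp add: V_def)
      moreover have "\<phi> -` V \<inter> cball 0 c \<subseteq> U"
      proof
        fix y assume y: "y \<in> \<phi> -` V \<inter> cball 0 c"
        have "\<bar>blinfun_apply f (y - x)\<bar> < e" if f: "f \<in> F" for f
        proof -
          have "norm (y - x) \<le> 2 * c"
            using norm_triangle_ineq4[of y x] x y W(2) by auto
          then have "\<bar>blinfun_apply (g (k f) - f) (y - x)\<bar> \<le> \<delta> * (2 * c)"
            using norm_blinfun[of "g (k f) - f" "y - x"] k[of f] \<open>0 < \<delta>\<close>
              mult_mono[of "norm (g (k f) - f)" \<delta> "norm (y - x)" "2 * c"] by simp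
          also have "\<dots> \<le> e / 2" using F(2) \<open>0 \<le> c\<close> by (simp add: \<delta>_def field_simps)
          finally have "\<bar>blinfun_apply (g (k f)) (y - x) - blinfun_apply f (y - x)\<bar> \<le> e / 2"
            by (simp add: blinfun.diff_left)
          moreover have "\<bar>blinfun_apply (g (k f)) (y - x)\<bar> < e / 2"
            using y f by (simp add: V_def \<phi>_def blinfun.diff_right)
          ultimately show ?thesis by linarith
        qed
        then show "y \<in> U" using F(3) y W(2) by (auto simp: weak_nbhd_def)
      qed
      ultimately show ?thesis by blast
    qed
    then obtain V where V: "\<And>x. x \<in> U \<Longrightarrow> open (V x)" "\<And>x. x \<in> U \<Longrightarrow> \<phi> x \<in> V x"
        "\<And>x. x \<in> U \<Longrightarrow> \<phi> -` V x \<inter> cball 0 c \<subseteq> U" by metis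
    have "U = \<phi> -` (\<Union>x\<in>U. V x) \<inter> cball 0 c"
      using V(2,3) W(2) by blast
    moreover have "open (\<Union>x\<in>U. V x)" using V(1) by blast
    ultimately show "openin (pullback_topology (cball 0 c) \<phi> euclidean) U"
      unfolding openin_pullback_topology open_openin[symmetric] by blast
  qed
qed

lemma homeomorphic_pullback_topology:
  fixes f :: "'a \<Rightarrow> 'b::topological_space"
  assumes "inj_on f S"
  shows "pullback_topology S f euclidean homeomorphic_space top_of_set (f ` S)"
proof (rule homeomorphic_map_imp_homeomorphic_space)
  have top: "topspace (pullback_topology S f euclidean) = S" by (simp add: topspace_pullback_topology)
  have "openin (pullback_topology S f euclidean) {x \<in> S. f x \<in> U} \<longleftrightarrow> openin (top_of_set (f ` S)) U"
    if U: "U \<subseteq> f ` S" for U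
  proof -
    have "{x \<in> S. f x \<in> U} = f -` V \<inter> S \<longleftrightarrow> U = f ` S \<inter> V" for V using U by auto
    then show ?thesis by (simp add: openin_pullback_topology openin_open)
  qed
  then show "homeomorphic_map (pullback_topology S f euclidean) (top_of_set (f ` S)) f"
    using assms by (simp add: homeomorphic_map_def quotient_map_def top)
qed

lemma second_countable_pullback_topology:
  fixes f :: "'a \<Rightarrow> 'b::second_countable_topology"
  shows "second_countable (pullback_topology S f euclidean)"
proof -
  obtain B :: "'b set set" where B: "countable B" "topological_basis B" using ex_countable_basis by blast
  show ?thesis
    unfolding second_countable_def
  proof (intro exI[of _ "(\<lambda>b. f -` b \<inter> S) ` B"] conjI allI impI ballI)
    show "countable ((\<lambda>b. f -` b \<inter> S) ` B)" using B(1) by simp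
    show "openin (pullback_topology S f euclidean) V" if "V \<in> (\<lambda>b. f -` b \<inter> S) ` B" for V
      using that topological_basis_open[OF B(2)] by (auto simp: openin_pullback_topology)
    fix U x assume "openin (pullback_topology S f euclidean) U \<and> x \<in> U"
    then obtain T where T: "open T" "U = f -` T \<inter> S" "x \<in> U" by (auto simp: openin_pullback_topology)
    then obtain b where "b \<in> B" "f x \<in> b" "b \<subseteq> T" using topological_basisE[OF B(2), of T "f x"] by auto
    then show "\<exists>V\<in>(\<lambda>b. f -` b \<inter> S) ` B. x \<in> V \<and> V \<subseteq> U"
      using T by (intro bexI[of _ "f -` b \<inter> S"]) auto
  qed
qed

lemma weak_cball_if_separable_dual:
  fixes c :: real
  assumes "separable_space (euclidean :: ('a::real_normed_vector \<Rightarrow>\<^sub>L real) topology)"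
  shows "second_countable (subtopology weak_topology (cball 0 c :: 'a set))"
    and "metrizable_space (subtopology weak_topology (cball 0 c :: 'a set))"
proof -
  obtain D :: "('a \<Rightarrow>\<^sub>L real) set" where D: "countable D" "closure D = UNIV"
    using assms by (auto simp: separable_space_def)
  have "D \<noteq> {}" using D(2) by auto
  define g where "g = from_nat_into D"
  have "closure (range g) = UNIV" using range_from_nat_into[OF \<open>D \<noteq> {}\<close> D(1)] D(2) by (simp add: g_def)
  note pb = weak_cball_eq_pullback[OF this]
  show "second_countable (subtopology weak_topology (cball 0 c :: 'a set))"
    unfolding pb(1) by (rule second_countable_pullback_topology)
  have "subtopology weak_topology (cball 0 c :: 'a set) homeomorphic_space
      top_of_set ((\<lambda>x i. blinfun_apply (g i) x) ` cball 0 c)"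
    unfolding pb(1) using pb(2) by (intro homeomorphic_pullback_topology) (rule inj_on_subset, auto)
  moreover have "metrizable_space (top_of_set ((\<lambda>x i. blinfun_apply (g i) x) ` cball (0 :: 'a) c))"
    by (intro metrizable_space_subtopology metrizable_space_euclidean)
  ultimately show "metrizable_space (subtopology weak_topology (cball 0 c :: 'a set))"
    using homeomorphic_metrizable_space by blast
qed

text \<open>The functionals bounded by \<open>n\<close> on \<open>K\<close> form closed sets that cover the dual.  By Baire's
  theorem one of them contains a ball, so \<open>K\<close> is bounded uniformly on the unit ball of the dual.\<close>

lemma bounded_if_weakly_compact:
  fixes K :: "'a::real_normed_vector set"
  assumes "compactin weak_topology K"
  obtains n :: nat where "K \<subseteq> cball 0 (real n)"
proof -
  define C where "C n = {f :: 'a \<Rightarrow>\<^sub>L real. \<forall>x\<in>K. \<bar>blinfun_apply f x\<bar> \<le> real n}" for n :: nat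
  have "continuous_on UNIV (\<lambda>f :: 'a \<Rightarrow>\<^sub>L real. blinfun_apply f x)" for x
    by (intro linear_continuous_on blinfun.bounded_linear_left)
  then have "closed {f :: 'a \<Rightarrow>\<^sub>L real. \<bar>blinfun_apply f x\<bar> \<le> real n}" for n x
    by (intro closed_Collect_le continuous_on_rabs continuous_on_const)
  moreover have "C n = (\<Inter>x\<in>K. {f. \<bar>blinfun_apply f x\<bar> \<le> real n})" for n by (auto simp: C_def)
  ultimately have closed: "closed (C n)" for n by auto
  have cover: "(\<Union>n. C n) = UNIV"
  proof -
    have "\<exists>n. f \<in> C n" for f
    proof -
      have "compact (blinfun_apply f ` K)"
        using image_compactin[OF assms continuous_map_weak_topology[of f]] by simp
      then obtain b where b: "\<And>x. x \<in> K \<Longrightarrow> \<bar>blinfun_apply f x\<bar> \<le> b"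
        using compact_imp_bounded bounded_iff by (metis imageI real_norm_def)
      obtain n where "b \<le> real n" using real_arch_simple by blast
      then have "f \<in> C n" unfolding C_def using b by (blast intro: order_trans)
      then show ?thesis by blast
    qed
    then show ?thesis by blast
  qed
  have "\<exists>n. interior (C n) \<noteq> {}"
  proof (rule ccontr)
    assume "\<not> ?thesis"
    then have "euclidean interior_of \<Union> (range C) = {}"
      using closed by (intro Baire_category_alt disjI1 completely_metrizable_space_euclidean)
        auto
    then show False using cover by simp
  qed
  then obtain n f0 where "f0 \<in> interior (C n)" by blast
  then obtain d where d: "0 < d" "ball f0 d \<subseteq> C n"
    using mem_interior by blast
  have "norm x \<le> 4 * real n / d" if x: "x \<in> K" for x
  proof -
    obtain h :: "'a \<Rightarrow>\<^sub>L real" where h: "norm h \<le> 1" "blinfun_apply h x = norm x" using norming_functional by blast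
    have "norm ((d / 2) *\<^sub>R h) \<le> d / 2" using mult_left_mono[OF h(1), of "d / 2"] d(1) by simp
    then have "f0 + (d / 2) *\<^sub>R h \<in> ball f0 d" using d(1) by (simp add: dist_norm)
    then have "f0 + (d / 2) *\<^sub>R h \<in> C n" "f0 \<in> C n" using d by auto
    then have "\<bar>blinfun_apply f0 x + d / 2 * norm x\<bar> \<le> real n" "\<bar>blinfun_apply f0 x\<bar> \<le> real n"
      using x h(2) by (auto simp: C_def blinfun.add_left blinfun.scaleR_left)
    then have "d / 2 * norm x \<le> 2 * real n" by linarith
    then show ?thesis using d(1) by (simp add: field_simps)
  qed
  moreover obtain m where "4 * real n / d \<le> real m" using real_arch_simple by blast
  ultimately have "K \<subseteq> cball 0 (real m)" by force
  then show thesis by (rule that)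
qed

section \<open>Networks\<close>

lemma aleph_space_if_countable_k_network:
  assumes "regular_space X" "t1_space X" "countable \<N>" "k_network X \<N>"
  shows "aleph_space X"
proof -
  define \<L> where "\<L> n = (if \<N> = {} then {} else {from_nat_into \<N> n})" for n :: nat
  have "\<L> n \<subseteq> \<N>" for n by (auto simp: \<L>_def from_nat_into)
  then have "\<Union>(\<L> n) \<subseteq> topspace X" for n using assms(4) unfolding k_network_def by blast
  moreover have "finite (\<L> n)" for n by (simp add: \<L>_def)
  ultimately have "locally_finite_in X (\<L> n)" for n
    unfolding locally_finite_in_def by (intro conjI ballI exI[of _ "topspace X"]) simp_all
  moreover have "\<N> = (\<Union>n. \<L> n)"
    using range_from_nat_into[OF _ assms(3)] by (auto simp: \<L>_def)
  ultimately have "sigma_locally_finite_in X \<N>" unfolding sigma_locally_finite_in_def by blast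
  then show ?thesis using assms unfolding aleph_space_def by blast
qed

text \<open>The network consists of countable bases of the pieces; its members need not be open in \<open>X\<close>.\<close>

lemma countable_k_network_if_second_countable_exhaustion:
  assumes S: "\<And>n :: nat. second_countable (subtopology X (S n))"
    and K: "\<And>K. compactin X K \<Longrightarrow> \<exists>n. K \<subseteq> S n"
  obtains \<N> where "countable \<N>" "k_network X \<N>"
proof -
  have "\<exists>B. countable B \<and> (\<forall>V\<in>B. openin (subtopology X (S n)) V) \<and>
      (\<forall>U x. openin (subtopology X (S n)) U \<and> x \<in> U \<longrightarrow> (\<exists>V\<in>B. x \<in> V \<and> V \<subseteq> U))" for n
    using S[of n] by (simp add: second_countable_def)
  then obtain B where B: "\<And>n. countable (B n)" "\<And>n V. V \<in> B n \<Longrightarrow> openin (subtopology X (S n)) V"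
      "\<And>n U x. openin (subtopology X (S n)) U \<Longrightarrow> x \<in> U \<Longrightarrow> \<exists>V\<in>B n. x \<in> V \<and> V \<subseteq> U"
    by metis
  have "k_network X (\<Union>n. B n)"
    unfolding k_network_def
  proof (intro conjI ballI allI impI; (elim conjE)?)
    fix N assume "N \<in> (\<Union>n. B n)"
    then show "N \<subseteq> topspace X" using B(2) openin_subset by fastforce
  next
    fix U C assume U: "openin X U" and C: "compactin X C" "C \<subseteq> U"
    obtain n where n: "C \<subseteq> S n" using K[OF C(1)] by blast
    have "openin (subtopology X (S n)) (U \<inter> S n)" using U by (auto simp: openin_subtopology)
    then have cover: "C \<subseteq> \<Union>{V \<in> B n. V \<subseteq> U \<inter> S n}" using B(3)[of n "U \<inter> S n"] C(2) n by blast
    have "compactin (subtopology X (S n)) C" using C(1) n by (simp add: compactin_subtopology)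
    moreover have "\<forall>V\<in>{V \<in> B n. V \<subseteq> U \<inter> S n}. openin (subtopology X (S n)) V" using B(2) by blast
    ultimately obtain \<F> where "finite \<F>" "\<F> \<subseteq> {V \<in> B n. V \<subseteq> U \<inter> S n}" "C \<subseteq> \<Union>\<F>"
      using cover unfolding compactin_def by meson
    then show "\<exists>\<F>. finite \<F> \<and> \<F> \<subseteq> (\<Union>n. B n) \<and> C \<subseteq> \<Union>\<F> \<and> \<Union>\<F> \<subseteq> U"
      by (intro exI[of _ \<F>]) blast
  qed
  moreover have "countable (\<Union>n. B n)" using B(1) by (intro countable_UN) auto
  ultimately show thesis by (intro that)
qed

text \<open>A convergent sequence together with its limit is compact, so a k-network has members containing
  infinitely many terms; such a member has the limit in its closure, and each locally finite family has
  only finitely many members of this kind.\<close>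

lemma countable_cs_star_character_if_aleph_space:
  assumes "aleph_space X"
  shows "countable_cs_star_character X"
  unfolding countable_cs_star_character_def
proof
  fix x assume x: "x \<in> topspace X"
  obtain \<L> :: "nat \<Rightarrow> 'a set set" where fin: "\<And>n. locally_finite_in X (\<L> n)" and net: "k_network X (\<Union>n. \<L> n)"
    using assms unfolding aleph_space_def sigma_locally_finite_in_def by blast
  define \<D> where "\<D> n = {N \<in> \<L> n. x \<in> X closure_of N}" for n
  have "finite (\<D> n)" for n
  proof -
    obtain V where V: "openin X V" "x \<in> V" "finite {U \<in> \<L> n. U \<inter> V \<noteq> {}}"
      using fin[of n] x unfolding locally_finite_in_def by blast
    have "\<D> n \<subseteq> {U \<in> \<L> n. U \<inter> V \<noteq> {}}"
      unfolding \<D>_def using V(1,2) by (auto simp: in_closure_of)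
    then show ?thesis using V(3) finite_subset by blast
  qed
  then have "countable (\<Union>n. \<D> n)" by (simp add: countable_finite)
  moreover have "\<forall>D\<in>(\<Union>n. \<D> n). D \<subseteq> topspace X" using net unfolding k_network_def \<D>_def by blast
  moreover have "\<exists>D\<in>(\<Union>n. \<D> n). D \<subseteq> U \<and> infinite {n :: nat. s n \<in> D}"
    if s: "range s \<subseteq> topspace X" "limitin X s x sequentially" and U: "nbhd_in X x U" for s U
  proof -
    let ?I = "X interior_of U"
    have I: "openin X ?I" "x \<in> ?I" using U by (auto simp: nbhd_in_def)
    then obtain m where m: "\<And>n. m \<le> n \<Longrightarrow> s n \<in> ?I"
      using s(2) unfolding limitin_def eventually_sequentially by blast
    define K where "K = insert x (range (\<lambda>n. s (m + n)))"
    have "limitin X (\<lambda>n. s (m + n)) x sequentially"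
      using limitin_subsequence[of "\<lambda>n. m + n" X s x] s(2) by (simp add: strict_mono_def o_def)
    then have "compactin X K"
      unfolding K_def using s(1) by (intro compactin_sequence_with_limit) auto
    moreover have "K \<subseteq> ?I" using m I(2) by (auto simp: K_def)
    ultimately obtain \<F> where F: "finite \<F>" "\<F> \<subseteq> (\<Union>n. \<L> n)" "K \<subseteq> \<Union>\<F>" "\<Union>\<F> \<subseteq> ?I"
      using net I(1) unfolding k_network_def by meson
    have "\<exists>D\<in>\<F>. infinite {n. s n \<in> D}"
    proof (rule ccontr)
      assume "\<not> ?thesis"
      then have "finite (\<Union>D\<in>\<F>. {n. s n \<in> D})" using F(1) by blast
      moreover have "n \<in> (\<Union>D\<in>\<F>. {n. s n \<in> D})" if "m \<le> n" for n
      proof -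
        have "s (m + (n - m)) \<in> K" unfolding K_def by blast
        then show ?thesis using F(3) that by auto
      qed
      then have "{m..} \<subseteq> (\<Union>D\<in>\<F>. {n. s n \<in> D})" by auto
      ultimately show False using infinite_Ici finite_subset by blast
    qed
    then obtain D where D: "D \<in> \<F>" "infinite {n. s n \<in> D}" by blast
    have "x \<in> X closure_of D"
      unfolding in_closure_of
    proof (intro conjI x allI impI)
      fix T assume "x \<in> T \<and> openin X T"
      then obtain k where k: "\<And>n. k \<le> n \<Longrightarrow> s n \<in> T"
        using s(2) unfolding limitin_def eventually_sequentially by blast
      obtain n where "k \<le> n" "s n \<in> D" using D(2) unfolding infinite_nat_iff_unbounded_le by blast
      then show "\<exists>y. y \<in> D \<and> y \<in> T" using k by blast
    qed
    moreover have "D \<subseteq> U" using D(1) F(4) interior_of_subset[of X U] by blast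
    moreover obtain j where "D \<in> \<L> j" using D(1) F(2) by blast
    ultimately show ?thesis using D(2) unfolding \<D>_def by blast
  qed
  ultimately show "\<exists>\<D>. countable \<D> \<and> (\<forall>D\<in>\<D>. D \<subseteq> topspace X) \<and>
      (\<forall>s U. range s \<subseteq> topspace X \<and> limitin X s x sequentially \<and> nbhd_in X x U \<longrightarrow>
        (\<exists>D\<in>\<D>. D \<subseteq> U \<and> infinite {n :: nat. s n \<in> D}))"
    by (intro exI[of _ "\<Union>n. \<D> n"]) blast
qed

text \<open>A countable base at \<open>x\<close> serves: in a T1 space a basic set that met \<open>A\<close> in finitely many points
  could be shrunk to a neighbourhood of \<open>x\<close> that misses \<open>A\<close>.\<close>

lemma strong_Pytkeev_space_if_first_countable:
  assumes first: "first_countable X" and t1: "t1_space X"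
  shows "strong_Pytkeev_space X"
  unfolding strong_Pytkeev_space_def
proof
  fix x assume "x \<in> topspace X"
  from bspec[OF first[unfolded first_countable_def] this]
  obtain \<B> where B: "countable \<B>" "\<forall>V\<in>\<B>. openin X V"
      "\<forall>U. openin X U \<and> x \<in> U \<longrightarrow> (\<exists>V\<in>\<B>. x \<in> V \<and> V \<subseteq> U)"
    by (elim exE conjE)
  have "\<exists>V\<in>\<B>. V \<subseteq> U \<and> infinite (V \<inter> A)"
    if U: "nbhd_in X x U" and A: "A \<subseteq> topspace X" "x \<in> X closure_of A - A" for U A
  proof -
    obtain V where V: "V \<in> \<B>" "x \<in> V" "V \<subseteq> X interior_of U"
      using U B(3)[rule_format, of "X interior_of U"] by (auto simp: nbhd_in_def)
    have "infinite (V \<inter> A)"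
    proof
      assume "finite (V \<inter> A)"
      then have "closedin X (V \<inter> A)" using t1 A(1) by (auto simp: t1_space_closedin_finite)
      then have "openin X (V - V \<inter> A)" using bspec[OF B(2) V(1)] by (intro openin_diff)
      moreover have "x \<in> V - V \<inter> A" "x \<in> X closure_of A" using A(2) V(2) by auto
      ultimately obtain y where "y \<in> A \<and> y \<in> V - V \<inter> A"
        unfolding in_closure_of by meson
      then show False by blast
    qed
    then show ?thesis using V interior_of_subset[of X U] by blast
  qed
  then show "\<exists>\<D>. countable \<D> \<and> (\<forall>D\<in>\<D>. D \<subseteq> topspace X) \<and>
      (\<forall>U A. nbhd_in X x U \<and> A \<subseteq> topspace X \<and> x \<in> X closure_of A - A \<longrightarrow>
        (\<exists>D\<in>\<D>. D \<subseteq> U \<and> infinite (D \<inter> A)))"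
    using B(1,2) openin_subset by (intro exI[of _ \<B>] conjI) blast+
qed

lemma countable_cs_star_character_subtopology:
  assumes cs: "countable_cs_star_character X"
  shows "countable_cs_star_character (subtopology X S)"
  unfolding countable_cs_star_character_def
proof
  fix x assume "x \<in> topspace (subtopology X S)"
  then have "x \<in> topspace X" by simp
  from bspec[OF cs[unfolded countable_cs_star_character_def] this]
  obtain \<D> where D: "countable \<D>" "\<forall>D\<in>\<D>. D \<subseteq> topspace X"
      "\<forall>s U. range s \<subseteq> topspace X \<and> limitin X s x sequentially \<and> nbhd_in X x U \<longrightarrow>
        (\<exists>D\<in>\<D>. D \<subseteq> U \<and> infinite {n :: nat. s n \<in> D})"
    by (elim exE conjE)
  have "\<exists>D\<in>(\<lambda>D. D \<inter> S) ` \<D>. D \<subseteq> U \<and> infinite {n. s n \<in> D}"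
    if s: "range s \<subseteq> topspace (subtopology X S)" "limitin (subtopology X S) s x sequentially"
      and U: "nbhd_in (subtopology X S) x U" for s U
  proof -
    obtain T where T: "openin X T" "x \<in> T" "T \<inter> S \<subseteq> U"
      using U by (auto simp: nbhd_in_def interior_of_def openin_subtopology)
    have "nbhd_in X x T" using T openin_subset by (auto simp: nbhd_in_def interior_of_openin)
    moreover have "range s \<subseteq> topspace X" "limitin X s x sequentially"
      using s by (auto simp: limitin_subtopology)
    ultimately obtain D where "D \<in> \<D>" "D \<subseteq> T" "infinite {n. s n \<in> D}"
      using D(3)[rule_format, of s T] by blast
    moreover have "s n \<in> S" for n using s(1) by auto
    ultimately show ?thesis using T(3) by (intro bexI[of _ "D \<inter> S"]) auto
  qed
  then show "\<exists>\<D>. countable \<D> \<and> (\<forall>D\<in>\<D>. D \<subseteq> topspace (subtopology X S)) \<and>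
      (\<forall>s U. range s \<subseteq> topspace (subtopology X S) \<and> limitin (subtopology X S) s x sequentially \<and>
        nbhd_in (subtopology X S) x U \<longrightarrow> (\<exists>D\<in>\<D>. D \<subseteq> U \<and> infinite {n :: nat. s n \<in> D}))"
    using D(1,2) by (intro exI[of _ "(\<lambda>D. D \<inter> S) ` \<D>"]) auto
qed

section \<open>Conditions equivalent to a separable dual\<close>

lemma separable_dual_if_strong_Pytkeev_ball:
  assumes "strong_Pytkeev_space (weak_unit_ball :: 'a::real_normed_vector topology)"
  shows "separable_space (euclidean :: ('a \<Rightarrow>\<^sub>L real) topology)"
proof -
  have "(0 :: 'a) \<in> topspace weak_unit_ball" by simp
  from bspec[OF assms[unfolded strong_Pytkeev_space_def] this]
  obtain \<D> :: "'a set set" where "countable \<D>"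
      "\<forall>U A. nbhd_in weak_unit_ball 0 U \<and> A \<subseteq> topspace weak_unit_ball \<and> 0 \<in> weak_unit_ball closure_of A - A \<longrightarrow>
        (\<exists>D\<in>\<D>. D \<subseteq> U \<and> infinite (D \<inter> A))"
    by (elim exE conjE)
  then have "strong_Pytkeev_at_0 \<D>"
    unfolding strong_Pytkeev_at_0_def by (simp add: weak_unit_ball_closure)
  then show ?thesis by (rule separable_dual_if_strong_Pytkeev_at_0)
qed

lemma separable_dual_if_cs_star_ball:
  assumes cs: "countable_cs_star_character (weak_unit_ball :: 'a::real_normed_vector topology)"
    and indep: "\<And>r q (y :: nat \<Rightarrow> 'a). r < q \<Longrightarrow> range y \<subseteq> cball 0 1 \<Longrightarrow> \<not> boolean_independent r q y"
  shows "separable_space (euclidean :: ('a \<Rightarrow>\<^sub>L real) topology)"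
proof -
  have "(0 :: 'a) \<in> topspace weak_unit_ball" by simp
  from bspec[OF cs[unfolded countable_cs_star_character_def] this]
  obtain \<D> :: "'a set set" where D: "countable \<D>"
      "\<forall>s U. range s \<subseteq> topspace weak_unit_ball \<and> limitin weak_unit_ball s 0 sequentially \<and>
        nbhd_in weak_unit_ball 0 U \<longrightarrow> (\<exists>D\<in>\<D>. D \<subseteq> U \<and> infinite {n :: nat. s n \<in> D})"
    by (elim exE conjE)
  have "limitin weak_unit_ball s 0 sequentially"
    if "range s \<subseteq> cball 0 1" "limitin weak_topology s 0 sequentially" for s :: "nat \<Rightarrow> 'a"
    using that by (auto simp: weak_unit_ball_def limitin_subtopology image_subset_iff)
  then have "cs_star_at_0 \<D>"
    unfolding cs_star_at_0_def using D by simp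
  then show ?thesis
    using weakly_Cauchy_subsequences[OF indep] by (rule separable_dual_if_cs_star_at_0)
qed

lemma all_equivalentI:
  assumes "\<And>P. P \<in> set Ps \<Longrightarrow> P \<longleftrightarrow> Q"
  shows "all_equivalent Ps"
  unfolding all_equivalent_def using assms by blast

theorem theorem1p8:
  shows "let E\<^sub>w = (weak_topology :: 'a::banach topology);
             B\<^sub>w = (weak_unit_ball :: 'a topology)
         in all_equivalent
           [separable_space B\<^sub>w \<and> metrizable_space B\<^sub>w,
            metrizable_space B\<^sub>w,
            first_countable B\<^sub>w,
            strong_Pytkeev_space B\<^sub>w,
            aleph_space B\<^sub>w \<and> k_space B\<^sub>w,
            countable_cs_star_character B\<^sub>w \<and> k_space B\<^sub>w,
            aleph_space E\<^sub>w \<and> k_space B\<^sub>w,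
            countable_cs_star_character E\<^sub>w \<and> k_space B\<^sub>w,
            countable_cs_star_character E\<^sub>w \<and>
              \<not> (\<exists>T :: (nat \<Rightarrow> real) \<Rightarrow> 'a. ell1_isomorphic_embedding T),
            separable_space (euclidean :: ('a \<Rightarrow>\<^sub>L real) topology)]"
proof -
  let ?E = "weak_topology :: 'a topology" and ?B = "weak_unit_ball :: 'a topology"
  let ?sep = "separable_space (euclidean :: ('a \<Rightarrow>\<^sub>L real) topology)"
  have t1: "t1_space ?B" and regular: "regular_space ?B"
    unfolding weak_unit_ball_def
    by (intro t1_space_subtopology t1_space_weak_topology regular_space_subtopology regular_space_weak_topology)+
  have second: "second_countable ?B" and metrizable: "metrizable_space ?B" if ?sep
    unfolding weak_unit_ball_def using weak_cball_if_separable_dual[OF that] by blast+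
  have k: "k_space ?B" if ?sep
    using metrizable[OF that] by (rule metrizable_imp_k_space)
  have aleph_B: "aleph_space ?B" if ?sep
  proof -
    have "\<exists>n :: nat. K \<subseteq> topspace ?B" if "compactin ?B K" for K
      using compactin_subset_topspace[OF that] by blast
    moreover have "second_countable (subtopology ?B (topspace ?B))"
      using second[OF \<open>?sep\<close>] by (simp only: subtopology_topspace)
    ultimately obtain \<N> where "countable \<N>" "k_network ?B \<N>"
      using countable_k_network_if_second_countable_exhaustion[of ?B "\<lambda>_. topspace ?B"] by blast
    then show ?thesis by (rule aleph_space_if_countable_k_network[OF regular t1])
  qed
  have aleph_E: "aleph_space ?E" if ?sep
  proof -
    have "\<exists>n. K \<subseteq> cball 0 (real n)" if "compactin ?E K" for K
      using bounded_if_weakly_compact[OF that] by blast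
    then obtain \<N> where "countable \<N>" "k_network ?E \<N>"
      using countable_k_network_if_second_countable_exhaustion[of ?E "\<lambda>n. cball 0 (real n)"]
        weak_cball_if_separable_dual(1)[OF \<open>?sep\<close>] by blast
    then show ?thesis
      by (rule aleph_space_if_countable_k_network[OF regular_space_weak_topology t1_space_weak_topology])
  qed
  have cs_E_B: "countable_cs_star_character ?B" if "countable_cs_star_character ?E"
    unfolding weak_unit_ball_def using that by (rule countable_cs_star_character_subtopology)
  have first: ?sep if "first_countable ?B"
    using that t1 separable_dual_if_strong_Pytkeev_ball strong_Pytkeev_space_if_first_countable by blast
  have cs_k: ?sep if "countable_cs_star_character ?B" "k_space ?B"
    using that(1) not_boolean_independent_if_k_space[OF that(2)] by (rule separable_dual_if_cs_star_ball)
  have cs_ell1: ?sep if "countable_cs_star_character ?B" "\<not> (\<exists>T :: (nat \<Rightarrow> real) \<Rightarrow> 'a. ell1_isomorphic_embedding T)"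
  proof (rule separable_dual_if_cs_star_ball[OF that(1)])
    fix r q and y :: "nat \<Rightarrow> 'a" assume "r < (q :: real)" and ball: "range y \<subseteq> cball 0 1"
    have "norm (y n) \<le> 1" for n using subsetD[OF ball, of "y n"] by simp
    then show "\<not> boolean_independent r q y"
      using ell1_embedding_if_boolean_independent[OF _ \<open>r < q\<close>] that(2) by blast
  qed
  note aleph_cs = countable_cs_star_character_if_aleph_space
  have "separable_space ?B \<and> metrizable_space ?B \<longleftrightarrow> ?sep"
    using second metrizable second_countable_imp_separable_space metrizable_imp_first_countable first by blast
  moreover have "metrizable_space ?B \<longleftrightarrow> ?sep"
    using metrizable metrizable_imp_first_countable first by blast
  moreover have "first_countable ?B \<longleftrightarrow> ?sep"
    using metrizable metrizable_imp_first_countable first by blast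
  moreover have "strong_Pytkeev_space ?B \<longleftrightarrow> ?sep"
    using metrizable metrizable_imp_first_countable t1 strong_Pytkeev_space_if_first_countable
      separable_dual_if_strong_Pytkeev_ball by blast
  moreover have "aleph_space ?B \<and> k_space ?B \<longleftrightarrow> ?sep"
    using aleph_B k aleph_cs cs_k by blast
  moreover have "countable_cs_star_character ?B \<and> k_space ?B \<longleftrightarrow> ?sep"
    using aleph_B k aleph_cs cs_k by blast
  moreover have "aleph_space ?E \<and> k_space ?B \<longleftrightarrow> ?sep"
    using aleph_E k aleph_cs cs_E_B cs_k by blast
  moreover have "countable_cs_star_character ?E \<and> k_space ?B \<longleftrightarrow> ?sep"
    using aleph_E k aleph_cs cs_E_B cs_k by blast
  moreover have "countable_cs_star_character ?E \<and>
      \<not> (\<exists>T :: (nat \<Rightarrow> real) \<Rightarrow> 'a. ell1_isomorphic_embedding T) \<longleftrightarrow> ?sep"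
    using aleph_E aleph_cs cs_E_B cs_ell1 no_ell1_embedding_if_separable_dual by blast
  ultimately show ?thesis
    unfolding Let_def by (intro all_equivalentI[where Q = ?sep]) auto
qed

end
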